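(* Let $\pi$ be a set of primes and let $G$ be a finite $\pi$-separable group. Let $\chi \in \mathrm{B}_\pi(G)$, so that $\varphi = \chi^o \in \mathrm{I}_\pi(G)$. Then $\ker \chi = K(\varphi)$.
   Context: All groups are finite. A group is $\pi$-separable if it has a normal series each of whose factors is a $\pi$-group or a $\pi'$-group. $G^o$ denotes the set of $\pi$-elements of $G$ (elements whose order is divisible only by primes in $\pi$), and for a character $\chi$ of $G$, $\chi^o$ denotes its restriction to $G^o$. A $\pi$-partial character of $G$ is a function of the form $\chi^o$ with $\chi$ an ordinary (complex) character of $G$; it is irreducible if it is not a sum of two $\pi$-partial characters; $\mathrm{I}_\pi(G)$ is the set of irreducible $\pi$-partial characters. For a $\pi$-partial character $\varphi$ of $G$, define $L(\varphi) = \langle x \in G^o \mid \varphi(x) = \varphi(1) \rangle$, a normal subgroup of $G$, and define $K(\varphi) \supseteq L(\varphi)$ by $K(\varphi)/L(\varphi) = \mathbf{O}_{\pi'}(G/L(\varphi))$, where $\mathbf{O}_{\pi'}(H)$ is the largest normal $\pi'$-subgroup of $H$. Definition of Isaacs' set $\mathrm{B}_\pi(G) \subseteq \mathrm{Irr}(G)$. A character $\chi \in \mathrm{Irr}(G)$ is $\pi$-special if $\chi(1)$ is a $\pi$-number and, for every subnormal subgroup $S$ of $G$ and every irreducible constituent $\theta$ of $\chi_S$, the determinantal order $o(\theta)$ (the order of the linear character $\det \theta$) is a $\pi$-number; $\pi'$-special is defined likewise with $\pi'$, the complement of $\pi$ in the set of all primes, in place of $\pi$. A character in $\mathrm{Irr}(G)$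 is $\pi$-factored if it is a product of a $\pi$-special and a $\pi'$-special character of $G$. Given $\chi \in \mathrm{Irr}(G)$, consider pairs $(S,\theta)$ with $S$ subnormal in $G$, $\theta \in \mathrm{Irr}(S)$ a $\pi$-factored constituent of $\chi_S$, ordered by $(S,\theta) \le (S_1,\theta_1)$ if $S \le S_1$ and $\theta$ is a constituent of $(\theta_1)_S$. The maximal such pairs are all conjugate in $G$ (known). A nucleus of $\chi$ is a pair $(W,\gamma)$ with $W \le G$, $\gamma \in \mathrm{Irr}(W)$, defined recursively: if $\chi$ is $\pi$-factored, then the nucleus is $(G,\chi)$; otherwise choose a pair $(S,\theta)$ that is maximal, with respect to the ordering $\le$, among the pairs with $S$ subnormal in $G$ and $\theta \in \mathrm{Irr}(S)$ a $\pi$-factored constituent of $\chi_S$, and let $T$ be the stabilizer of $\theta$ in $\mathbf{N}_G(S)$; then (known) $T < G$ and there is a unique $\psi \in \mathrm{Irr}(T)$ lying over $\theta$ with $\psi^G = \chi$, and a nucleus of $\chi$ is defined to be a nucleus of $\psi$. The nucleus is unique up to $G$-conjugacy, and $\gamma$ is $\pi$-factored with $\gamma^G = \chi$. Then $\mathrm{B}_\pi(G)$ is the set of $\chi \in \mathrm{Irr}(G)$ whose nucleus character $\gamma$ is $\pi$-special. It is a known theorem of Isaacs that $\chi \mapsto \chi^o$ is a bijection $\mathrm{B}_\pi(G) \to \mathrm{I}_\pi(G)$. *)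

theory Defs
  imports
    "HOL-Algebra.Group_Action"
    "HOL-Algebra.Generated_Groups"
    "HOL-Algebra.Multiplicative_Group"
    "HOL-Computational_Algebra.Primes"
    "Jordan_Normal_Form.Determinant"
    "Jordan_Normal_Form.VS_Connect"
begin

text \<open>
  A subgroup \<open>H\<close> of \<open>G\<close> is a set, and becomes a group as \<open>G\<lparr>carrier := H\<rparr>\<close>. Functions on a set \<open>X\<close>
  (characters on the group, partial characters on the \<open>\<pi>\<close>-elements) are represented by HOL
  functions that are \<open>undefined\<close> outside \<open>X\<close>, so that restriction is the library's \<open>restrict\<close> and
  equality of functions on \<open>X\<close> is plain equality.
\<close>


section \<open>Complex representations and characters\<close>

definition mat_trace :: "'a::comm_monoid_add mat \<Rightarrow> 'a" where
  "mat_trace A = sum_list (diag_mat A)"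

definition general_linear :: "nat \<Rightarrow> complex mat monoid" where
  "general_linear n = units_of (ring_mat TYPE(complex) n ())"

definition irreducible_rep :: "('a, 'b) monoid_scheme \<Rightarrow> nat \<Rightarrow> ('a \<Rightarrow> complex mat) \<Rightarrow> bool" where
  "irreducible_rep G n \<rho> \<longleftrightarrow>
     n > 0 \<and> \<rho> \<in> hom G (general_linear n) \<and>
     (\<forall>W. subspace class_ring W (module_vec TYPE(complex) n) \<and>
          (\<forall>x\<in>carrier G. \<forall>w\<in>W. \<rho> x *\<^sub>v w \<in> W) \<longrightarrow>
          W = {0\<^sub>v n} \<or> W = carrier_vec n)"

definition affords :: "('a, 'b) monoid_scheme \<Rightarrow> nat \<Rightarrow> ('a \<Rightarrow> complex mat) \<Rightarrow> ('a \<Rightarrow> complex) \<Rightarrow> bool" where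
  "affords G n \<rho> \<chi> \<longleftrightarrow>
     \<rho> \<in> hom G (general_linear n) \<and> \<chi> = restrict (\<lambda>x. mat_trace (\<rho> x)) (carrier G)"

text \<open>The zero function is not a character.\<close>

definition characters :: "('a, 'b) monoid_scheme \<Rightarrow> ('a \<Rightarrow> complex) set" where
  "characters G = {\<chi>. \<exists>n>0. \<exists>\<rho>. affords G n \<rho> \<chi>}"

definition Irr :: "('a, 'b) monoid_scheme \<Rightarrow> ('a \<Rightarrow> complex) set" where
  "Irr G = {\<chi>. \<exists>n \<rho>. irreducible_rep G n \<rho> \<and> affords G n \<rho> \<chi>}"

definition char_kernel :: "('a, 'b) monoid_scheme \<Rightarrow> ('a \<Rightarrow> complex) \<Rightarrow> 'a set" where
  "char_kernel G \<chi> = {x \<in> carrier G. \<chi> x = \<chi> \<one>\<^bsub>G\<^esub>}"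

definition irr_constituents :: "('a, 'b) monoid_scheme \<Rightarrow> ('a \<Rightarrow> complex) \<Rightarrow> ('a \<Rightarrow> complex) set" where
  "irr_constituents G \<psi> =
     {\<theta> \<in> Irr G. \<psi> = \<theta> \<or>
        (\<exists>\<eta>\<in>characters G. \<psi> = restrict (\<lambda>x. \<theta> x + \<eta> x) (carrier G))}"

definition induced_char ::
  "('a, 'b) monoid_scheme \<Rightarrow> 'a set \<Rightarrow> ('a \<Rightarrow> complex) \<Rightarrow> 'a \<Rightarrow> complex" where
  "induced_char G H \<psi> =
     restrict (\<lambda>x. (\<Sum>g \<in> {g \<in> carrier G. g \<otimes>\<^bsub>G\<^esub> x \<otimes>\<^bsub>G\<^esub> inv\<^bsub>G\<^esub> g \<in> H}.
                      \<psi> (g \<otimes>\<^bsub>G\<^esub> x \<otimes>\<^bsub>G\<^esub> inv\<^bsub>G\<^esub> g)) / of_nat (card H))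
       (carrier G)"

text \<open>
  The choice of the representation is immaterial: representations of a finite group over the complex
  numbers affording the same character are similar.
\<close>

definition det_char :: "('a, 'b) monoid_scheme \<Rightarrow> ('a \<Rightarrow> complex) \<Rightarrow> 'a \<Rightarrow> complex" where
  "det_char G \<chi> =
     restrict (\<lambda>x. det ((SOME \<rho>. \<exists>n. affords G n \<rho> \<chi>) x)) (carrier G)"

definition det_order :: "('a, 'b) monoid_scheme \<Rightarrow> ('a \<Rightarrow> complex) \<Rightarrow> nat" where
  "det_order G \<chi> = (LEAST k. k > 0 \<and> (\<forall>x\<in>carrier G. det_char G \<chi> x ^ k = 1))"


section \<open>Notions relative to a set of primes\<close>

definition compl_primes :: "nat set \<Rightarrow> nat set" where
  "compl_primes \<pi> = {p. prime p} - \<pi>"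

definition pi_number :: "nat set \<Rightarrow> nat \<Rightarrow> bool" where
  "pi_number \<pi> n \<longleftrightarrow> n \<noteq> 0 \<and> prime_factors n \<subseteq> \<pi>"

definition pi_group :: "nat set \<Rightarrow> ('a, 'b) monoid_scheme \<Rightarrow> bool" where
  "pi_group \<pi> G \<longleftrightarrow> group G \<and> finite (carrier G) \<and> pi_number \<pi> (Coset.order G)"

text \<open>In a normal series every term is normal in the whole group.\<close>

definition pi_separable :: "nat set \<Rightarrow> ('a, 'b) monoid_scheme \<Rightarrow> bool" where
  "pi_separable \<pi> G \<longleftrightarrow>
     (\<exists>Ns. Ns \<noteq> [] \<and> hd Ns = {\<one>\<^bsub>G\<^esub>} \<and> last Ns = carrier G \<and> (\<forall>N\<in>set Ns. N \<lhd> G) \<and>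
        (\<forall>i. Suc i < length Ns \<longrightarrow> Ns ! i \<subseteq> Ns ! Suc i \<and>
           (pi_group \<pi> (G\<lparr>carrier := Ns ! Suc i\<rparr> Mod Ns ! i) \<or>
            pi_group (compl_primes \<pi>) (G\<lparr>carrier := Ns ! Suc i\<rparr> Mod Ns ! i))))"

definition pi_elements :: "nat set \<Rightarrow> ('a, 'b) monoid_scheme \<Rightarrow> 'a set" where
  "pi_elements \<pi> G = {x \<in> carrier G. pi_number \<pi> (group.ord G x)}"

definition pi_restriction ::
  "nat set \<Rightarrow> ('a, 'b) monoid_scheme \<Rightarrow> ('a \<Rightarrow> complex) \<Rightarrow> 'a \<Rightarrow> complex" where
  "pi_restriction \<pi> G \<chi> = restrict \<chi> (pi_elements \<pi> G)"

text \<open>The largest (with respect to inclusion) normal \<open>\<pi>\<close>-subgroup.\<close>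

definition pi_core :: "nat set \<Rightarrow> ('a, 'b) monoid_scheme \<Rightarrow> 'a set" where
  "pi_core \<pi> G = (GREATEST N. N \<lhd> G \<and> pi_group \<pi> (G\<lparr>carrier := N\<rparr>))"

definition partial_L :: "nat set \<Rightarrow> ('a, 'b) monoid_scheme \<Rightarrow> ('a \<Rightarrow> complex) \<Rightarrow> 'a set" where
  "partial_L \<pi> G \<phi> = generate G {x \<in> pi_elements \<pi> G. \<phi> x = \<phi> \<one>\<^bsub>G\<^esub>}"

text \<open>The preimage in \<open>G\<close> of the \<open>\<pi>'\<close>-core of the quotient by \<open>partial_L\<close>.\<close>

definition partial_K :: "nat set \<Rightarrow> ('a, 'b) monoid_scheme \<Rightarrow> ('a \<Rightarrow> complex) \<Rightarrow> 'a set" where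
  "partial_K \<pi> G \<phi> =
     {x \<in> carrier G. partial_L \<pi> G \<phi> #>\<^bsub>G\<^esub> x \<in> pi_core (compl_primes \<pi>) (G Mod partial_L \<pi> G \<phi>)}"


section \<open>Special and factored characters\<close>

inductive subnormal :: "('a, 'b) monoid_scheme \<Rightarrow> 'a set \<Rightarrow> bool" for G where
  whole: "subnormal G (carrier G)"
| step: "subnormal G S \<Longrightarrow> N \<lhd> G\<lparr>carrier := S\<rparr> \<Longrightarrow> subnormal G N"

definition pi_special :: "nat set \<Rightarrow> ('a, 'b) monoid_scheme \<Rightarrow> ('a \<Rightarrow> complex) \<Rightarrow> bool" where
  "pi_special \<pi> G \<chi> \<longleftrightarrow>
     \<chi> \<in> Irr G \<and>
     (\<exists>d. \<chi> \<one>\<^bsub>G\<^esub> = of_nat d \<and> pi_number \<pi> d) \<and>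
     (\<forall>S \<theta>. subnormal G S \<and> \<theta> \<in> irr_constituents (G\<lparr>carrier := S\<rparr>) (restrict \<chi> S) \<longrightarrow>
        pi_number \<pi> (det_order (G\<lparr>carrier := S\<rparr>) \<theta>))"

definition pi_factored :: "nat set \<Rightarrow> ('a, 'b) monoid_scheme \<Rightarrow> ('a \<Rightarrow> complex) \<Rightarrow> bool" where
  "pi_factored \<pi> G \<chi> \<longleftrightarrow>
     \<chi> \<in> Irr G \<and>
     (\<exists>\<alpha> \<beta>. pi_special \<pi> G \<alpha> \<and> pi_special (compl_primes \<pi>) G \<beta> \<and>
        \<chi> = restrict (\<lambda>x. \<alpha> x * \<beta> x) (carrier G))"


section \<open>Nuclei and the set \<open>B\<^sub>\<pi>\<close>\<close>

definition factored_pairs ::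
  "nat set \<Rightarrow> ('a, 'b) monoid_scheme \<Rightarrow> ('a \<Rightarrow> complex) \<Rightarrow> ('a set \<times> ('a \<Rightarrow> complex)) set" where
  "factored_pairs \<pi> G \<chi> =
     {(S, \<theta>). subnormal G S \<and> pi_factored \<pi> (G\<lparr>carrier := S\<rparr>) \<theta> \<and>
        \<theta> \<in> irr_constituents (G\<lparr>carrier := S\<rparr>) (restrict \<chi> S)}"

definition pair_le ::
  "('a, 'b) monoid_scheme \<Rightarrow> 'a set \<times> ('a \<Rightarrow> complex) \<Rightarrow> 'a set \<times> ('a \<Rightarrow> complex) \<Rightarrow> bool" where
  "pair_le G P Q \<longleftrightarrow>
     fst P \<subseteq> fst Q \<and> snd P \<in> irr_constituents (G\<lparr>carrier := fst P\<rparr>) (restrict (snd Q) (fst P))"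

definition maximal_factored_pair ::
  "nat set \<Rightarrow> ('a, 'b) monoid_scheme \<Rightarrow> ('a \<Rightarrow> complex) \<Rightarrow> 'a set \<times> ('a \<Rightarrow> complex) \<Rightarrow> bool" where
  "maximal_factored_pair \<pi> G \<chi> P \<longleftrightarrow>
     P \<in> factored_pairs \<pi> G \<chi> \<and> (\<forall>Q\<in>factored_pairs \<pi> G \<chi>. pair_le G P Q \<longrightarrow> Q = P)"

definition inertia_in_normalizer ::
  "('a, 'b) monoid_scheme \<Rightarrow> 'a set \<Rightarrow> ('a \<Rightarrow> complex) \<Rightarrow> 'a set" where
  "inertia_in_normalizer G S \<theta> =
     {g \<in> normalizer G S. \<forall>s\<in>S. \<theta> (g \<otimes>\<^bsub>G\<^esub> s \<otimes>\<^bsub>G\<^esub> inv\<^bsub>G\<^esub> g) = \<theta> s}"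

text \<open>
  \<open>nucleus \<pi> G \<chi> W \<gamma>\<close>: the pair \<open>(W, \<gamma>)\<close> is a nucleus of \<open>\<chi> \<in> Irr G\<close>. It is a relation because the
  nucleus is only unique up to conjugacy. In the recursive step the group itself is replaced by the
  proper subgroup \<open>T\<close>.
\<close>

inductive nucleus ::
  "nat set \<Rightarrow> ('a, 'b) monoid_scheme \<Rightarrow> ('a \<Rightarrow> complex) \<Rightarrow> 'a set \<Rightarrow> ('a \<Rightarrow> complex) \<Rightarrow> bool"
  for \<pi> where
  factored: "pi_factored \<pi> G \<chi> \<Longrightarrow> nucleus \<pi> G \<chi> (carrier G) \<chi>"
| induce: "\<chi> \<in> Irr G \<Longrightarrow> \<not> pi_factored \<pi> G \<chi> \<Longrightarrow>
    maximal_factored_pair \<pi> G \<chi> (S, \<theta>) \<Longrightarrow>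
    T = inertia_in_normalizer G S \<theta> \<Longrightarrow>
    \<psi> \<in> Irr (G\<lparr>carrier := T\<rparr>) \<Longrightarrow>
    \<theta> \<in> irr_constituents (G\<lparr>carrier := S\<rparr>) (restrict \<psi> S) \<Longrightarrow>
    induced_char G T \<psi> = \<chi> \<Longrightarrow>
    nucleus \<pi> (G\<lparr>carrier := T\<rparr>) \<psi> W \<gamma> \<Longrightarrow>
    nucleus \<pi> G \<chi> W \<gamma>"

definition B_pi :: "nat set \<Rightarrow> ('a, 'b) monoid_scheme \<Rightarrow> ('a \<Rightarrow> complex) set" where
  "B_pi \<pi> G = {\<chi> \<in> Irr G. \<exists>W \<gamma>. nucleus \<pi> G \<chi> W \<gamma> \<and> pi_special \<pi> (G\<lparr>carrier := W\<rparr>) \<gamma>}"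

end

theory Submission
  imports
    Defs
    "Jordan_Normal_Form.Schur_Decomposition"
    "Jordan_Normal_Form.Spectral_Radius"
    "HOL-Algebra.Sylow"
    "HOL-Algebra.SndIsomorphismGrp"
begin

text \<open>
  Let \<open>L = L(\<phi>)\<close>. All \<open>\<pi>\<close>-elements of \<open>ker \<chi>\<close> lie in \<open>L\<close>, so \<open>ker \<chi> / L\<close> is a \<open>\<pi>'\<close>-group and
  \<open>ker \<chi> \<le> K(\<phi>)\<close>. For the converse write \<open>\<chi> = \<gamma>\<^sup>G\<close> with \<open>(W, \<gamma>)\<close> a nucleus and \<open>\<gamma>\<close> \<open>\<pi>\<close>-special, and let
  \<open>N = K(\<phi>)\<close>. Then \<open>L \<le> ker \<gamma>\<close>, and the constituents of \<open>\<gamma>\<close> on the \<open>\<pi>'\<close>-section \<open>(N \<inter> W) / L\<close> have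
  degree dividing both \<open>\<gamma>(1)\<close> (Clifford) and the group order (Frobenius), so they are linear, and they
  have \<open>\<pi>\<close>-order; hence \<open>N \<inter> W \<le> ker \<gamma>\<close>. The formula for induced characters now shows that \<open>\<chi>\<close> is
  nonnegative on \<open>N\<close>, so \<open>\<chi>\<^sub>N\<close> contains the trivial character, and irreducibility of \<open>\<chi>\<close> forces
  \<open>N \<le> ker \<chi>\<close>.
\<close>


section \<open>Traces and matrices of finite order\<close>

text \<open>The obstacle is that N is not known in advance to lie in W. The hypothesis on \<gamma>
  says nothing outside W, and the kernel of \<chi> is the intersection of all conjugates of the
  kernel of \<gamma>, so trivial action of N \<inter> W under \<gamma> is still far from N lying in
  the kernel of \<chi>. Normality of N bridges the gap: a conjugate of an element of N that falls
  into W falls into N \<inter> W, where \<gamma> is constant. That L lies in W and in the kernel of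
  \<gamma> has a different reason. Every term of the formula for \<chi>(x) has real part at most
  \<gamma>(1), so \<chi>(x) = \<chi>(1) forces every single term to be maximal, in particular the
  one in which x is not conjugated. Both passages from a trivial constituent to trivial action
  (\<gamma> on N \<inter> W, \<chi> on N) use one fact: the vectors fixed by a normal subgroup form
  an invariant subspace of an irreducible representation. Characters enter as traces of matrix
  representations. A bound on traces of matrices of finite order turns equality of character values
  into equality of matrices, and the rest is linear algebra with these matrices.\<close>

lemma mat_trace_sum:
  assumes "A \<in> carrier_mat n n"
  shows "mat_trace A = (\<Sum>i<n. A $$ (i,i))"
  using assms by (simp add: mat_trace_def diag_mat_def sum_list_sum_nth atLeast0LessThan)

lemma mult_mat_index:
  assumes "A \<in> carrier_mat n m" "B \<in> carrier_mat m k" "i < n" "j < k"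
  shows "(A * B) $$ (i,j) = (\<Sum>l<m. A $$ (i,l) * B $$ (l,j))"
  using assms by (auto simp: scalar_prod_def atLeast0LessThan)

lemma mult_mat_vec_index:
  assumes "A \<in> carrier_mat n m" "v \<in> carrier_vec m" "i < n"
  shows "(A *\<^sub>v v) $ i = (\<Sum>l<m. A $$ (i,l) * v $ l)"
  using assms by (auto simp: scalar_prod_def atLeast0LessThan)

lemma mat_trace_comm:
  fixes A B :: "'a :: comm_semiring_0 mat"
  assumes A: "A \<in> carrier_mat n m" and B: "B \<in> carrier_mat m n"
  shows "mat_trace (A * B) = mat_trace (B * A)"
proof -
  have "mat_trace (A * B) = (\<Sum>i<n. \<Sum>l<m. A $$ (i,l) * B $$ (l,i))"
    using mat_trace_sum[OF mult_carrier_mat[OF A B]] mult_mat_index[OF A B] by simp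
  also have "\<dots> = (\<Sum>l<m. \<Sum>i<n. B $$ (l,i) * A $$ (i,l))"
    by (subst sum.swap) (simp add: mult.commute)
  also have "\<dots> = mat_trace (B * A)"
    using mat_trace_sum[OF mult_carrier_mat[OF B A]] mult_mat_index[OF B A] by simp
  finally show ?thesis .
qed

lemma mat_trace_one: "mat_trace (1\<^sub>m n) = of_nat n"
  by (subst mat_trace_sum[of _ n]) auto

lemma mat_trace_intertwine:
  fixes A :: "'a :: comm_ring_1 mat"
  assumes c: "A \<in> carrier_mat n n" "D \<in> carrier_mat n n" "S \<in> carrier_mat n n" "S' \<in> carrier_mat n n"
    and inv: "S * S' = 1\<^sub>m n" "S' * S = 1\<^sub>m n" and eq: "A * S = S * D"
  shows "mat_trace A = mat_trace D"
proof -
  have "A = A * (S * S')" using c inv by simp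
  also have "\<dots> = S * D * S'" using c eq by (simp flip: assoc_mult_mat)
  also have "\<dots> = S * (D * S')" using c by simp
  finally have "mat_trace A = mat_trace (S * (D * S'))" by simp
  also have "\<dots> = mat_trace (D * S' * S)" using c by (intro mat_trace_comm) auto
  also have "D * S' * S = D" using c inv by simp
  finally show ?thesis .
qed

section \<open>Triangular matrices and unipotence in characteristic 0\<close>

lemma upper_triangular_mult:
  fixes A B :: "'a :: comm_ring_1 mat"
  assumes A: "A \<in> carrier_mat n n" "upper_triangular A" and B: "B \<in> carrier_mat n n" "upper_triangular B"
  shows "upper_triangular (A * B)"
proof (rule upper_triangularI)
  fix i j assume ij: "j < i" "i < dim_row (A * B)"
  have "A $$ (i,l) * B $$ (l,j) = 0" if "l < n" for l
    using ij that A B upper_triangularD[of A l i] upper_triangularD[of B j l] by (cases "l < i") auto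
  then show "(A * B) $$ (i,j) = 0"
    using mult_mat_index[OF A(1) B(1), of i j] ij A B by simp
qed

lemma upper_triangular_mult_diag:
  fixes A B :: "'a :: comm_ring_1 mat"
  assumes A: "A \<in> carrier_mat n n" "upper_triangular A" and B: "B \<in> carrier_mat n n" "upper_triangular B"
    and i: "i < n"
  shows "(A * B) $$ (i,i) = A $$ (i,i) * B $$ (i,i)"
proof -
  have "A $$ (i,l) * B $$ (l,i) = (if l = i then A $$ (i,i) * B $$ (i,i) else 0)" if "l < n" for l
    using i that A B upper_triangularD[of A l i] upper_triangularD[of B i l]
    by (cases l i rule: linorder_cases) auto
  then have "(\<Sum>l<n. A $$ (i,l) * B $$ (l,i)) = (\<Sum>l<n. if l = i then A $$ (i,i) * B $$ (i,i) else 0)"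
    by (intro sum.cong) auto
  also have "\<dots> = A $$ (i,i) * B $$ (i,i)" using i by simp
  finally show ?thesis unfolding mult_mat_index[OF A(1) B(1) i i] .
qed

lemma upper_triangular_pow:
  fixes A :: "'a :: comm_ring_1 mat"
  assumes A: "A \<in> carrier_mat n n" "upper_triangular A"
  shows "upper_triangular (A ^\<^sub>m k) \<and> (\<forall>i<n. (A ^\<^sub>m k) $$ (i,i) = (A $$ (i,i)) ^ k)"
proof (induction k)
  case 0 then show ?case using A by auto
next
  case (Suc k)
  have "A ^\<^sub>m k \<in> carrier_mat n n" using A by simp
  from upper_triangular_mult[OF this _ A] upper_triangular_mult_diag[OF this _ A] Suc show ?case by simp
qed

text \<open>A Jordan block of size two makes v drift linearly in k. In characteristic 0 the drift
  never returns to zero, so finite order will force u = 0.\<close>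

lemma pow_mat_fix_affine:
  fixes A :: "'a :: field_char_0 mat"
  assumes A: "A \<in> carrier_mat n n" and v: "v \<in> carrier_vec n" "u \<in> carrier_vec n"
    and Av: "A *\<^sub>v v = v + u" and Au: "A *\<^sub>v u = u"
  shows "A ^\<^sub>m k *\<^sub>v v = v + of_nat k \<cdot>\<^sub>v u"
proof (induction k)
  case 0 then show ?case using A v by auto
next
  case (Suc k)
  have "A ^\<^sub>m k *\<^sub>v u = u"
    by (induction k) (use A v Au in \<open>auto simp: assoc_mult_mat_vec[of _ n n _ n]\<close>)
  then have "A ^\<^sub>m Suc k *\<^sub>v v = (v + of_nat k \<cdot>\<^sub>v u) + u"
    using A v Av Suc by (simp add: assoc_mult_mat_vec[of _ n n _ n] mult_add_distrib_mat_vec[of _ n n])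
  then show ?case using v by (auto simp: algebra_simps intro!: eq_vecI)
qed

text \<open>The columns are treated from left to right. The difference u between column j and the
  j-th unit vector is supported on coordinates below j, where B is already known to act as the
  identity; so B fixes u, and B having finite order gives k u = 0.\<close>

lemma upper_triangular_unipotent_finite_order:
  fixes B :: "complex mat"
  assumes B: "B \<in> carrier_mat n n" "upper_triangular B" and diag: "\<And>i. i < n \<Longrightarrow> B $$ (i,i) = 1"
    and k: "k > 0" "B ^\<^sub>m k = 1\<^sub>m n"
  shows "B = 1\<^sub>m n"
proof -
  have "B *\<^sub>v unit_vec n j = unit_vec n j" if "j < n" for j
    using that
  proof (induction j rule: less_induct)
    case (less j)
    define u where "u = B *\<^sub>v unit_vec n j - unit_vec n j"
    have u: "u \<in> carrier_vec n" using B by (simp add: u_def)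
    have col: "B *\<^sub>v unit_vec n i = col B i" if "i < n" for i
      using that B by (intro eq_vecI) auto
    have u0: "u $ i = 0" if "j \<le> i" "i < n" for i
      using that less.prems B diag unfolding u_def col[OF less.prems] by (cases "i = j") auto
    have "B *\<^sub>v u = u"
    proof (intro eq_vecI)
      fix i assume "i < dim_vec u"
      then have i: "i < n" using u by simp
      have "B $$ (i,l) * u $ l = (if l = i then u $ i else 0)" if "l < n" for l
      proof (cases "l < j")
        case True
        have "B $$ (i,l) = (B *\<^sub>v unit_vec n l) $ i" using col[OF \<open>l < n\<close>] i that B by simp
        also have "\<dots> = (if l = i then 1 else 0)" using less.IH[OF True] that i by simp
        finally show ?thesis by simp
      next
        case False
        then show ?thesis using u0 that i by auto
      qed
      then have "(\<Sum>l<n. B $$ (i,l) * u $ l) = u $ i" using i by (simp add: sum.delta')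
      then show "(B *\<^sub>v u) $ i = u $ i" using mult_mat_vec_index[OF B(1) u i] by simp
    qed (use B u in auto)
    moreover have "B *\<^sub>v unit_vec n j = unit_vec n j + u"
      unfolding u_def using B by (intro eq_vecI) auto
    ultimately have "B ^\<^sub>m k *\<^sub>v unit_vec n j = unit_vec n j + of_nat k \<cdot>\<^sub>v u"
      using pow_mat_fix_affine[OF B(1) _ u] by auto
    then have eq: "unit_vec n j = unit_vec n j + of_nat k \<cdot>\<^sub>v u" using k by simp
    have "u $ i = 0" if "i < n" for i
    proof -
      have "unit_vec n j $ i = unit_vec n j $ i + of_nat k * u $ i"
        using arg_cong[OF eq, of "\<lambda>v. v $ i"] that u by simp
      then show ?thesis using k by simp
    qed
    then have "u = 0\<^sub>v n" using u by (intro eq_vecI) auto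
    then show ?case using \<open>B *\<^sub>v unit_vec n j = unit_vec n j + u\<close> by simp
  qed
  then have "col B j = col (1\<^sub>m n) j" if "j < n" for j
  proof -
    have "B *\<^sub>v unit_vec n j = col B j" using that B by (intro eq_vecI) auto
    then show ?thesis using \<open>j < n \<Longrightarrow> B *\<^sub>v unit_vec n j = unit_vec n j\<close> that by simp
  qed
  then show ?thesis using B by (intro mat_col_eqI) auto
qed

lemma root_of_unity_Re:
  fixes z :: complex
  assumes "z ^ k = 1" "k > 0"
  shows "Re z \<le> 1" "Re z = 1 \<Longrightarrow> z = 1"
proof -
  have "norm z ^ k = 1" using assms(1) by (metis norm_one norm_power)
  then have "norm z = 1" using power_eq_imp_eq_base[of "norm z" k 1] assms(2) by simp
  then show "Re z \<le> 1" using complex_Re_le_cmod[of z] by simp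
  show "z = 1" if "Re z = 1"
    using that \<open>norm z = 1\<close> by (auto simp: cmod_def complex_eq_iff)
qed

text \<open>Schur's triangular form takes the place of a diagonalization. The diagonal entries are
  k-th roots of unity, hence have real part at most 1; if their sum reaches n, they are all 1, and
  the triangular matrix is unipotent of finite order.\<close>

lemma trace_finite_order:
  fixes A :: "complex mat"
  assumes A: "A \<in> carrier_mat n n" and k: "k > 0" "A ^\<^sub>m k = 1\<^sub>m n"
  shows "Re (mat_trace A) \<le> real n" "Re (mat_trace A) = real n \<Longrightarrow> A = 1\<^sub>m n"
proof -
  obtain as where "char_poly A = (\<Prod>a\<leftarrow>as. [:- a, 1:])" using char_poly_factorized[OF A] by auto
  from schur_decomposition_exists[OF A this] obtain B
    where B: "B \<in> carrier_mat n n" "upper_triangular B" and sim: "similar_mat A B" by auto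
  then obtain P Q where wit: "similar_mat_wit A B P Q" by (auto simp: similar_mat_def)
  note w = similar_mat_witD2[OF A wit]
  have "Q * A ^\<^sub>m k * P = B ^\<^sub>m k"
    using similar_mat_wit_pow[OF wit, of k] similar_mat_witD2[of "A ^\<^sub>m k" n n "B ^\<^sub>m k" P Q] A
    by (smt (verit) assoc_mult_mat left_mult_one_mat pow_carrier_mat right_mult_one_mat mult_carrier_mat)
  then have Bk: "B ^\<^sub>m k = 1\<^sub>m n" using k w by simp
  have d: "(B $$ (i,i)) ^ k = 1" if "i < n" for i
    using upper_triangular_pow[OF B, of k] Bk that by auto
  have "A * P = P * B" unfolding w(3) using w by (simp add: assoc_mult_mat[of _ n n _ n _ n])
  then have tr: "mat_trace A = (\<Sum>i<n. B $$ (i,i))"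
    using mat_trace_intertwine[of A n B P Q] w mat_trace_sum[OF B(1)] by simp
  have le: "Re (B $$ (i,i)) \<le> 1" if "i < n" for i using root_of_unity_Re[OF d[OF that] k(1)] by simp
  show "Re (mat_trace A) \<le> real n"
    unfolding tr Re_sum using sum_mono[of "{..<n}" "\<lambda>i. Re (B $$ (i,i))" "\<lambda>_. 1"] le by simp
  assume "Re (mat_trace A) = real n"
  then have "(\<Sum>i<n. 1 - Re (B $$ (i,i))) = 0" unfolding tr Re_sum by (simp add: sum_subtractf)
  then have "1 - Re (B $$ (i,i)) = 0" if "i < n" for i
    using le that by (subst (asm) sum_nonneg_eq_0_iff) auto
  then have "B $$ (i,i) = 1" if "i < n" for i
    using root_of_unity_Re(2)[OF d[OF that] k(1)] that by simp
  then have "B = 1\<^sub>m n" using upper_triangular_unipotent_finite_order[OF B _ k(1) Bk] by simp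
  with w(3) have "A = P * 1\<^sub>m n * Q" by simp
  then show "A = 1\<^sub>m n" using w(1,6,7) by simp
qed


section \<open>Subspaces as column spaces\<close>

definition vec_subspace :: "nat \<Rightarrow> 'a :: field vec set \<Rightarrow> bool" where
  "vec_subspace n W \<longleftrightarrow> W \<subseteq> carrier_vec n \<and> 0\<^sub>v n \<in> W \<and>
     (\<forall>u\<in>W. \<forall>v\<in>W. u + v \<in> W) \<and> (\<forall>c. \<forall>v\<in>W. c \<cdot>\<^sub>v v \<in> W)"

text \<open>The bridge from the subspaces in the definition of \<open>irreducible_rep\<close> to
  closure conditions that can be checked directly.\<close>

lemma subspace_module_vec_iff:
  "subspace class_ring W (module_vec TYPE(complex) n) \<longleftrightarrow> vec_subspace n W"
proof
  assume "subspace class_ring W (module_vec TYPE(complex) n)"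
  then have "submodule class_ring W (module_vec TYPE(complex) n)" by (simp add: subspace.submod)
  then show "vec_subspace n W"
    unfolding submodule_def vec_subspace_def by (auto simp: module_vec_simps)
next
  assume W: "vec_subspace n W"
  interpret M: Module.module class_ring "module_vec TYPE(complex) n" by (rule vec_module)
  have "submodule class_ring W (module_vec TYPE(complex) n)"
    using W M.module_axioms unfolding submodule_def vec_subspace_def by (auto simp: module_vec_simps)
  then show "subspace class_ring W (module_vec TYPE(complex) n)"
    using vec_vs by (auto intro: subspace.intro)
qed

lemma vec_subspaceD:
  assumes "vec_subspace n W"
  shows "W \<subseteq> carrier_vec n" "0\<^sub>v n \<in> W" "u \<in> W \<Longrightarrow> v \<in> W \<Longrightarrow> u + v \<in> W" "v \<in> W \<Longrightarrow> c \<cdot>\<^sub>v v \<in> W"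
  using assms by (auto simp: vec_subspace_def)

text \<open>
  Subspaces are handled as column spaces of injective matrices, so that the dimension is the number of
  columns and a direct sum is a horizontal concatenation.
\<close>

definition inj_mat :: "nat \<Rightarrow> nat \<Rightarrow> 'a :: field mat \<Rightarrow> bool" where
  "inj_mat n r B \<longleftrightarrow> B \<in> carrier_mat n r \<and> (\<forall>v\<in>carrier_vec r. B *\<^sub>v v = 0\<^sub>v n \<longrightarrow> v = 0\<^sub>v r)"

definition mat_range :: "nat \<Rightarrow> 'a :: field mat \<Rightarrow> 'a vec set" where
  "mat_range r B = (\<lambda>v. B *\<^sub>v v) ` carrier_vec r"

definition hcat :: "'a mat \<Rightarrow> 'a mat \<Rightarrow> 'a mat" where
  "hcat A B = mat (dim_row A) (dim_col A + dim_col B)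
     (\<lambda>(i,j). if j < dim_col A then A $$ (i,j) else B $$ (i, j - dim_col A))"

lemma hcat_carrier [simp]:
  "A \<in> carrier_mat n r \<Longrightarrow> B \<in> carrier_mat n s \<Longrightarrow> hcat A B \<in> carrier_mat n (r + s)"
  by (auto simp: hcat_def)

lemma hcat_assoc:
  "A \<in> carrier_mat n r \<Longrightarrow> B \<in> carrier_mat n s \<Longrightarrow> C \<in> carrier_mat n t \<Longrightarrow>
    hcat (hcat A B) C = hcat A (hcat B C)"
  by (rule eq_matI) (auto simp: hcat_def)

lemma sum_lessThan_add:
  fixes f :: "nat \<Rightarrow> 'a :: comm_monoid_add"
  shows "(\<Sum>l<r+s. f l) = (\<Sum>l<r. f l) + (\<Sum>l<s. f (r + l))"
  by (induction s) (auto simp: add.assoc)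

lemma hcat_mult_vec:
  fixes A B :: "'a :: field mat"
  assumes A: "A \<in> carrier_mat n r" and B: "B \<in> carrier_mat n s"
    and x: "x \<in> carrier_vec r" and y: "y \<in> carrier_vec s"
  shows "hcat A B *\<^sub>v (x @\<^sub>v y) = A *\<^sub>v x + B *\<^sub>v y"
proof (rule eq_vecI)
  fix i assume "i < dim_vec (A *\<^sub>v x + B *\<^sub>v y)"
  then have i: "i < n" using B by simp
  have "(hcat A B *\<^sub>v (x @\<^sub>v y)) $ i = (\<Sum>l<r+s. hcat A B $$ (i,l) * (x @\<^sub>v y) $ l)"
    using mult_mat_vec_index[OF hcat_carrier[OF A B] append_carrier_vec[OF x y] i] .
  also have "\<dots> = (\<Sum>l<r. hcat A B $$ (i,l) * (x @\<^sub>v y) $ l)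
      + (\<Sum>l<s. hcat A B $$ (i,r+l) * (x @\<^sub>v y) $ (r+l))"
    by (rule sum_lessThan_add)
  also have "\<dots> = (\<Sum>l<r. A $$ (i,l) * x $ l) + (\<Sum>l<s. B $$ (i,l) * y $ l)"
    using A B x y i by (intro arg_cong2[of _ _ _ _ "(+)"] sum.cong) (auto simp: hcat_def)
  also have "\<dots> = (A *\<^sub>v x + B *\<^sub>v y) $ i"
    using mult_mat_vec_index[OF A x i] mult_mat_vec_index[OF B y i] A B i by simp
  finally show "(hcat A B *\<^sub>v (x @\<^sub>v y)) $ i = (A *\<^sub>v x + B *\<^sub>v y) $ i" .
qed (use A B in \<open>auto simp: hcat_def\<close>)

lemma carrier_vec_append_cases:
  assumes "v \<in> carrier_vec (r + s)"
  obtains x y where "x \<in> carrier_vec r" "y \<in> carrier_vec s" "v = x @\<^sub>v y"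
  using assms vec_first_last_append vec_first_carrier vec_last_carrier by metis

lemma mat_range_hcat:
  fixes A B :: "'a :: field mat"
  assumes A: "A \<in> carrier_mat n r" and B: "B \<in> carrier_mat n s"
  shows "mat_range (r + s) (hcat A B) = {u + w |u w. u \<in> mat_range r A \<and> w \<in> mat_range s B}"
proof (intro equalityI subsetI)
  fix v assume "v \<in> mat_range (r + s) (hcat A B)"
  then obtain x y where "x \<in> carrier_vec r" "y \<in> carrier_vec s" "v = hcat A B *\<^sub>v (x @\<^sub>v y)"
    unfolding mat_range_def by (auto elim!: carrier_vec_append_cases)
  then show "v \<in> {u + w |u w. u \<in> mat_range r A \<and> w \<in> mat_range s B}"
    using hcat_mult_vec[OF A B] by (auto simp: mat_range_def)
next
  fix v assume "v \<in> {u + w |u w. u \<in> mat_range r A \<and> w \<in> mat_range s B}"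
  then obtain x y where "x \<in> carrier_vec r" "y \<in> carrier_vec s" "v = A *\<^sub>v x + B *\<^sub>v y"
    unfolding mat_range_def by auto
  then show "v \<in> mat_range (r + s) (hcat A B)"
    using hcat_mult_vec[OF A B] unfolding mat_range_def
    by (auto intro!: image_eqI[of _ _ "x @\<^sub>v y"])
qed

lemma mat_range_subspace:
  assumes "A \<in> carrier_mat n r"
  shows "vec_subspace n (mat_range r A)"
  unfolding vec_subspace_def
proof (intro conjI ballI allI)
  show "mat_range r A \<subseteq> carrier_vec n" using assms by (auto simp: mat_range_def)
  show "0\<^sub>v n \<in> mat_range r A"
    using assms unfolding mat_range_def by (intro image_eqI[of _ _ "0\<^sub>v r"]) auto
  fix u c assume "u \<in> mat_range r A"
  then obtain x where x: "x \<in> carrier_vec r" "u = A *\<^sub>v x" by (auto simp: mat_range_def)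
  then show "c \<cdot>\<^sub>v u \<in> mat_range r A"
    using assms mult_mat_vec[OF assms x(1), of c] unfolding mat_range_def
    by (intro image_eqI[of _ _ "c \<cdot>\<^sub>v x"]) auto
  fix v assume "v \<in> mat_range r A"
  then obtain y where y: "y \<in> carrier_vec r" "v = A *\<^sub>v y" by (auto simp: mat_range_def)
  then show "u + v \<in> mat_range r A"
    using x mult_add_distrib_mat_vec[OF assms x(1) y(1)] unfolding mat_range_def
    by (intro image_eqI[of _ _ "x + y"]) auto
qed

text \<open>The hypothesis on B packs two facts into one: B is injective, because 0 lies in the
  range of A, and its range meets that of A only in 0.\<close>

lemma inj_mat_hcat:
  fixes A B :: "'a :: field mat"
  assumes A: "inj_mat n r A" and B: "B \<in> carrier_mat n s"
    and AB: "\<And>y. y \<in> carrier_vec s \<Longrightarrow> B *\<^sub>v y \<in> mat_range r A \<Longrightarrow> y = 0\<^sub>v s"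
  shows "inj_mat n (r + s) (hcat A B)"
  unfolding inj_mat_def
proof (intro conjI ballI impI)
  have Ac: "A \<in> carrier_mat n r" using A by (simp add: inj_mat_def)
  show "hcat A B \<in> carrier_mat n (r + s)" using Ac B by simp
  fix v assume v: "v \<in> carrier_vec (r + s)" and 0: "hcat A B *\<^sub>v v = 0\<^sub>v n"
  then obtain x y where xy: "x \<in> carrier_vec r" "y \<in> carrier_vec s" "v = x @\<^sub>v y"
    by (auto elim!: carrier_vec_append_cases)
  then have eq: "A *\<^sub>v x + B *\<^sub>v y = 0\<^sub>v n" using 0 hcat_mult_vec[OF Ac B] by simp
  have Ax: "A *\<^sub>v x \<in> carrier_vec n" and By: "B *\<^sub>v y \<in> carrier_vec n" using Ac B xy by auto
  have "B *\<^sub>v y = A *\<^sub>v ((-1) \<cdot>\<^sub>v x)"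
  proof (rule eq_vecI)
    fix i assume "i < dim_vec (A *\<^sub>v ((-1) \<cdot>\<^sub>v x))"
    then have i: "i < n" using Ac by simp
    have "(A *\<^sub>v x) $ i + (B *\<^sub>v y) $ i = 0"
      using arg_cong[OF eq, of "\<lambda>v. v $ i"] i B by simp
    then show "(B *\<^sub>v y) $ i = (A *\<^sub>v ((-1) \<cdot>\<^sub>v x)) $ i"
      unfolding mult_mat_vec[OF Ac xy(1)] using i Ax By Ac by (simp add: eq_neg_iff_add_eq_0 add.commute)
  qed (use Ac B in auto)
  then have "B *\<^sub>v y \<in> mat_range r A" using xy by (auto simp: mat_range_def)
  then have y: "y = 0\<^sub>v s" using AB xy by simp
  then have "B *\<^sub>v y = 0\<^sub>v n" using B by auto
  then have "A *\<^sub>v x = 0\<^sub>v n" using eq Ax by simp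
  then have "x = 0\<^sub>v r" using A xy by (simp add: inj_mat_def)
  then show "v = 0\<^sub>v (r + s)" using xy y by auto
qed

text \<open>If r > n, zero rows make the matrix square. Row n (counted from 0) of the padded matrix
  vanishes, so its transpose kills a unit vector, the determinant is 0, and a kernel vector of the
  padded matrix is one of B.\<close>

lemma inj_mat_dim_le:
  fixes B :: "'a :: field mat"
  assumes "inj_mat n r B"
  shows "r \<le> n"
proof (rule ccontr)
  assume nr: "\<not> r \<le> n"
  have B: "B \<in> carrier_mat n r" using assms by (simp add: inj_mat_def)
  define C where "C = mat r r (\<lambda>(i,j). if i < n then B $$ (i,j) else 0)"
  have C: "C \<in> carrier_mat r r" by (simp add: C_def)
  have "transpose_mat C *\<^sub>v unit_vec r n = 0\<^sub>v r"
    by (rule eq_vecI) (use nr in \<open>auto simp: C_def\<close>)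
  moreover have "unit_vec r n \<noteq> 0\<^sub>v r" using nr by (metis index_unit_vec(1) index_zero_vec(1) not_le zero_neq_one)
  ultimately have "\<exists>v. v \<in> carrier_vec r \<and> v \<noteq> 0\<^sub>v r \<and> transpose_mat C *\<^sub>v v = 0\<^sub>v r"
    using unit_vec_carrier[of r n] by (intro exI[of _ "unit_vec r n"] conjI)
  then have "det (transpose_mat C) = 0"
    using det_0_iff_vec_prod_zero_field[of "transpose_mat C" r] C by simp
  then have "det C = 0" using det_transpose[OF C] by simp
  then obtain v where v: "v \<in> carrier_vec r" "v \<noteq> 0\<^sub>v r" "C *\<^sub>v v = 0\<^sub>v r"
    using det_0_iff_vec_prod_zero_field[OF C] by auto
  have "B *\<^sub>v v = 0\<^sub>v n"
  proof (rule eq_vecI)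
    fix i assume "i < dim_vec (0\<^sub>v n)"
    then have i: "i < n" "i < r" using nr by auto
    have "(B *\<^sub>v v) $ i = (C *\<^sub>v v) $ i"
      using mult_mat_vec_index[OF B v(1) i(1)] mult_mat_vec_index[OF C v(1) i(2)] i by (simp add: C_def)
    then show "(B *\<^sub>v v) $ i = 0\<^sub>v n $ i" using v i by simp
  qed (use B in auto)
  then show False using assms v(1,2) unfolding inj_mat_def by blast
qed

text \<open>Preimages of the unit vectors are the columns of a right inverse C. As B * C = 1 makes C
  injective, the dimension bound applies to B and to C, and r = n.\<close>

lemma inj_mat_bij:
  fixes B :: "'a :: field mat"
  assumes B: "inj_mat n r B" and surj: "mat_range r B = carrier_vec n"
  obtains C where "r = n" "C \<in> carrier_mat n n" "B * C = 1\<^sub>m n" "C * B = 1\<^sub>m n"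
proof -
  have Bc: "B \<in> carrier_mat n r" using B by (simp add: inj_mat_def)
  have "\<exists>c\<in>carrier_vec r. B *\<^sub>v c = unit_vec n j" for j
    using surj unit_vec_carrier[of n j] unfolding mat_range_def by (metis imageE)
  then obtain c where c: "\<And>j. c j \<in> carrier_vec r" "\<And>j. B *\<^sub>v c j = unit_vec n j" by metis
  define C where "C = mat r n (\<lambda>(i,j). c j $ i)"
  have C: "C \<in> carrier_mat r n" by (simp add: C_def)
  have colC: "col C j = c j" if "j < n" for j
    using that c(1)[of j] by (intro eq_vecI) (auto simp: C_def)
  have BC: "B * C = 1\<^sub>m n"
  proof (rule mat_col_eqI)
    fix j assume "j < dim_col (1\<^sub>m n)"
    then have j: "j < n" by simp
    have "col (B * C) j = B *\<^sub>v col C j" using Bc C j by (intro eq_vecI) auto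
    then show "col (B * C) j = col (1\<^sub>m n) j" using colC c j by simp
  qed (use Bc C in auto)
  have "inj_mat r n C"
    unfolding inj_mat_def
  proof (intro conjI ballI impI C)
    fix v assume v: "v \<in> carrier_vec n" "C *\<^sub>v v = 0\<^sub>v r"
    have "v = (B * C) *\<^sub>v v" using BC v by simp
    also have "\<dots> = B *\<^sub>v (C *\<^sub>v v)" using Bc C v by simp
    also have "\<dots> = 0\<^sub>v n" using Bc v by auto
    finally show "v = 0\<^sub>v n" .
  qed
  from inj_mat_dim_le[OF this] inj_mat_dim_le[OF B] have rn: "r = n" by simp
  have "C * B = 1\<^sub>m n"
    using mat_mult_left_right_inverse[OF _ _ BC] Bc C unfolding rn by blast
  then show ?thesis using that[OF rn _ BC] C unfolding rn by blast
qed

text \<open>Basis extension, one column at a time: a vector of W outside the range is independent of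
  it. The number of columns cannot exceed n, so n - r is a termination measure.\<close>

lemma inj_mat_extend:
  fixes B :: "'a :: field mat"
  assumes "inj_mat n r B" and W: "vec_subspace n W" and "mat_range r B \<subseteq> W"
  shows "\<exists>C s. C \<in> carrier_mat n s \<and> inj_mat n (r + s) (hcat B C) \<and> mat_range (r + s) (hcat B C) = W"
  using assms(1,3)
proof (induction "n - r" arbitrary: r B rule: less_induct)
  case less
  have B: "B \<in> carrier_mat n r" using less.prems by (simp add: inj_mat_def)
  show ?case
  proof (cases "mat_range r B = W")
    case True
    have "hcat B (0\<^sub>m n 0) = B" using B by (intro eq_matI) (auto simp: hcat_def)
    then show ?thesis using True less.prems by (intro exI[of _ "0\<^sub>m n 0"] exI[of _ 0]) auto
  next
    case False
    then obtain w where w: "w \<in> W" "w \<notin> mat_range r B" using less.prems by auto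
    then have wc: "w \<in> carrier_vec n" using vec_subspaceD[OF W] by auto
    define D where "D = mat n 1 (\<lambda>(i,j). w $ i)"
    have D: "D \<in> carrier_mat n 1" by (simp add: D_def)
    have Dy: "D *\<^sub>v y = y $ 0 \<cdot>\<^sub>v w" if "y \<in> carrier_vec 1" for y
      using that wc by (intro eq_vecI) (auto simp: D_def scalar_prod_def)
    note rB = vec_subspaceD[OF mat_range_subspace[OF B]]
    have inj: "inj_mat n (r + 1) (hcat B D)"
    proof (rule inj_mat_hcat[OF less.prems(1) D])
      fix y :: "'a vec" assume y: "y \<in> carrier_vec 1" "D *\<^sub>v y \<in> mat_range r B"
      have "y $ 0 = 0"
      proof (rule ccontr)
        assume "y $ 0 \<noteq> 0"
        then have "w = inverse (y $ 0) \<cdot>\<^sub>v (y $ 0 \<cdot>\<^sub>v w)" using wc by (intro eq_vecI) auto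
        also have "\<dots> \<in> mat_range r B" using y rB(4) Dy[OF y(1)] by auto
        finally show False using w by simp
      qed
      then show "y = 0\<^sub>v 1" using y by (intro eq_vecI) auto
    qed
    have sub: "mat_range (r + 1) (hcat B D) \<subseteq> W"
      unfolding mat_range_hcat[OF B D] using less.prems(2) w vec_subspaceD(3,4)[OF W] Dy
      by (auto simp: mat_range_def[of "Suc 0"])
    have "n - (r + 1) < n - r" using inj_mat_dim_le[OF inj] by simp
    from less.hyps[OF this inj sub] obtain C s where C: "C \<in> carrier_mat n s"
      "inj_mat n (r + 1 + s) (hcat (hcat B D) C)" "mat_range (r + 1 + s) (hcat (hcat B D) C) = W"
      by blast
    have eq: "hcat (hcat B D) C = hcat B (hcat D C)" by (rule hcat_assoc[OF B D C(1)])
    show ?thesis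
      using C(2,3) hcat_carrier[OF D C(1)] unfolding eq add.assoc by (intro exI conjI)
  qed
qed

lemma vec_subspace_basis:
  fixes W :: "'a :: field vec set"
  assumes W: "vec_subspace n W"
  obtains B r where "inj_mat n r B" "mat_range r B = W"
proof -
  have 0: "inj_mat n 0 (0\<^sub>m n 0 :: 'a mat)" by (auto simp: inj_mat_def)
  have "0\<^sub>m n 0 *\<^sub>v v = 0\<^sub>v n" if "v \<in> carrier_vec 0" for v :: "'a vec"
    using that by (intro eq_vecI) (auto simp: scalar_prod_def)
  then have "mat_range 0 (0\<^sub>m n 0) \<subseteq> W"
    using vec_subspaceD(2)[OF W] by (auto simp: mat_range_def)
  from inj_mat_extend[OF 0 W this] that show ?thesis by blast
qed


section \<open>Irreducible groups of matrices\<close>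

lemma mat_eqI_vec:
  assumes A: "A \<in> carrier_mat n m" and B: "B \<in> carrier_mat n m"
    and eq: "\<And>v. v \<in> carrier_vec m \<Longrightarrow> A *\<^sub>v v = (B *\<^sub>v v :: 'a :: semiring_1 vec)"
  shows "A = B"
proof (rule mat_col_eqI)
  fix j assume "j < dim_col B"
  then have j: "j < m" using B by simp
  have "C *\<^sub>v unit_vec m j = col C j" if "C \<in> carrier_mat n m" for C :: "'a mat"
    using that j by (intro eq_vecI) auto
  then show "col A j = col B j" using eq[of "unit_vec m j"] A B by auto
qed (use A B in auto)

lemma inj_mat_cancel:
  fixes B :: "'a :: field mat"
  assumes B: "inj_mat n r B" and x: "x \<in> carrier_vec r" and y: "y \<in> carrier_vec r" and eq: "B *\<^sub>v x = B *\<^sub>v y"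
  shows "x = y"
proof -
  have Bc: "B \<in> carrier_mat n r" using B by (simp add: inj_mat_def)
  have "B *\<^sub>v (x - y) = 0\<^sub>v n"
    using mult_minus_distrib_mat_vec[OF Bc x y] eq Bc y by simp
  then have 0: "x - y = 0\<^sub>v r" using B x y by (simp add: inj_mat_def)
  show ?thesis
  proof (rule eq_vecI)
    fix i assume "i < dim_vec y"
    then show "x $ i = y $ i" using arg_cong[OF 0, of "\<lambda>v. v $ i"] x y by simp
  qed (use x y in auto)
qed

text \<open>The matrix \<alpha> with h * B = B * \<alpha> is unique when B is injective; identities
  between the h therefore pass to the induced action on the column space.\<close>

lemma inj_mat_cancel_mat:
  fixes B :: "'a :: field mat"
  assumes B: "inj_mat n r B" and C: "C \<in> carrier_mat r m" and D: "D \<in> carrier_mat r m" and eq: "B * C = B * D"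
  shows "C = D"
proof (rule mat_eqI_vec[OF C D])
  have Bc: "B \<in> carrier_mat n r" using B by (simp add: inj_mat_def)
  fix v :: "'a vec" assume v: "v \<in> carrier_vec m"
  have "B *\<^sub>v (C *\<^sub>v v) = B *\<^sub>v (D *\<^sub>v v)"
    using arg_cong[OF eq, of "\<lambda>X. X *\<^sub>v v"] Bc C D v by simp
  then show "C *\<^sub>v v = D *\<^sub>v v"
    using inj_mat_cancel[OF B, of "C *\<^sub>v v" "D *\<^sub>v v"] C D v by simp
qed

text \<open>The image of a representation, as a bare set. Degree bounds then refer to the order of
  the image, which divides the index of every subgroup contained in the kernel.\<close>

definition mat_group :: "nat \<Rightarrow> complex mat set \<Rightarrow> bool" where
  "mat_group n H \<longleftrightarrow> H \<subseteq> carrier_mat n n \<and> 1\<^sub>m n \<in> H \<and> (\<forall>g\<in>H. \<forall>h\<in>H. g * h \<in> H) \<and>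
     (\<forall>h\<in>H. \<exists>k\<in>H. h * k = 1\<^sub>m n \<and> k * h = 1\<^sub>m n)"

definition irreducible_mats :: "nat \<Rightarrow> complex mat set \<Rightarrow> bool" where
  "irreducible_mats n H \<longleftrightarrow> n > 0 \<and> H \<subseteq> carrier_mat n n \<and>
     (\<forall>W. vec_subspace n W \<and> (\<forall>h\<in>H. \<forall>w\<in>W. h *\<^sub>v w \<in> W) \<longrightarrow> W = {0\<^sub>v n} \<or> W = carrier_vec n)"

lemma irreducible_matsD:
  assumes "irreducible_mats n H" "vec_subspace n W" "\<And>h w. h \<in> H \<Longrightarrow> w \<in> W \<Longrightarrow> h *\<^sub>v w \<in> W"
    "v \<in> W" "v \<noteq> 0\<^sub>v n"
  shows "W = carrier_vec n"
  using assms unfolding irreducible_mats_def by blast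

text \<open>Over the complex numbers X has an eigenvector, and the eigenspace is H-invariant because
  X commutes with H.\<close>

lemma schur:
  assumes irr: "irreducible_mats n H" and X: "X \<in> carrier_mat n n"
    and comm: "\<And>h. h \<in> H \<Longrightarrow> X * h = h * X"
  obtains c where "X = c \<cdot>\<^sub>m 1\<^sub>m n"
proof -
  have n: "n > 0" and H: "H \<subseteq> carrier_mat n n" using irr by (auto simp: irreducible_mats_def)
  obtain c v where v: "v \<in> carrier_vec n" "v \<noteq> 0\<^sub>v n" "X *\<^sub>v v = c \<cdot>\<^sub>v v"
    using spectrum_non_empty[OF X n] X by (auto simp: spectrum_def eigenvalue_def eigenvector_def)
  define W where "W = {w \<in> carrier_vec n. X *\<^sub>v w = c \<cdot>\<^sub>v w}"
  have "vec_subspace n W"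
    unfolding vec_subspace_def W_def
    using X by (auto simp: mult_add_distrib_mat_vec[OF X] smult_add_distrib_vec[of _ n]
        mult_mat_vec[OF X] smult_smult_assoc mult.commute)
  moreover have "h *\<^sub>v w \<in> W" if "h \<in> H" "w \<in> W" for h w
  proof -
    have h: "h \<in> carrier_mat n n" and w: "w \<in> carrier_vec n" "X *\<^sub>v w = c \<cdot>\<^sub>v w"
      using that H by (auto simp: W_def)
    have "X *\<^sub>v (h *\<^sub>v w) = (X * h) *\<^sub>v w" using X h w by simp
    also have "\<dots> = h *\<^sub>v (X *\<^sub>v w)" using X h w comm[OF that(1)] by simp
    also have "\<dots> = c \<cdot>\<^sub>v (h *\<^sub>v w)" unfolding w using mult_mat_vec[OF h w(1)] .
    finally show ?thesis using h w by (simp add: W_def)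
  qed
  moreover have "v \<in> W" using v by (simp add: W_def)
  ultimately have W: "W = carrier_vec n" using irreducible_matsD[OF irr] v(2) by blast
  have "X = c \<cdot>\<^sub>m 1\<^sub>m n"
  proof (rule mat_eqI_vec[OF X])
    fix w :: "complex vec" assume "w \<in> carrier_vec n"
    then have w: "w \<in> carrier_vec n" "X *\<^sub>v w = c \<cdot>\<^sub>v w" using W by (auto simp: W_def)
    have "(c \<cdot>\<^sub>m 1\<^sub>m n) *\<^sub>v w = c \<cdot>\<^sub>v w" using w(1) by (intro eq_vecI) auto
    then show "X *\<^sub>v w = (c \<cdot>\<^sub>m 1\<^sub>m n) *\<^sub>v w" using w by simp
  qed simp
  then show ?thesis using that by blast
qed

lemma mat_group_inverse:
  assumes "mat_group n H"
  obtains iv where "\<And>h. h \<in> H \<Longrightarrow> iv h \<in> H" "\<And>h. h \<in> H \<Longrightarrow> h * iv h = 1\<^sub>m n" "\<And>h. h \<in> H \<Longrightarrow> iv h * h = 1\<^sub>m n"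
  using assms unfolding mat_group_def by metis

lemma mat_group_translate:
  assumes H: "mat_group n H" and g: "g \<in> H"
  shows "bij_betw (\<lambda>h. g * h) H H"
proof -
  obtain k where k: "k \<in> H" "g * k = 1\<^sub>m n" "k * g = 1\<^sub>m n" using H g unfolding mat_group_def by blast
  have c: "\<And>h. h \<in> H \<Longrightarrow> h \<in> carrier_mat n n" using H by (auto simp: mat_group_def)
  show ?thesis
  proof (rule bij_betwI[of _ _ _ "\<lambda>h. k * h"])
    show "(\<lambda>h. g * h) \<in> H \<rightarrow> H" "(\<lambda>h. k * h) \<in> H \<rightarrow> H" using H g k by (auto simp: mat_group_def)
    fix x assume x: "x \<in> H"
    have "k * (g * x) = (k * g) * x" by (rule assoc_mult_mat[OF c c c, symmetric]) (use k g x in auto)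
    then show "k * (g * x) = x" using k c[OF x] by simp
    have "g * (k * x) = (g * k) * x" by (rule assoc_mult_mat[OF c c c, symmetric]) (use k g x in auto)
    then show "g * (k * x) = x" using k c[OF x] by simp
  qed
qed

text \<open>For fixed i and j the sums are the entries of X = \<Sum> h E h^-1, where E has a single
  entry 1 at position (i, j). This X commutes with H, so it is scalar, and its trace determines the
  scalar.\<close>

lemma schur_orthogonality:
  assumes H: "mat_group n H" "finite H" and irr: "irreducible_mats n H"
    and iv: "\<And>h. h \<in> H \<Longrightarrow> iv h \<in> H" "\<And>h. h \<in> H \<Longrightarrow> h * iv h = 1\<^sub>m n" "\<And>h. h \<in> H \<Longrightarrow> iv h * h = 1\<^sub>m n"
    and ij: "a < n" "i < n" "j < n" "b < n"
  shows "(\<Sum>h\<in>H. h $$ (a,i) * iv h $$ (j,b)) = (if i = j \<and> a = b then of_nat (card H) / of_nat n else 0)"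
proof -
  have c: "\<And>h. h \<in> H \<Longrightarrow> h \<in> carrier_mat n n" using H by (auto simp: mat_group_def)
  have n: "n > 0" using ij by simp
  define X where "X = mat n n (\<lambda>(a,b). \<Sum>h\<in>H. h $$ (a,i) * iv h $$ (j,b))"
  have X: "X \<in> carrier_mat n n" by (simp add: X_def)
  have "X * g = g * X" if g: "g \<in> H" for g
  proof (rule eq_matI)
    fix a b assume "a < dim_row (g * X)" "b < dim_col (g * X)"
    then have ab: "a < n" "b < n" using c[OF g] X by auto
    have gh: "g * h \<in> H" if "h \<in> H" for h using H g that by (auto simp: mat_group_def)
    have ivg: "iv (g * h) * g = iv h" if h: "h \<in> H" for h
    proof -
      have "iv (g * h) * g = iv (g * h) * g * (h * iv h)" 
        using iv(2)[OF h] c[OF g] c[OF iv(1)[OF gh[OF h]]] by simp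
      also have "\<dots> = iv (g * h) * (g * h) * iv h"
        using c[OF g] c[OF h] c[OF iv(1)[OF h]] c[OF iv(1)[OF gh[OF h]]] by (simp add: assoc_mult_mat[of _ n n _ n _ n])
      also have "\<dots> = iv h" using iv(3)[OF gh[OF h]] c[OF iv(1)[OF h]] by simp
      finally show ?thesis .
    qed
    have "(X * g) $$ (a,b) = (\<Sum>l<n. (\<Sum>h\<in>H. h $$ (a,i) * iv h $$ (j,l)) * g $$ (l,b))"
      unfolding mult_mat_index[OF X c[OF g] ab] using ab by (intro sum.cong) (auto simp: X_def)
    also have "\<dots> = (\<Sum>h\<in>H. h $$ (a,i) * (\<Sum>l<n. iv h $$ (j,l) * g $$ (l,b)))"
      unfolding sum_distrib_left sum_distrib_right mult.assoc by (rule sum.swap)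
    also have "\<dots> = (\<Sum>h\<in>H. h $$ (a,i) * (iv h * g) $$ (j,b))"
      by (intro sum.cong refl arg_cong2[of _ _ _ _ "(*)"])
        (use mult_mat_index[OF c[OF iv(1)] c[OF g] ij(3) ab(2)] in simp)
    \<comment> \<open>Reindexing by h -> g h moves the factor g from the right of X to its left,
      since (g h)^-1 g = h^-1.\<close>
    also have "\<dots> = (\<Sum>h\<in>H. (g * h) $$ (a,i) * (iv (g * h) * g) $$ (j,b))"
      using mat_group_translate[OF H(1) g] by (intro sum.reindex_bij_betw[symmetric])
    also have "\<dots> = (\<Sum>h\<in>H. (g * h) $$ (a,i) * iv h $$ (j,b))"
      using ivg by (intro sum.cong) auto
    also have "\<dots> = (\<Sum>h\<in>H. (\<Sum>l<n. g $$ (a,l) * h $$ (l,i)) * iv h $$ (j,b))"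
      by (intro sum.cong refl arg_cong2[of _ _ _ _ "(*)"])
        (use mult_mat_index[OF c[OF g] c ab(1) ij(2)] in simp)
    also have "\<dots> = (\<Sum>l<n. g $$ (a,l) * (\<Sum>h\<in>H. h $$ (l,i) * iv h $$ (j,b)))"
      unfolding sum_distrib_left sum_distrib_right mult.assoc by (rule sum.swap)
    also have "\<dots> = (g * X) $$ (a,b)"
      unfolding mult_mat_index[OF c[OF g] X ab] using ab by (intro sum.cong) (auto simp: X_def)
    finally show "(X * g) $$ (a,b) = (g * X) $$ (a,b)" .
  qed (use c[OF g] X in auto)
  then obtain s where s: "X = s \<cdot>\<^sub>m 1\<^sub>m n" using schur[OF irr X] by metis
  have "of_nat n * s = mat_trace X"
    unfolding s by (subst mat_trace_sum[of _ n]) auto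
  also have "\<dots> = (\<Sum>a<n. \<Sum>h\<in>H. iv h $$ (j,a) * h $$ (a,i))"
    unfolding mat_trace_sum[OF X] by (intro sum.cong) (auto simp: X_def mult.commute)
  also have "\<dots> = (\<Sum>h\<in>H. (iv h * h) $$ (j,i))"
    by (subst sum.swap) (intro sum.cong refl mult_mat_index[OF c[OF iv(1)] c ij(3,2), symmetric])
  also have "\<dots> = (if i = j then of_nat (card H) else 0)"
    using iv(3) ij by simp
  finally have "s = (if i = j then of_nat (card H) / of_nat n else 0)" using n by (auto simp: field_simps)
  moreover have "X $$ (a,b) = (\<Sum>h\<in>H. h $$ (a,i) * iv h $$ (j,b))" using ij by (simp add: X_def)
  moreover have "X $$ (a,b) = (if a = b then s else 0)" unfolding s using ij by simp
  ultimately show ?thesis by (auto split: if_splits)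
qed

text \<open>An eigenvalue of an integer matrix is a root of its characteristic polynomial, which is
  monic with integer coefficients. Rows and columns are indexed by an arbitrary finite set I so that
  pairs of group elements can serve as indices; f is the eigenvector.\<close>

lemma algebraic_int_eigenvalue:
  fixes q :: complex and f :: "'i \<Rightarrow> complex" and T :: "'i \<Rightarrow> 'i \<Rightarrow> int"
  assumes I: "finite I" and x: "x \<in> I" "f x \<noteq> 0"
    and eig: "\<And>x. x \<in> I \<Longrightarrow> q * f x = (\<Sum>y\<in>I. of_int (T x y) * f y)"
  shows "algebraic_int q"
proof -
  define N where "N = card I"
  obtain e where e: "bij_betw e {..<N} I"
    using ex_bij_betw_nat_finite[OF I] unfolding N_def atLeast0LessThan by blast
  have eI: "e i \<in> I" if "i < N" for i using e that by (auto simp: bij_betw_def)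
  define M where "M = mat N N (\<lambda>(i,j). T (e i) (e j))"
  define M' where "M' = (map_mat of_int M :: complex mat)"
  define v where "v = vec N (\<lambda>i. f (e i))"
  have M: "M \<in> carrier_mat N N" by (simp add: M_def)
  have M': "M' \<in> carrier_mat N N" using M by (simp add: M'_def)
  have v: "v \<in> carrier_vec N" by (simp add: v_def)
  have "M' *\<^sub>v v = q \<cdot>\<^sub>v v"
  proof (rule eq_vecI)
    fix i assume "i < dim_vec (q \<cdot>\<^sub>v v)"
    then have i: "i < N" by (simp add: v_def)
    have "(M' *\<^sub>v v) $ i = (\<Sum>j<N. of_int (T (e i) (e j)) * f (e j))"
      unfolding mult_mat_vec_index[OF M' v i] using i by (intro sum.cong) (auto simp: M'_def M_def v_def)
    also have "\<dots> = (\<Sum>y\<in>I. of_int (T (e i) y) * f y)"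
      by (rule sum.reindex_bij_betw[OF e])
    also have "\<dots> = (q \<cdot>\<^sub>v v) $ i" using eig[OF eI[OF i]] i by (simp add: v_def)
    finally show "(M' *\<^sub>v v) $ i = (q \<cdot>\<^sub>v v) $ i" .
  qed (use M' v in auto)
  moreover have "v \<noteq> 0\<^sub>v N"
  proof -
    obtain i where "i < N" "e i = x" using e x(1) unfolding bij_betw_def by auto
    then have "v $ i \<noteq> 0\<^sub>v N $ i" using x(2) by (simp add: v_def)
    then show ?thesis by auto
  qed
  ultimately have "eigenvalue M' q"
    using v M' unfolding eigenvalue_def eigenvector_def by auto
  then have "poly (char_poly M') q = 0" using eigenvalue_root_char_poly[OF M'] by simp
  moreover have "char_poly M' = of_int_poly (char_poly M)"
    unfolding M'_def by (rule of_int_hom.char_poly_hom[OF M])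
  moreover have "lead_coeff (char_poly M) = 1" using degree_monic_char_poly[OF M] by simp
  ultimately show ?thesis unfolding algebraic_int_altdef_ipoly by auto
qed

text \<open>
  For fixed \<open>H\<close> the numbers \<open>g\<^sub>0\<^sub>0 h\<^sub>0\<^sub>0\<close>, indexed by the pairs \<open>(g, h)\<close>, form an eigenvector with eigenvalue
  \<open>|H| / n\<close> of the integer matrix that sends \<open>(g, h)\<close> to the sum of all \<open>(m g, m\<^sup>-\<^sup>1 h)\<close> with \<open>m \<in> H\<close>. So
  \<open>|H| / n\<close> is an algebraic integer, and no roots of unity are needed.
\<close>

lemma irreducible_degree_dvd:
  assumes H: "mat_group n H" "finite H" and irr: "irreducible_mats n H"
  shows "n dvd card H"
proof -
  obtain iv where iv: "\<And>h. h \<in> H \<Longrightarrow> iv h \<in> H" "\<And>h. h \<in> H \<Longrightarrow> h * iv h = 1\<^sub>m n" "\<And>h. h \<in> H \<Longrightarrow> iv h * h = 1\<^sub>m n"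
    using mat_group_inverse[OF H(1)] by metis
  have n: "n > 0" using irr by (simp add: irreducible_mats_def)
  have c: "\<And>h. h \<in> H \<Longrightarrow> h \<in> carrier_mat n n" using H by (auto simp: mat_group_def)
  have mult: "\<And>g h. g \<in> H \<Longrightarrow> h \<in> H \<Longrightarrow> g * h \<in> H" using H by (auto simp: mat_group_def)
  define q :: complex where "q = of_nat (card H) / of_nat n"
  define f :: "complex mat \<times> complex mat \<Rightarrow> complex" where "f = (\<lambda>(g,h). g $$ (0,0) * h $$ (0,0))"
  define \<phi> where "\<phi> = (\<lambda>m (g,h). (m * g, iv m * h :: complex mat))"
  define T where "T = (\<lambda>x y. int (card {m \<in> H. \<phi> m x = y}))"
  have eig: "q * f x = (\<Sum>y\<in>H \<times> H. of_int (T x y) * f y)" if x: "x \<in> H \<times> H" for x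
  proof -
    obtain g h where gh: "x = (g,h)" "g \<in> H" "h \<in> H" using x by auto
    have "(\<Sum>m\<in>H. f (\<phi> m x)) = (\<Sum>m\<in>H. (\<Sum>i<n. m $$ (0,i) * g $$ (i,0)) * (\<Sum>j<n. iv m $$ (0,j) * h $$ (j,0)))"
      unfolding f_def \<phi>_def gh
      using mult_mat_index[OF c c[OF gh(2)] n n] mult_mat_index[OF c[OF iv(1)] c[OF gh(3)] n n]
      by (intro sum.cong) auto
    also have "\<dots> = (\<Sum>m\<in>H. \<Sum>i<n. \<Sum>j<n. m $$ (0,i) * iv m $$ (0,j) * (g $$ (i,0) * h $$ (j,0)))"
      by (simp add: sum_product mult_ac)
    also have "\<dots> = (\<Sum>i<n. \<Sum>j<n. (\<Sum>m\<in>H. m $$ (0,i) * iv m $$ (0,j)) * (g $$ (i,0) * h $$ (j,0)))"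
      unfolding sum_distrib_right by (subst sum.swap, intro sum.cong refl, rule sum.swap)
    \<comment> \<open>Orthogonality for the first rows of m and of its inverse leaves only i = j =
      0, where the sum over m is |H| / n.\<close>
    also have "\<dots> = (\<Sum>i<n. \<Sum>j<n. if i = 0 then if j = 0 then q * f x else 0 else 0)"
      using schur_orthogonality[OF H irr iv, of 0 _ 0] n
      by (intro sum.cong refl) (auto simp: q_def f_def gh)
    also have "\<dots> = (\<Sum>i<n. if i = 0 then q * f x else 0)" using n by (intro sum.cong) auto
    also have "\<dots> = q * f x" using n by simp
    finally have "q * f x = (\<Sum>m\<in>H. f (\<phi> m x))" by simp
    \<comment> \<open>Grouping the m by the pair they produce turns the sum over H into row x of the
      integer matrix T applied to f.\<close>
    also have "\<dots> = (\<Sum>y\<in>H \<times> H. \<Sum>m | m \<in> H \<and> \<phi> m x = y. f (\<phi> m x))"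
    proof (rule sum.group[symmetric])
      show "(\<lambda>m. \<phi> m x) ` H \<subseteq> H \<times> H" using gh mult iv(1) by (auto simp: \<phi>_def)
    qed (use H in auto)
    also have "\<dots> = (\<Sum>y\<in>H \<times> H. of_int (T x y) * f y)"
      by (simp add: T_def)
    finally show ?thesis .
  qed
  have "algebraic_int q"
  proof (rule algebraic_int_eigenvalue[of "H \<times> H" "(1\<^sub>m n, 1\<^sub>m n)" f q T])
    show "(1\<^sub>m n, 1\<^sub>m n) \<in> H \<times> H" using H by (simp add: mat_group_def)
    show "f (1\<^sub>m n, 1\<^sub>m n) \<noteq> 0" using n by (simp add: f_def)
  qed (use H(2) eig in auto)
  moreover have "q \<in> \<rat>" by (simp add: q_def)
  ultimately have "q \<in> \<int>" using rational_algebraic_int_is_int by blast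
  then obtain z where z: "q = of_int z" by (auto elim: Ints_cases)
  then have "complex_of_int (int (card H)) = of_int (z * int n)" using n by (simp add: q_def field_simps)
  then have "int (card H) = z * int n" by (simp only: of_int_eq_iff)
  then have "int n dvd int (card H)" by simp
  then show ?thesis by simp
qed

section \<open>Restriction to a normal subgroup: fixed vectors and Clifford's theorem\<close>

lemma mult_mat_zero_vec: "A \<in> carrier_mat n m \<Longrightarrow> A *\<^sub>v 0\<^sub>v m = 0\<^sub>v n"
  by (intro eq_vecI) auto

text \<open>Normality written without inverses: an element of G can be moved past one of H in either
  direction, at the cost of changing the element of H.\<close>

definition normalizes :: "complex mat set \<Rightarrow> complex mat set \<Rightarrow> bool" where
  "normalizes G H \<longleftrightarrow> (\<forall>g\<in>G. \<forall>h\<in>H. (\<exists>k\<in>H. g * h = k * g) \<and> (\<exists>k\<in>H. h * g = g * k))"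

text \<open>The common fixed space of H is invariant under every G that normalizes H, so one nonzero
  fixed vector makes it the whole space.\<close>

lemma normal_fixed_vector:
  assumes irr: "irreducible_mats n G" and H: "H \<subseteq> carrier_mat n n" and norm: "normalizes G H"
    and v: "v \<in> carrier_vec n" "v \<noteq> 0\<^sub>v n" and fixed: "\<And>h. h \<in> H \<Longrightarrow> h *\<^sub>v v = v" and h: "h \<in> H"
  shows "h = 1\<^sub>m n"
proof -
  have G: "\<And>g. g \<in> G \<Longrightarrow> g \<in> carrier_mat n n" using irr by (auto simp: irreducible_mats_def)
  have Hc: "\<And>h. h \<in> H \<Longrightarrow> h \<in> carrier_mat n n" using H by auto
  define W where "W = {w \<in> carrier_vec n. \<forall>h\<in>H. h *\<^sub>v w = w}"
  have "vec_subspace n W"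
    unfolding vec_subspace_def W_def
    using Hc by (auto simp: mult_mat_zero_vec[OF Hc] mult_add_distrib_mat_vec[OF Hc] mult_mat_vec[OF Hc])
  moreover have "g *\<^sub>v w \<in> W" if "g \<in> G" "w \<in> W" for g w
  proof -
    have w: "w \<in> carrier_vec n" using that by (simp add: W_def)
    have "h *\<^sub>v (g *\<^sub>v w) = g *\<^sub>v w" if hH: "h \<in> H" for h
    proof -
      obtain k where k: "k \<in> H" "h * g = g * k" using norm \<open>g \<in> G\<close> hH by (auto simp: normalizes_def)
      have "h *\<^sub>v (g *\<^sub>v w) = (h * g) *\<^sub>v w" using Hc[OF hH] G[OF \<open>g \<in> G\<close>] w by simp
      also have "\<dots> = g *\<^sub>v (k *\<^sub>v w)" unfolding k(2) using Hc[OF k(1)] G[OF \<open>g \<in> G\<close>] w by simp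
      also have "k *\<^sub>v w = w" using \<open>w \<in> W\<close> k by (auto simp: W_def)
      finally show ?thesis .
    qed
    then show ?thesis using w G[OF \<open>g \<in> G\<close>] by (simp add: W_def)
  qed
  moreover have "v \<in> W" using v fixed by (simp add: W_def)
  ultimately have "W = carrier_vec n" using irreducible_matsD[OF irr] v(2) by blast
  then show ?thesis using h Hc[OF h] by (intro mat_eqI_vec[of _ n n]) (auto simp: W_def)
qed

text \<open>The column space of \<open>B\<close> is a minimal nonzero \<open>H\<close>-invariant subspace, on which \<open>h\<close> acts by \<open>\<alpha> h\<close>.\<close>

definition irreducible_block :: "nat \<Rightarrow> complex mat set \<Rightarrow> nat \<Rightarrow> complex mat \<Rightarrow> (complex mat \<Rightarrow> complex mat) \<Rightarrow> bool" where
  "irreducible_block n H d B \<alpha> \<longleftrightarrow> inj_mat n d B \<and> (\<forall>h\<in>H. \<alpha> h \<in> carrier_mat d d \<and> h * B = B * \<alpha> h) \<and>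
     irreducible_mats d (\<alpha> ` H)"

text \<open>Take d > 0 least such that some d-dimensional column space is H-invariant; d = n is a
  candidate. An invariant subspace of the block with basis C yields the invariant column space of B
  * C, so by minimality it is zero or has dimension d.\<close>

lemma irreducible_block_exists:
  assumes H: "H \<subseteq> carrier_mat n n" and n: "n > 0"
  obtains d B \<alpha> where "irreducible_block n H d B \<alpha>"
proof -
  define P where "P = (\<lambda>d. d > 0 \<and> (\<exists>B. inj_mat n d B \<and> (\<forall>h\<in>H. \<exists>A\<in>carrier_mat d d. h * B = B * A)))"
  define d where "d = (LEAST d. P d)"
  have "inj_mat n n (1\<^sub>m n)" by (simp add: inj_mat_def)
  moreover have "\<exists>A\<in>carrier_mat n n. h * 1\<^sub>m n = 1\<^sub>m n * A" if "h \<in> H" for h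
    using H that by (intro bexI[of _ h]) auto
  ultimately have "P n" unfolding P_def using n by blast
  then have "P d" unfolding d_def by (rule LeastI)
  then obtain B where d: "d > 0" and B: "inj_mat n d B" and inv: "\<forall>h\<in>H. \<exists>A\<in>carrier_mat d d. h * B = B * A"
    by (auto simp: P_def)
  obtain \<alpha> where \<alpha>: "\<And>h. h \<in> H \<Longrightarrow> \<alpha> h \<in> carrier_mat d d" "\<And>h. h \<in> H \<Longrightarrow> h * B = B * \<alpha> h"
    using inv by metis
  have Bc: "B \<in> carrier_mat n d" using B by (simp add: inj_mat_def)
  have "irreducible_mats d (\<alpha> ` H)"
    unfolding irreducible_mats_def
  proof (intro conjI allI impI d)
    show "\<alpha> ` H \<subseteq> carrier_mat d d" using \<alpha> by auto
    fix W assume W: "vec_subspace d W \<and> (\<forall>h\<in>\<alpha> ` H. \<forall>w\<in>W. h *\<^sub>v w \<in> W)"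
    then have Wsub: "vec_subspace d W" by simp
    obtain C e where C: "inj_mat d e C" "mat_range e C = W" by (rule vec_subspace_basis[OF Wsub])
    have Cc: "C \<in> carrier_mat d e" using C by (simp add: inj_mat_def)
    show "W = {0\<^sub>v d} \<or> W = carrier_vec d"
    proof (cases "e = 0")
      case True
      have "x = 0\<^sub>v 0" if "x \<in> carrier_vec 0" for x :: "complex vec" using that by auto
      then have "carrier_vec 0 = {0\<^sub>v 0 :: complex vec}" by auto
      then have "W = {C *\<^sub>v 0\<^sub>v 0}" using C(2) True unfolding mat_range_def by simp
      then show ?thesis using mult_mat_zero_vec[OF Cc] True by simp
    next
      case False
      have "inj_mat n e (B * C)"
        unfolding inj_mat_def
      proof (intro conjI ballI impI)
        show "B * C \<in> carrier_mat n e" using Bc Cc by simp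
        fix v assume v: "v \<in> carrier_vec e" "B * C *\<^sub>v v = 0\<^sub>v n"
        then have "B *\<^sub>v (C *\<^sub>v v) = 0\<^sub>v n" using Bc Cc by simp
        then have "C *\<^sub>v v = 0\<^sub>v d" using B Cc v by (simp add: inj_mat_def)
        then show "v = 0\<^sub>v e" using C v by (simp add: inj_mat_def)
      qed
      moreover have "\<exists>A\<in>carrier_mat e e. h * (B * C) = B * C * A" if h: "h \<in> H" for h
      proof -
        have hc: "h \<in> carrier_mat n n" using H h by auto
        have "\<exists>x\<in>carrier_vec e. \<alpha> h *\<^sub>v col C j = C *\<^sub>v x" if "j < e" for j
        proof -
          have "col C j = C *\<^sub>v unit_vec e j" using that Cc by (intro eq_vecI) auto
          then have "col C j \<in> W" unfolding C(2)[symmetric] mat_range_def by auto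
          then have "\<alpha> h *\<^sub>v col C j \<in> mat_range e C" using W h unfolding C(2) by auto
          then show ?thesis by (auto simp: mat_range_def)
        qed
        then obtain x where x: "\<And>j. j < e \<Longrightarrow> x j \<in> carrier_vec e" "\<And>j. j < e \<Longrightarrow> \<alpha> h *\<^sub>v col C j = C *\<^sub>v x j"
          by metis
        define A where "A = mat e e (\<lambda>(i,j). x j $ i)"
        have A: "A \<in> carrier_mat e e" by (simp add: A_def)
        have "\<alpha> h * C = C * A"
        proof (rule mat_col_eqI)
          fix j assume "j < dim_col (C * A)"
          then have j: "j < e" by (simp add: A_def)
          have "col A j = x j" using x(1)[OF j] j by (intro eq_vecI) (auto simp: A_def)
          moreover have "col (C * A) j = C *\<^sub>v col A j" using Cc A j by (intro eq_vecI) auto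
          moreover have "col (\<alpha> h * C) j = \<alpha> h *\<^sub>v col C j" using Cc \<alpha>(1)[OF h] j by (intro eq_vecI) auto
          ultimately show "col (\<alpha> h * C) j = col (C * A) j" using x(2)[OF j] by simp
        qed (use \<alpha>(1)[OF h] Cc A in auto)
        moreover have "h * (B * C) = B * (\<alpha> h * C)"
        proof -
          have "h * (B * C) = h * B * C" by (rule assoc_mult_mat[symmetric, OF hc Bc Cc])
          also have "\<dots> = B * (\<alpha> h * C)" unfolding \<alpha>(2)[OF h] by (rule assoc_mult_mat[OF Bc \<alpha>(1)[OF h] Cc])
          finally show ?thesis .
        qed
        ultimately have "h * (B * C) = B * C * A" using assoc_mult_mat[OF Bc Cc A] by simp
        then show ?thesis using A by blast
      qed
      ultimately have "P e" unfolding P_def using False by blast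
      then have "d \<le> e" unfolding d_def by (rule Least_le)
      then have "e = d" using inj_mat_dim_le[OF C(1)] by simp
      \<comment> \<open>A basis of W with d columns extends to a basis of the whole space, and the
        dimension bound leaves no room for new columns; so W is everything.\<close>
      obtain D s where D: "D \<in> carrier_mat d s" "inj_mat d (e + s) (hcat C D)" "mat_range (e + s) (hcat C D) = carrier_vec d"
        using inj_mat_extend[OF C(1), of "carrier_vec d"] W C(2) vec_subspaceD(1)[of d W]
        by (auto simp: vec_subspace_def)
      have "s = 0" using inj_mat_dim_le[OF D(2)] \<open>e = d\<close> by simp
      then have "hcat C D = C" using Cc D(1) by (intro eq_matI) (auto simp: hcat_def)
      then show ?thesis using C(2) D(3) \<open>s = 0\<close> by simp
    qed
  qed
  then show ?thesis using that B \<alpha> unfolding irreducible_block_def by blast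
qed

lemma irreducible_blockD:
  assumes "irreducible_block n H d B \<alpha>"
  shows "inj_mat n d B" "B \<in> carrier_mat n d" "h \<in> H \<Longrightarrow> \<alpha> h \<in> carrier_mat d d" "h \<in> H \<Longrightarrow> h * B = B * \<alpha> h"
    "irreducible_mats d (\<alpha> ` H)" "d > 0"
  using assms by (auto simp: irreducible_block_def irreducible_mats_def inj_mat_def)

lemma irreducible_block_mult:
  assumes bl: "irreducible_block n H d B \<alpha>" and H: "H \<subseteq> carrier_mat n n"
    and gh: "g \<in> H" "h \<in> H" "g * h \<in> H"
  shows "\<alpha> (g * h) = \<alpha> g * \<alpha> h"
proof (rule inj_mat_cancel_mat)
  note b = irreducible_blockD[OF bl]
  show "inj_mat n d B" "\<alpha> (g * h) \<in> carrier_mat d d" "\<alpha> g * \<alpha> h \<in> carrier_mat d d"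
    using b(1) b(3)[OF gh(1)] b(3)[OF gh(2)] b(3)[OF gh(3)] by auto
  have c: "g \<in> carrier_mat n n" "h \<in> carrier_mat n n" using H gh by auto
  have "B * \<alpha> (g * h) = g * h * B" using b(4)[OF gh(3)] by simp
  also have "\<dots> = g * (h * B)" by (rule assoc_mult_mat[OF c b(2)])
  also have "\<dots> = g * (B * \<alpha> h)" using b(4)[OF gh(2)] by simp
  also have "\<dots> = g * B * \<alpha> h" by (rule assoc_mult_mat[OF c(1) b(2) b(3)[OF gh(2)], symmetric])
  also have "\<dots> = B * \<alpha> g * \<alpha> h" using b(4)[OF gh(1)] by simp
  also have "\<dots> = B * (\<alpha> g * \<alpha> h)" by (rule assoc_mult_mat[OF b(2) b(3)[OF gh(1)] b(3)[OF gh(2)]])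
  finally show "B * \<alpha> (g * h) = B * (\<alpha> g * \<alpha> h)" .
qed

lemma irreducible_block_one:
  assumes bl: "irreducible_block n H d B \<alpha>" and one: "1\<^sub>m n \<in> H"
  shows "\<alpha> (1\<^sub>m n) = 1\<^sub>m d"
proof (rule inj_mat_cancel_mat)
  note b = irreducible_blockD[OF bl]
  show "inj_mat n d B" "\<alpha> (1\<^sub>m n) \<in> carrier_mat d d" "1\<^sub>m d \<in> carrier_mat d d" using b(1) b(3)[OF one] by auto
  show "B * \<alpha> (1\<^sub>m n) = B * 1\<^sub>m d" using b(2) b(4)[OF one] by simp
qed

text \<open>The divisibility part of Clifford's theorem. Each translate g * B spans again an
  irreducible H-space of dimension d, so it either lies inside a given H-invariant subspace or meets
  it only in 0. An H-invariant subspace of dimension k d with k maximal therefore contains all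
  translates. Its largest G-invariant subspace is then nonzero, hence the whole space, and k d =
  n.\<close>

lemma irreducible_block_dvd:
  assumes G: "mat_group n G" "irreducible_mats n G" and H: "H \<subseteq> carrier_mat n n" and norm: "normalizes G H"
    and bl: "irreducible_block n H d B \<alpha>"
  shows "d dvd n"
proof -
  note b = irreducible_blockD[OF bl]
  have Gc: "\<And>g. g \<in> G \<Longrightarrow> g \<in> carrier_mat n n" using G by (auto simp: mat_group_def)
  have Hc: "\<And>h. h \<in> H \<Longrightarrow> h \<in> carrier_mat n n" using H by auto
  \<comment> \<open>Only invariance and the dimension k d are recorded, not a decomposition into
    blocks; this is all that maximality needs.\<close>
  define P where "P = (\<lambda>k. \<exists>C. inj_mat n (k * d) C \<and> (\<forall>h\<in>H. \<forall>w\<in>mat_range (k * d) C. h *\<^sub>v w \<in> mat_range (k * d) C))"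
  have "P 0"
  proof -
    have "0\<^sub>m n 0 *\<^sub>v v = 0\<^sub>v n" if "v \<in> carrier_vec 0" for v :: "complex vec"
      using that by (intro eq_vecI) (auto simp: scalar_prod_def)
    then show ?thesis unfolding P_def
      by (intro exI[of _ "0\<^sub>m n 0"]) (auto simp: inj_mat_def mat_range_def mult_mat_zero_vec[OF Hc])
  qed
  moreover have "k \<le> n" if "P k" for k
  proof -
    have "k * d \<le> n" using that inj_mat_dim_le unfolding P_def by blast
    moreover have "k \<le> k * d" using b(6) by simp
    ultimately show ?thesis by linarith
  qed
  ultimately have k: "P (Greatest P)" and max: "\<And>k'. P k' \<Longrightarrow> k' \<le> Greatest P"
    using GreatestI_nat[of P 0 n] Greatest_le_nat[of P _ n] by auto
  define k where "k = Greatest P"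
  note k = k[folded k_def] and max = max[folded k_def]
  obtain C where C: "inj_mat n (k * d) C" "\<And>h w. h \<in> H \<Longrightarrow> w \<in> mat_range (k * d) C \<Longrightarrow> h *\<^sub>v w \<in> mat_range (k * d) C"
    using k unfolding P_def by blast
  have Cc: "C \<in> carrier_mat n (k * d)" using C by (simp add: inj_mat_def)
  note R = vec_subspaceD[OF mat_range_subspace[OF Cc]]
  have act: "h *\<^sub>v (B *\<^sub>v x) = B *\<^sub>v (\<alpha> h *\<^sub>v x)" if "h \<in> H" "x \<in> carrier_vec d" for h x
    using arg_cong[OF b(4)[OF that(1)], of "\<lambda>X. X *\<^sub>v x"] Hc[OF that(1)] b(2) b(3)[OF that(1)] that(2) by simp
  have sub: "g *\<^sub>v (B *\<^sub>v x) \<in> mat_range (k * d) C" if g: "g \<in> G" and x: "x \<in> carrier_vec d" for g x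
  proof -
    \<comment> \<open>Y is the preimage of the range of C under g * B. It is invariant under the
      irreducible action \<alpha> because g can be moved past H, so it is zero or everything; if it
      were zero, one more block could be adjoined to C.\<close>
    define Y where "Y = {y \<in> carrier_vec d. g *\<^sub>v (B *\<^sub>v y) \<in> mat_range (k * d) C}"
    have Y: "vec_subspace d Y"
      unfolding vec_subspace_def Y_def
      using R(2,3,4) Gc[OF g] b(2)
      by (auto simp: mult_mat_zero_vec[OF b(2)] mult_mat_zero_vec[OF Gc[OF g]] mult_add_distrib_mat_vec[OF b(2)]
          mult_add_distrib_mat_vec[OF Gc[OF g]] mult_mat_vec[OF b(2)] mult_mat_vec[OF Gc[OF g]])
    have Yinv: "h *\<^sub>v y \<in> Y" if hy: "h \<in> \<alpha> ` H" "y \<in> Y" for h y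
    proof -
      obtain h' where h': "h' \<in> H" "h = \<alpha> h'" using hy by auto
      obtain l where l: "l \<in> H" "g * h' = l * g" using norm g h' by (auto simp: normalizes_def)
      have y: "y \<in> carrier_vec d" "g *\<^sub>v (B *\<^sub>v y) \<in> mat_range (k * d) C" using hy by (auto simp: Y_def)
      have By: "B *\<^sub>v y \<in> carrier_vec n" using b(2) y(1) by simp
      have "g *\<^sub>v (B *\<^sub>v (h *\<^sub>v y)) = g *\<^sub>v (h' *\<^sub>v (B *\<^sub>v y))" using act[OF h'(1) y(1)] h' by simp
      also have "\<dots> = (g * h') *\<^sub>v (B *\<^sub>v y)" using Gc[OF g] Hc[OF h'(1)] By by simp
      also have "\<dots> = l *\<^sub>v (g *\<^sub>v (B *\<^sub>v y))" unfolding l(2) using Gc[OF g] Hc[OF l(1)] By by simp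
      also have "\<dots> \<in> mat_range (k * d) C" using C(2)[OF l(1) y(2)] .
      finally show ?thesis using b(3)[OF h'(1)] h'(2) y(1) by (simp add: Y_def)
    qed
    have "Y \<noteq> {0\<^sub>v d}"
    proof
      assume Y0: "Y = {0\<^sub>v d}"
      have gB: "g * B \<in> carrier_mat n d" using Gc[OF g] b(2) by simp
      have gBv: "(g * B) *\<^sub>v y = g *\<^sub>v (B *\<^sub>v y)" if "y \<in> carrier_vec d" for y
        using Gc[OF g] b(2) that by simp
      have "inj_mat n (k * d + d) (hcat C (g * B))"
      proof (rule inj_mat_hcat[OF C(1) gB])
        fix y assume "y \<in> carrier_vec d" "g * B *\<^sub>v y \<in> mat_range (k * d) C"
        then have "y \<in> Y" using gBv by (simp add: Y_def)
        then show "y = 0\<^sub>v d" using Y0 by simp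
      qed
      moreover have "h *\<^sub>v w \<in> mat_range (k * d + d) (hcat C (g * B))"
        if h: "h \<in> H" and w: "w \<in> mat_range (k * d + d) (hcat C (g * B))" for h w
      proof -
        obtain u y where u: "u \<in> mat_range (k * d) C" and y: "y \<in> carrier_vec d" and w: "w = u + g *\<^sub>v (B *\<^sub>v y)"
          using w gBv unfolding mat_range_hcat[OF Cc gB] by (auto simp: mat_range_def[of d])
        have By: "B *\<^sub>v y \<in> carrier_vec n" using b(2) y(1) by simp
        obtain l where l: "l \<in> H" "h * g = g * l" using norm g h by (auto simp: normalizes_def)
        have "h *\<^sub>v w = h *\<^sub>v u + h *\<^sub>v (g *\<^sub>v (B *\<^sub>v y))"
          unfolding w using R(1) u Gc[OF g] By by (intro mult_add_distrib_mat_vec[OF Hc[OF h]]) auto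
        also have "h *\<^sub>v (g *\<^sub>v (B *\<^sub>v y)) = (h * g) *\<^sub>v (B *\<^sub>v y)" using Gc[OF g] Hc[OF h] By by simp
        also have "\<dots> = g *\<^sub>v (l *\<^sub>v (B *\<^sub>v y))" unfolding l(2) using Gc[OF g] Hc[OF l(1)] By by simp
        also have "\<dots> = (g * B) *\<^sub>v (\<alpha> l *\<^sub>v y)" using act[OF l(1) y] gBv b(3)[OF l(1)] y by simp
        finally have "h *\<^sub>v w = h *\<^sub>v u + (g * B) *\<^sub>v (\<alpha> l *\<^sub>v y)" .
        moreover have "(g * B) *\<^sub>v (\<alpha> l *\<^sub>v y) \<in> mat_range d (g * B)"
          unfolding mat_range_def using b(3)[OF l(1)] y by (intro imageI) simp
        ultimately show ?thesis
          unfolding mat_range_hcat[OF Cc gB] using C(2)[OF h u] by blast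
      qed
      ultimately have "P (Suc k)" unfolding P_def by (auto simp: add.commute)
      then show False using max[of "Suc k"] by simp
    qed
    moreover have "Y = {0\<^sub>v d} \<or> Y = carrier_vec d"
      using b(5)[unfolded irreducible_mats_def] Y Yinv by simp
    ultimately have "Y = carrier_vec d" by simp
    then show ?thesis using x by (auto simp: Y_def)
  qed
  \<comment> \<open>Z is the largest G-invariant subspace inside the range of C; it contains the
    first column of B because all translates of B lie in that range.\<close>
  define Z where "Z = {v \<in> carrier_vec n. \<forall>g\<in>G. g *\<^sub>v v \<in> mat_range (k * d) C}"
  have "vec_subspace n Z"
    unfolding vec_subspace_def Z_def
    using R(2,3,4) by (auto simp: mult_mat_zero_vec[OF Gc] mult_add_distrib_mat_vec[OF Gc] mult_mat_vec[OF Gc])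
  moreover have "g *\<^sub>v v \<in> Z" if "g \<in> G" "v \<in> Z" for g v
  proof -
    have v: "v \<in> carrier_vec n" using that by (simp add: Z_def)
    have "g' *\<^sub>v (g *\<^sub>v v) \<in> mat_range (k * d) C" if "g' \<in> G" for g'
    proof -
      have "g' *\<^sub>v (g *\<^sub>v v) = (g' * g) *\<^sub>v v" using Gc[OF that] Gc[OF \<open>g \<in> G\<close>] v by simp
      moreover have "g' * g \<in> G" using G(1) that \<open>g \<in> G\<close> by (simp add: mat_group_def)
      ultimately show ?thesis using \<open>v \<in> Z\<close> by (simp add: Z_def)
    qed
    then show ?thesis using v Gc[OF \<open>g \<in> G\<close>] by (simp add: Z_def)
  qed
  moreover have u: "unit_vec d 0 \<in> carrier_vec d" "unit_vec d 0 \<noteq> (0\<^sub>v d :: complex vec)"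
    using b(6) by (auto simp: vec_eq_iff)
  then have "B *\<^sub>v unit_vec d 0 \<in> Z" using sub b(2) by (auto simp: Z_def)
  moreover have "B *\<^sub>v unit_vec d 0 \<noteq> 0\<^sub>v n" using b(1) u unfolding inj_mat_def by blast
  ultimately have Z: "Z = carrier_vec n" using irreducible_matsD[OF G(2)] by blast
  have "1\<^sub>m n \<in> G" using G(1) by (simp add: mat_group_def)
  then have "1\<^sub>m n *\<^sub>v v \<in> mat_range (k * d) C" if "v \<in> carrier_vec n" for v using that Z unfolding Z_def by blast
  then have "mat_range (k * d) C = carrier_vec n" using R(1) by auto
  then have "k * d = n" using inj_mat_bij[OF C(1)] by metis
  then show ?thesis by (metis dvd_triv_right)
qed

text \<open>Here \<beta> is the action on the quotient by the column space of B. Completing B to an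
  invertible S makes the conjugate of h by S block triangular with diagonal blocks
  \<open>\<alpha> h\<close> and \<open>\<beta> h\<close>. The quotient plays the role of a
  complement, and its trace is a genuine character when s > 0, as a constituent requires.\<close>

lemma irreducible_block_trace:
  assumes H: "H \<subseteq> carrier_mat n n" and bl: "irreducible_block n H d B \<alpha>"
  obtains s \<beta> where "n = d + s" "\<And>h. h \<in> H \<Longrightarrow> \<beta> h \<in> carrier_mat s s"
    "\<And>h. h \<in> H \<Longrightarrow> mat_trace h = mat_trace (\<alpha> h) + mat_trace (\<beta> h)"
    "\<And>g h. g \<in> H \<Longrightarrow> h \<in> H \<Longrightarrow> g * h \<in> H \<Longrightarrow> \<beta> (g * h) = \<beta> g * \<beta> h"
    "\<beta> (1\<^sub>m n) = 1\<^sub>m s"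
proof -
  note b = irreducible_blockD[OF bl]
  have Hc: "\<And>h. h \<in> H \<Longrightarrow> h \<in> carrier_mat n n" using H by auto
  have sub: "vec_subspace n (carrier_vec n :: complex vec set)" by (auto simp: vec_subspace_def)
  have "mat_range d B \<subseteq> carrier_vec n" using vec_subspaceD(1)[OF mat_range_subspace[OF b(2)]] .
  from inj_mat_extend[OF b(1) sub this] obtain C s where C: "C \<in> carrier_mat n s"
    and S: "inj_mat n (d + s) (hcat B C)" "mat_range (d + s) (hcat B C) = carrier_vec n" by blast
  define S where "S = hcat B C"
  obtain S' where n: "d + s = n" and S': "S' \<in> carrier_mat n n" "S * S' = 1\<^sub>m n" "S' * S = 1\<^sub>m n"
    using inj_mat_bij[OF S] unfolding S_def by metis
  have Sc: "S \<in> carrier_mat n n" using S(1) n by (simp add: inj_mat_def S_def)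
  define J where "J = (\<lambda>h. S' * h * S)"
  have Jc: "J h \<in> carrier_mat n n" if "h \<in> H" for h using Hc[OF that] Sc S'(1) by (simp add: J_def)
  have intertwine: "h * S = S * J h" if "h \<in> H" for h
  proof -
    have "S * J h = S * (S' * (h * S))"
      unfolding J_def using assoc_mult_mat[OF S'(1) Hc[OF that] Sc] by simp
    also have "\<dots> = S * S' * (h * S)"
      using Hc[OF that] Sc by (intro assoc_mult_mat[symmetric, OF Sc S'(1)]) auto
    also have "\<dots> = h * S" using S'(2) Hc[OF that] Sc by simp
    finally show ?thesis by simp
  qed
  have Jmult: "J (g * h) = J g * J h" if "g \<in> H" "h \<in> H" for g h
  proof (rule inj_mat_cancel_mat)
    show "inj_mat n n S" using S(1) n by (simp add: S_def)
    note gc = Hc[OF that(1)] and hc = Hc[OF that(2)]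
    show "J (g * h) \<in> carrier_mat n n" "J g * J h \<in> carrier_mat n n"
      using gc hc Sc S'(1) by (auto simp: J_def)
    have "S * J (g * h) = S * (S' * (g * h * S))"
      unfolding J_def using assoc_mult_mat[OF S'(1) mult_carrier_mat[OF gc hc] Sc] by simp
    also have "\<dots> = S * S' * (g * h * S)"
      using gc hc Sc by (intro assoc_mult_mat[symmetric, OF Sc S'(1)]) auto
    also have "\<dots> = g * h * S" using S'(2) gc hc Sc by simp
    also have "\<dots> = g * (h * S)" by (rule assoc_mult_mat[OF gc hc Sc])
    also have "\<dots> = g * S * J h" unfolding intertwine[OF that(2)] by (rule assoc_mult_mat[symmetric, OF gc Sc Jc[OF that(2)]])
    also have "\<dots> = S * (J g * J h)" unfolding intertwine[OF that(1)] by (rule assoc_mult_mat[OF Sc Jc[OF that(1)] Jc[OF that(2)]])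
    finally show "S * J (g * h) = S * (J g * J h)" .
  qed
  \<comment> \<open>Invariance of the column space of B says that the first d columns of
    \<open>J h\<close> are those of \<open>\<alpha> h\<close> above zeros; this is read off after
    applying the injective S.\<close>
  have Jcol: "J h $$ (i,j) = (if i < d then \<alpha> h $$ (i,j) else 0)" if h: "h \<in> H" and i: "i < n" and j: "j < d" for h i j
  proof -
    have app: "S *\<^sub>v (x @\<^sub>v 0\<^sub>v s) = B *\<^sub>v x" if "x \<in> carrier_vec d" for x
      unfolding S_def using hcat_mult_vec[OF b(2) C that, of "0\<^sub>v s"] mult_mat_zero_vec[OF C] b(2) that by simp
    define x :: "complex vec" where "x = unit_vec d j"
    have x: "x \<in> carrier_vec d" by (simp add: x_def)
    have xn: "x @\<^sub>v 0\<^sub>v s \<in> carrier_vec n" using x n by auto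
    have ax: "\<alpha> h *\<^sub>v x \<in> carrier_vec d" using b(3)[OF h] x by simp
    have "S *\<^sub>v (J h *\<^sub>v (x @\<^sub>v 0\<^sub>v s)) = (S * J h) *\<^sub>v (x @\<^sub>v 0\<^sub>v s)"
      using Sc Jc[OF h] xn by simp
    also have "\<dots> = h *\<^sub>v (B *\<^sub>v x)" unfolding intertwine[OF h, symmetric] using Hc[OF h] Sc xn app[OF x] by simp
    also have "\<dots> = (h * B) *\<^sub>v x" using Hc[OF h] b(2) x by simp
    also have "\<dots> = B *\<^sub>v (\<alpha> h *\<^sub>v x)" unfolding b(4)[OF h] using b(2) b(3)[OF h] x by simp
    also have "\<dots> = S *\<^sub>v ((\<alpha> h *\<^sub>v x) @\<^sub>v 0\<^sub>v s)" using app[OF ax] by simp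
    finally have eq: "S *\<^sub>v (J h *\<^sub>v (x @\<^sub>v 0\<^sub>v s)) = S *\<^sub>v ((\<alpha> h *\<^sub>v x) @\<^sub>v 0\<^sub>v s)" .
    have "J h *\<^sub>v (x @\<^sub>v 0\<^sub>v s) = (\<alpha> h *\<^sub>v x) @\<^sub>v 0\<^sub>v s"
    proof (rule inj_mat_cancel[OF _ _ _ eq])
      show "inj_mat n n S" using S(1) n by (simp add: S_def)
      show "J h *\<^sub>v (x @\<^sub>v 0\<^sub>v s) \<in> carrier_vec n" using Jc[OF h] xn by simp
      show "(\<alpha> h *\<^sub>v x) @\<^sub>v 0\<^sub>v s \<in> carrier_vec n" using ax n by auto
    qed
    then have "(J h *\<^sub>v (x @\<^sub>v 0\<^sub>v s)) $ i = ((\<alpha> h *\<^sub>v x) @\<^sub>v 0\<^sub>v s) $ i" by simp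
    moreover have "x @\<^sub>v 0\<^sub>v s = unit_vec n j"
      unfolding x_def using n j by (intro eq_vecI) auto
    moreover have "(J h *\<^sub>v unit_vec n j) $ i = J h $$ (i,j)" using Jc[OF h] i j n by simp
    moreover have "((\<alpha> h *\<^sub>v x) @\<^sub>v 0\<^sub>v s) $ i = (if i < d then \<alpha> h $$ (i,j) else 0)"
      using b(3)[OF h] i j n by (auto simp: x_def)
    ultimately show ?thesis by simp
  qed
  define \<beta> where "\<beta> = (\<lambda>h. mat s s (\<lambda>(i,j). J h $$ (d + i, d + j)))"
  have \<beta>c: "\<beta> h \<in> carrier_mat s s" for h by (simp add: \<beta>_def)
  show ?thesis
  proof (rule that)
    show "n = d + s" using n by simp
    show "\<beta> h \<in> carrier_mat s s" for h by (rule \<beta>c)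
    show "mat_trace h = mat_trace (\<alpha> h) + mat_trace (\<beta> h)" if h: "h \<in> H" for h
    proof -
      have "mat_trace h = (\<Sum>i<d + s. J h $$ (i,i))"
        using mat_trace_intertwine[OF Hc[OF h] Jc[OF h] Sc S'(1,2,3) intertwine[OF h]] mat_trace_sum[OF Jc[OF h]] n
        by simp
      also have "\<dots> = (\<Sum>i<d. \<alpha> h $$ (i,i)) + (\<Sum>i<s. \<beta> h $$ (i,i))"
        unfolding sum_lessThan_add using Jcol[OF h] n
        by (intro arg_cong2[of _ _ _ _ "(+)"] sum.cong) (auto simp: \<beta>_def)
      finally show ?thesis using mat_trace_sum[OF b(3)[OF h]] mat_trace_sum[OF \<beta>c] by simp
    qed
    show "\<beta> (g * h) = \<beta> g * \<beta> h" if gh: "g \<in> H" "h \<in> H" for g h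
    proof (rule eq_matI)
      fix i j assume "i < dim_row (\<beta> g * \<beta> h)" "j < dim_col (\<beta> g * \<beta> h)"
      then have ij: "i < s" "j < s" by (auto simp: \<beta>_def)
      then have ijn: "d + i < n" "d + j < n" using n by auto
      have "\<beta> (g * h) $$ (i,j) = (\<Sum>l<d + s. J g $$ (d + i, l) * J h $$ (l, d + j))"
        using ij Jmult[OF gh] mult_mat_index[OF Jc[OF gh(1)] Jc[OF gh(2)] ijn] n by (simp add: \<beta>_def)
      also have "\<dots> = (\<Sum>l<d. 0) + (\<Sum>l<s. \<beta> g $$ (i,l) * \<beta> h $$ (l,j))"
        unfolding sum_lessThan_add using Jcol[OF gh(1) ijn(1)] ij
        by (intro arg_cong2[of _ _ _ _ "(+)"] sum.cong) (auto simp: \<beta>_def)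
      finally show "\<beta> (g * h) $$ (i,j) = (\<beta> g * \<beta> h) $$ (i,j)"
        using mult_mat_index[OF \<beta>c \<beta>c ij] by simp
    qed (auto simp: \<beta>_def)
    have "J (1\<^sub>m n) = 1\<^sub>m n" using S' Sc by (simp add: J_def)
    then show "\<beta> (1\<^sub>m n) = 1\<^sub>m s" using n by (intro eq_matI) (auto simp: \<beta>_def)
  qed
qed


section \<open>Representations and special characters\<close>

lemma general_linear_simps:
  "x \<otimes>\<^bsub>general_linear n\<^esub> y = x * y" "\<one>\<^bsub>general_linear n\<^esub> = 1\<^sub>m n"
  "x \<in> carrier (general_linear n) \<longleftrightarrow> x \<in> carrier_mat n n \<and> (\<exists>y\<in>carrier_mat n n. y * x = 1\<^sub>m n \<and> x * y = 1\<^sub>m n)"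
  by (auto simp: general_linear_def units_of_def Units_def ring_mat_simps)

lemma group_general_linear: "group (general_linear n)"
  unfolding general_linear_def by (rule monoid.units_group) (rule ring.is_monoid[OF ring_mat])

lemma general_linear_homD:
  assumes G: "group G" and \<rho>: "\<rho> \<in> hom G (general_linear n)"
  shows "x \<in> carrier G \<Longrightarrow> \<rho> x \<in> carrier_mat n n"
    "x \<in> carrier G \<Longrightarrow> y \<in> carrier G \<Longrightarrow> \<rho> (x \<otimes>\<^bsub>G\<^esub> y) = \<rho> x * \<rho> y" "\<rho> \<one>\<^bsub>G\<^esub> = 1\<^sub>m n"
proof -
  interpret group_hom G "general_linear n" \<rho>
    using G \<rho> group_general_linear by (simp add: group_hom_def group_hom_axioms_def)
  show "x \<in> carrier G \<Longrightarrow> \<rho> x \<in> carrier_mat n n" using hom_closed by (simp add: general_linear_simps)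
  show "x \<in> carrier G \<Longrightarrow> y \<in> carrier G \<Longrightarrow> \<rho> (x \<otimes>\<^bsub>G\<^esub> y) = \<rho> x * \<rho> y"
    using hom_mult by (simp add: general_linear_simps)
  show "\<rho> \<one>\<^bsub>G\<^esub> = 1\<^sub>m n" using hom_one by (simp add: general_linear_simps)
qed

lemma general_linear_homI:
  assumes G: "group G" and c: "\<And>x. x \<in> carrier G \<Longrightarrow> \<rho> x \<in> carrier_mat n n"
    and m: "\<And>x y. x \<in> carrier G \<Longrightarrow> y \<in> carrier G \<Longrightarrow> \<rho> (x \<otimes>\<^bsub>G\<^esub> y) = \<rho> x * \<rho> y"
    and one: "\<rho> \<one>\<^bsub>G\<^esub> = 1\<^sub>m n"
  shows "\<rho> \<in> hom G (general_linear n)"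
proof (rule homI)
  interpret group G by (rule G)
  fix x assume x: "x \<in> carrier G"
  have "\<rho> (inv\<^bsub>G\<^esub> x) * \<rho> x = 1\<^sub>m n" "\<rho> x * \<rho> (inv\<^bsub>G\<^esub> x) = 1\<^sub>m n"
    using m[of "inv\<^bsub>G\<^esub> x" x] m[of x "inv\<^bsub>G\<^esub> x"] x one by auto
  then show "\<rho> x \<in> carrier (general_linear n)"
    unfolding general_linear_simps using c x by (intro conjI bexI[of _ "\<rho> (inv\<^bsub>G\<^esub> x)"]) auto
next
  fix x y assume "x \<in> carrier G" "y \<in> carrier G"
  then show "\<rho> (x \<otimes>\<^bsub>G\<^esub> y) = \<rho> x \<otimes>\<^bsub>general_linear n\<^esub> \<rho> y" using m by (simp add: general_linear_simps)
qed

lemma rep_image_mat_group: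
  assumes G: "group G" and \<rho>: "\<rho> \<in> hom G (general_linear n)"
  shows "mat_group n (\<rho> ` carrier G)"
proof -
  interpret group G by (rule G)
  note r = general_linear_homD[OF G \<rho>]
  have "\<exists>k\<in>\<rho> ` carrier G. \<rho> x * k = 1\<^sub>m n \<and> k * \<rho> x = 1\<^sub>m n" if "x \<in> carrier G" for x
    using r(2)[of "inv\<^bsub>G\<^esub> x" x] r(2)[of x "inv\<^bsub>G\<^esub> x"] r(3) that
    by (intro bexI[of _ "\<rho> (inv\<^bsub>G\<^esub> x)"]) auto
  moreover have "\<rho> x * \<rho> y \<in> \<rho> ` carrier G" if "x \<in> carrier G" "y \<in> carrier G" for x y
    using r(2)[OF that] that by (metis imageI m_closed)
  moreover have "1\<^sub>m n \<in> \<rho> ` carrier G" using r(3) one_closed by (metis imageI)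
  ultimately show ?thesis unfolding mat_group_def using r(1) by auto
qed

lemma irreducible_rep_iff:
  "irreducible_rep G n \<rho> \<longleftrightarrow> \<rho> \<in> hom G (general_linear n) \<and> irreducible_mats n (\<rho> ` carrier G)"
proof -
  have "\<rho> ` carrier G \<subseteq> carrier_mat n n" if "\<rho> \<in> hom G (general_linear n)"
    using that by (auto simp: hom_def Pi_def general_linear_simps)
  then show ?thesis
    unfolding irreducible_rep_def irreducible_mats_def subspace_module_vec_iff by auto
qed

lemma rep_pow:
  assumes G: "group G" and \<rho>: "\<rho> \<in> hom G (general_linear n)" and x: "x \<in> carrier G"
  shows "\<rho> (x [^]\<^bsub>G\<^esub> (k::nat)) = \<rho> x ^\<^sub>m k"
proof -
  interpret group G by (rule G)
  show ?thesis
    by (induction k) (use general_linear_homD[OF G \<rho>] x in \<open>auto simp: nat_pow_Suc carrier_matD[of _ n n]\<close>)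
qed

lemma affordsD:
  assumes "affords G n \<rho> \<chi>"
  shows "\<rho> \<in> hom G (general_linear n)" "x \<in> carrier G \<Longrightarrow> \<chi> x = mat_trace (\<rho> x)"
  using assms by (auto simp: affords_def)

lemma affords_one:
  assumes "group G" "affords G n \<rho> \<chi>"
  shows "\<chi> \<one>\<^bsub>G\<^esub> = of_nat n"
  using affordsD[OF assms(2)] general_linear_homD(3)[OF assms(1) affordsD(1)[OF assms(2)]] mat_trace_one
    monoid.one_closed[OF group.is_monoid[OF assms(1)]] by metis

lemma rep_trace:
  assumes G: "group G" "finite (carrier G)" and \<rho>: "\<rho> \<in> hom G (general_linear n)" and x: "x \<in> carrier G"
  shows "Re (mat_trace (\<rho> x)) \<le> real n" "Re (mat_trace (\<rho> x)) = real n \<Longrightarrow> \<rho> x = 1\<^sub>m n"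
proof -
  interpret group G by (rule G)
  have "\<rho> x ^\<^sub>m Coset.order G = 1\<^sub>m n"
    using rep_pow[OF G(1) \<rho> x, of "Coset.order G"] pow_order_eq_1[OF x] general_linear_homD(3)[OF G(1) \<rho>] by simp
  moreover have "Coset.order G > 0" using G(2) order_gt_0_iff_finite by blast
  ultimately show "Re (mat_trace (\<rho> x)) \<le> real n" "Re (mat_trace (\<rho> x)) = real n \<Longrightarrow> \<rho> x = 1\<^sub>m n"
    using trace_finite_order[OF general_linear_homD(1)[OF G(1) \<rho> x], of "Coset.order G"] by auto
qed

text \<open>Equality in the trace bound holds only at the identity matrix, so
  \<open>char_kernel\<close> is the kernel of every representation affording the character.\<close>

lemma affords_eq_one_iff:
  assumes G: "group G" "finite (carrier G)" and aff: "affords G n \<rho> \<chi>" and x: "x \<in> carrier G"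
  shows "\<chi> x = \<chi> \<one>\<^bsub>G\<^esub> \<longleftrightarrow> \<rho> x = 1\<^sub>m n"
proof
  assume "\<chi> x = \<chi> \<one>\<^bsub>G\<^esub>"
  then have "Re (mat_trace (\<rho> x)) = real n" using affords_one[OF G(1) aff] affordsD(2)[OF aff x] by simp
  then show "\<rho> x = 1\<^sub>m n" using rep_trace(2)[OF G affordsD(1)[OF aff] x] by simp
next
  assume "\<rho> x = 1\<^sub>m n"
  then show "\<chi> x = \<chi> \<one>\<^bsub>G\<^esub>" using affords_one[OF G(1) aff] affordsD(2)[OF aff x] mat_trace_one by simp
qed

text \<open>The codomain is cut down to the image, which makes the homomorphism onto and the first
  isomorphism theorem applicable; the codomain itself may be an infinite general linear
  group.\<close>

lemma (in group_hom) card_image_mult_kernel: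
  shows "card (h ` carrier G) * card (kernel G H h) = card (carrier G)"
proof -
  define H' where "H' = H\<lparr>carrier := h ` carrier G\<rparr>"
  have "group H'"
    unfolding H'_def using H.subgroup_imp_group[OF img_is_subgroup] .
  then interpret H': group_hom G H' h
    unfolding group_hom_def group_hom_axioms_def hom_def by (auto simp: H'_def)
  have "(\<lambda>X. the_elem (h ` X)) \<in> iso (G Mod kernel G H' h) H'"
    by (rule H'.FactGroup_iso_set) (simp add: H'_def)
  then have "card (carrier (G Mod kernel G H' h)) = card (carrier H')"
    by (auto simp: iso_def dest: bij_betw_same_card)
  moreover have "kernel G H' h = kernel G H h" by (simp add: kernel_def H'_def)
  ultimately have "card (rcosets\<^bsub>G\<^esub> kernel G H h) = card (h ` carrier G)"
    by (simp add: FactGroup_def H'_def)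
  then show ?thesis using G.lagrange[OF subgroup_kernel] by (simp add: Coset.order_def)
qed

lemma rep_normalizes:
  assumes G: "group G" and \<sigma>: "\<sigma> \<in> hom G (general_linear n)" and M: "M \<lhd> G"
  shows "normalizes (\<sigma> ` carrier G) (\<sigma> ` M)"
proof -
  interpret G: group G by (rule G)
  interpret M: normal M G by (rule M)
  note s = general_linear_homD[OF G \<sigma>]
  show ?thesis
    unfolding normalizes_def
  proof (intro ballI conjI)
    fix g h assume "g \<in> \<sigma> ` carrier G" "h \<in> \<sigma> ` M"
    then obtain x y where x: "x \<in> carrier G" "g = \<sigma> x" and y: "y \<in> M" "h = \<sigma> y" by auto
    note yc = M.mem_carrier[OF y(1)]
    have 1: "x \<otimes>\<^bsub>G\<^esub> y \<otimes>\<^bsub>G\<^esub> inv\<^bsub>G\<^esub> x \<in> M" "inv\<^bsub>G\<^esub> x \<otimes>\<^bsub>G\<^esub> y \<otimes>\<^bsub>G\<^esub> x \<in> M"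
      using x y M.inv_op_closed1 M.inv_op_closed2 by auto
    have "\<sigma> (x \<otimes>\<^bsub>G\<^esub> y \<otimes>\<^bsub>G\<^esub> inv\<^bsub>G\<^esub> x) * \<sigma> x = \<sigma> (x \<otimes>\<^bsub>G\<^esub> y \<otimes>\<^bsub>G\<^esub> inv\<^bsub>G\<^esub> x \<otimes>\<^bsub>G\<^esub> x)"
      using s(2)[of "x \<otimes>\<^bsub>G\<^esub> y \<otimes>\<^bsub>G\<^esub> inv\<^bsub>G\<^esub> x" x] x yc by simp
    also have "\<dots> = g * h" using x y yc s(2) by (simp add: G.m_assoc)
    finally show "\<exists>k\<in>\<sigma> ` M. g * h = k * g" using 1 x by (metis imageI)
    have "\<sigma> x * \<sigma> (inv\<^bsub>G\<^esub> x \<otimes>\<^bsub>G\<^esub> y \<otimes>\<^bsub>G\<^esub> x) = \<sigma> (x \<otimes>\<^bsub>G\<^esub> (inv\<^bsub>G\<^esub> x \<otimes>\<^bsub>G\<^esub> y \<otimes>\<^bsub>G\<^esub> x))"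
      using s(2)[of x "inv\<^bsub>G\<^esub> x \<otimes>\<^bsub>G\<^esub> y \<otimes>\<^bsub>G\<^esub> x"] x yc by simp
    also have "x \<otimes>\<^bsub>G\<^esub> (inv\<^bsub>G\<^esub> x \<otimes>\<^bsub>G\<^esub> y \<otimes>\<^bsub>G\<^esub> x) = y \<otimes>\<^bsub>G\<^esub> x"
      using x yc by (simp add: G.m_assoc[symmetric])
    also have "\<sigma> (y \<otimes>\<^bsub>G\<^esub> x) = h * g" using x y yc s(2) by simp
    finally show "\<exists>k\<in>\<sigma> ` M. h * g = g * k" using 1 x by (metis imageI)
  qed
qed

text \<open>Besides a constituent of degree dividing n, the injective intertwiner B is returned, so
  that a vector fixed under \<tau> can be carried back to the space of \<sigma>.\<close>

lemma irr_restrict_normal: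
  assumes G: "group G" and irr: "irreducible_rep G n \<sigma>" and aff: "affords G n \<sigma> \<gamma>"
    and M: "M \<lhd> G"
  obtains d B \<tau> where "irreducible_rep (G\<lparr>carrier := M\<rparr>) d \<tau>" "d dvd n" "inj_mat n d B"
    "\<And>x. x \<in> M \<Longrightarrow> \<sigma> x * B = B * \<tau> x"
    "restrict (\<lambda>x. mat_trace (\<tau> x)) M \<in> irr_constituents (G\<lparr>carrier := M\<rparr>) (restrict \<gamma> M)"
proof -
  interpret G: group G by (rule G)
  interpret M: normal M G by (rule M)
  let ?M = "G\<lparr>carrier := M\<rparr>"
  have gM: "group ?M" by (rule G.subgroup_imp_group[OF M.subgroup_axioms])
  have \<sigma>: "\<sigma> \<in> hom G (general_linear n)" and irrG: "irreducible_mats n (\<sigma> ` carrier G)"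
    using irr by (auto simp: irreducible_rep_iff)
  note s = general_linear_homD[OF G(1) \<sigma>]
  have n: "n > 0" using irrG by (simp add: irreducible_mats_def)
  have sM: "\<sigma> ` M \<subseteq> carrier_mat n n" using s(1) M.subset by auto
  obtain d B \<alpha> where bl: "irreducible_block n (\<sigma> ` M) d B \<alpha>" by (rule irreducible_block_exists[OF sM n])
  note b = irreducible_blockD[OF bl]
  have norm: "normalizes (\<sigma> ` carrier G) (\<sigma> ` M)" by (rule rep_normalizes[OF G(1) \<sigma> M])
  have ddvd: "d dvd n"
    by (rule irreducible_block_dvd[OF rep_image_mat_group[OF G(1) \<sigma>] irrG sM norm bl])
  define \<tau> where "\<tau> = \<alpha> \<circ> \<sigma>"
  \<comment> \<open>One verification serves both the action on the block and the action on the
    quotient.\<close>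
  have hom: "(\<beta> \<circ> \<sigma>) \<in> hom ?M (general_linear r)"
    if "\<And>h. h \<in> \<sigma> ` M \<Longrightarrow> \<beta> h \<in> carrier_mat r r"
      "\<And>g h. g \<in> \<sigma> ` M \<Longrightarrow> h \<in> \<sigma> ` M \<Longrightarrow> g * h \<in> \<sigma> ` M \<Longrightarrow> \<beta> (g * h) = \<beta> g * \<beta> h" "\<beta> (1\<^sub>m n) = 1\<^sub>m r" for \<beta> r
  proof (rule general_linear_homI[OF gM])
    fix x y assume xy: "x \<in> carrier ?M" "y \<in> carrier ?M"
    then show "(\<beta> \<circ> \<sigma>) x \<in> carrier_mat r r" using that by simp
    have eq: "\<sigma> (x \<otimes>\<^bsub>G\<^esub> y) = \<sigma> x * \<sigma> y" using s(2) xy M.mem_carrier by simp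
    have "\<sigma> x * \<sigma> y \<in> \<sigma> ` M" using xy M.m_closed unfolding eq[symmetric] by simp
    then show "(\<beta> \<circ> \<sigma>) (x \<otimes>\<^bsub>?M\<^esub> y) = (\<beta> \<circ> \<sigma>) x * (\<beta> \<circ> \<sigma>) y"
      using that(2)[of "\<sigma> x" "\<sigma> y"] xy eq by simp
  qed (use that s(3) in simp)
  have one: "1\<^sub>m n \<in> \<sigma> ` M" using s(3) M.one_closed by (metis imageI)
  have \<tau>: "\<tau> \<in> hom ?M (general_linear d)"
    unfolding \<tau>_def using b(3) irreducible_block_mult[OF bl sM] irreducible_block_one[OF bl one] by (intro hom) auto
  have irr\<tau>: "irreducible_rep ?M d \<tau>"
    unfolding irreducible_rep_iff using \<tau> b(5) by (simp add: \<tau>_def image_comp)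
  obtain r \<beta> where r: "n = d + r" and \<beta>: "\<And>h. h \<in> \<sigma> ` M \<Longrightarrow> \<beta> h \<in> carrier_mat r r"
    "\<And>h. h \<in> \<sigma> ` M \<Longrightarrow> mat_trace h = mat_trace (\<alpha> h) + mat_trace (\<beta> h)"
    "\<And>g h. g \<in> \<sigma> ` M \<Longrightarrow> h \<in> \<sigma> ` M \<Longrightarrow> g * h \<in> \<sigma> ` M \<Longrightarrow> \<beta> (g * h) = \<beta> g * \<beta> h"
    "\<beta> (1\<^sub>m n) = 1\<^sub>m r"
    by (rule irreducible_block_trace[OF sM bl]) blast
  define \<mu> where "\<mu> = restrict (\<lambda>x. mat_trace (\<tau> x)) M"
  define \<eta> where "\<eta> = restrict (\<lambda>x. mat_trace ((\<beta> \<circ> \<sigma>) x)) M"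
  have "affords ?M d \<tau> \<mu>" using \<tau> by (simp add: affords_def \<mu>_def)
  then have "\<mu> \<in> Irr ?M" using irr\<tau> by (auto simp: Irr_def)
  moreover have sum: "restrict \<gamma> M = restrict (\<lambda>x. \<mu> x + \<eta> x) M"
    using \<beta>(2) affordsD(2)[OF aff M.mem_carrier]
    by (intro restrict_ext) (simp add: \<mu>_def \<eta>_def \<tau>_def)
  moreover have "\<eta> \<in> characters ?M" if "r > 0"
  proof -
    have "affords ?M r (\<beta> \<circ> \<sigma>) \<eta>" using hom[OF \<beta>(1,3,4)] by (simp add: affords_def \<eta>_def)
    then show ?thesis using that unfolding characters_def by blast
  qed
  \<comment> \<open>An empty quotient has trace zero, which is not a character; the restriction is
    then itself irreducible and falls under the first alternative of
    \<open>irr_constituents\<close>.\<close>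
  moreover have "restrict \<gamma> M = \<mu>" if r0: "r = 0"
  proof -
    have "\<eta> x = 0" if "x \<in> M" for x
      using mat_trace_sum[OF \<beta>(1)[of "\<sigma> x"]] that r0 by (simp add: \<eta>_def)
    then show ?thesis unfolding sum by (auto simp: \<mu>_def)
  qed
  ultimately have "\<mu> \<in> irr_constituents ?M (restrict \<gamma> M)"
    unfolding irr_constituents_def by (cases "r = 0") auto
  moreover have "\<sigma> x * B = B * \<tau> x" if "x \<in> M" for x using b(4)[of "\<sigma> x"] that by (simp add: \<tau>_def)
  ultimately show ?thesis using that[OF irr\<tau> ddvd b(1)] unfolding \<mu>_def by blast
qed

section \<open>Coprimality and characters of degree one\<close>

lemma pi_numbers_coprime:
  assumes "pi_number \<pi> a" "\<And>p. p \<in> \<pi> \<Longrightarrow> \<not> p dvd b"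
  shows "coprime a b"
proof (rule ccontr)
  assume "\<not> coprime a b"
  then have "gcd a b \<noteq> 1" by (simp add: coprime_iff_gcd_eq_1)
  from prime_factor_nat[OF this] obtain p where "prime p" "p dvd gcd a b" by blast
  then have p: "prime p" "p dvd a" "p dvd b" by auto
  then have "p \<in> prime_factors a" using assms(1) by (auto simp: pi_number_def prime_factors_dvd)
  then show False using p assms by (auto simp: pi_number_def)
qed

lemma coprime_powers_eq_one:
  fixes z :: "'a :: field"
  assumes "coprime a b" "a \<noteq> 0" "z ^ a = 1" "z ^ b = 1"
  shows "z = 1"
proof -
  obtain x y where "a * x = b * y + 1" using bezout_nat[OF assms(2), of b] assms(1) by auto
  then have "z ^ (a * x) = z ^ (b * y + 1)" by simp
  then show ?thesis using assms(3,4) by (simp add: power_mult)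
qed

text \<open>Whichever representation \<open>det_char\<close> selects, its degree is the value of
  \<mu> at the identity; it consists of 1 by 1 matrices, whose determinant is their trace.\<close>

lemma det_char_degree_one:
  assumes G: "group G" and aff: "affords G 1 \<tau> \<mu>" and x: "x \<in> carrier G"
  shows "det_char G \<mu> x = \<mu> x"
proof -
  define \<rho> where "\<rho> = (SOME \<rho>. \<exists>n. affords G n \<rho> \<mu>)"
  have "\<exists>n. affords G n \<rho> \<mu>" unfolding \<rho>_def 
    by (rule someI_ex[where P = "\<lambda>\<rho>. \<exists>n. affords G n \<rho> \<mu>"]) (use aff in blast)
  then obtain n where n: "affords G n \<rho> \<mu>" by blast
  have "n = 1" using affords_one[OF G n] affords_one[OF G aff] by simp
  then have \<rho>: "\<rho> x \<in> carrier_mat 1 1" using general_linear_homD(1)[OF G affordsD(1)[OF n] x] by simp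
  have "det (\<rho> x) = mat_trace (\<rho> x)"
    using det_single[OF \<rho>] mat_trace_sum[OF \<rho>] by simp
  then show ?thesis using x affordsD(2)[OF n x] by (simp add: det_char_def \<rho>_def)
qed

text \<open>An irreducible constituent \<open>\<lambda>\<close> of \<open>\<gamma>\<^sub>M\<close> is a character of the \<open>\<pi>'\<close>-group \<open>M / L\<close>, so its degree divides
  the \<open>\<pi>'\<close>-number \<open>c\<close>, but it also divides the \<open>\<pi>\<close>-number \<open>\<gamma>(1)\<close>. Hence \<open>\<lambda>\<close> is linear, and being of \<open>\<pi>\<close>-order it
  is trivial.\<close>

lemma pi_special_trivial_on_section:
  assumes G: "group G" "finite (carrier G)" and spec: "pi_special \<pi> G \<gamma>"
    and irr: "irreducible_rep G n \<sigma>" and aff: "affords G n \<sigma> \<gamma>"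
    and M: "M \<lhd> G" and L: "L \<lhd> G" "L \<subseteq> M" "\<And>x. x \<in> L \<Longrightarrow> \<sigma> x = 1\<^sub>m n"
    and c: "card M = card L * c" "\<And>p. p \<in> \<pi> \<Longrightarrow> \<not> p dvd c" and x: "x \<in> M"
  shows "\<sigma> x = 1\<^sub>m n"
proof -
  interpret G: group G by (rule G)
  interpret M: normal M G by (rule M)
  let ?M = "G\<lparr>carrier := M\<rparr>"
  have gM: "group ?M" by (rule G.subgroup_imp_group[OF M.subgroup_axioms])
  have finM: "finite M" using G(2) M.subset finite_subset by blast
  have \<sigma>: "\<sigma> \<in> hom G (general_linear n)" and irrG: "irreducible_mats n (\<sigma> ` carrier G)"
    using irr by (auto simp: irreducible_rep_iff)
  note s = general_linear_homD[OF G(1) \<sigma>]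
  obtain d B \<tau> where \<tau>: "irreducible_rep ?M d \<tau>" and dn: "d dvd n" and B: "inj_mat n d B"
    and int: "\<And>x. x \<in> M \<Longrightarrow> \<sigma> x * B = B * \<tau> x"
    and const: "restrict (\<lambda>x. mat_trace (\<tau> x)) M \<in> irr_constituents ?M (restrict \<gamma> M)"
    using irr_restrict_normal[OF G(1) irr aff M] by metis
  define \<mu> where "\<mu> = restrict (\<lambda>x. mat_trace (\<tau> x)) M"
  have \<tau>hom: "\<tau> \<in> hom ?M (general_linear d)" and irr\<tau>: "irreducible_mats d (\<tau> ` M)"
    using \<tau> by (auto simp: irreducible_rep_iff)
  note t = general_linear_homD[OF gM \<tau>hom]
  have aff\<mu>: "affords ?M d \<tau> \<mu>" using \<tau>hom by (simp add: affords_def \<mu>_def)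
  have Bc: "B \<in> carrier_mat n d" using B by (simp add: inj_mat_def)
  have \<tau>L: "\<tau> y = 1\<^sub>m d" if y: "y \<in> L" for y
  proof -
    have "y \<in> M" using y L(2) by auto
    then have "B * \<tau> y = B * 1\<^sub>m d" using int[of y] L(3)[OF y] Bc by simp
    then show ?thesis using inj_mat_cancel_mat[OF B t(1)[of y] one_carrier_mat] \<open>y \<in> M\<close> by simp
  qed
  have "card M > 0" using finM M.one_closed card_gt_0_iff by blast
  then have "card L * c > 0" using c(1) by simp
  then have c0: "c > 0" "card L > 0" by simp_all
  \<comment> \<open>The kernel of \<tau> contains L, so the order of the image divides the index c
    of L in M.\<close>
  have "card (\<tau> ` M) dvd c"
  proof -
    interpret T: group_hom ?M "general_linear d" \<tau>
      using gM group_general_linear \<tau>hom by (simp add: group_hom_def group_hom_axioms_def)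
    let ?K = "kernel ?M (general_linear d) \<tau>"
    have K: "card (\<tau> ` M) * card ?K = card M" using T.card_image_mult_kernel by simp
    have "subgroup L G" using L(1) by (rule normal_imp_subgroup)
    then have "subgroup L ?M" using G.subgroup_incl[OF _ M.subgroup_axioms L(2)] by simp
    moreover have "L \<subseteq> ?K" using \<tau>L L(2) by (auto simp: kernel_def general_linear_simps)
    ultimately have "subgroup L (?M\<lparr>carrier := ?K\<rparr>)"
      using T.G.subgroup_incl[OF _ T.subgroup_kernel] by simp
    from group.lagrange[OF T.G.subgroup_imp_group[OF T.subgroup_kernel] this]
    have "card ?K = card L * card (rcosets\<^bsub>?M\<lparr>carrier := ?K\<rparr>\<^esub> L)"
      by (simp add: Coset.order_def mult.commute)
    then have "card L * (card (\<tau> ` M) * card (rcosets\<^bsub>?M\<lparr>carrier := ?K\<rparr>\<^esub> L)) = card L * c"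
      using K c(1) by (simp add: mult_ac)
    then have "card (\<tau> ` M) * card (rcosets\<^bsub>?M\<lparr>carrier := ?K\<rparr>\<^esub> L) = c" using c0 by simp
    then show ?thesis by (rule dvdI[OF sym])
  qed
  moreover have "mat_group d (\<tau> ` M)" using rep_image_mat_group[OF gM \<tau>hom] by simp
  ultimately have "d dvd c" using irreducible_degree_dvd[of d "\<tau> ` M"] irr\<tau> finM by auto
  moreover obtain e where "of_nat n = (of_nat e :: complex)" "pi_number \<pi> e"
    using spec affords_one[OF G(1) aff] unfolding pi_special_def by auto
  then have "pi_number \<pi> n" by simp
  then have "coprime n c" using c(2) by (rule pi_numbers_coprime)
  ultimately have d: "d = 1" using coprime_common_divisor[of n c d] dn by simp
  define k where "k = det_order ?M \<mu>"
  have "subnormal G M" using subnormal.step[OF subnormal.whole, of M G] M by simp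
  then have k: "pi_number \<pi> k"
    using spec const unfolding pi_special_def k_def \<mu>_def by blast
  have \<mu>mult: "\<mu> (y \<otimes>\<^bsub>G\<^esub> z) = \<mu> y * \<mu> z" if "y \<in> M" "z \<in> M" for y z
  proof -
    have "\<mu> (y \<otimes>\<^bsub>G\<^esub> z) = (\<tau> y * \<tau> z) $$ (0,0)"
      using that affordsD(2)[OF aff\<mu>, of "y \<otimes>\<^bsub>G\<^esub> z"] t(2)[of y z] mat_trace_sum[of "\<tau> y * \<tau> z" 1] t(1)[of y] t(1)[of z] d by simp
    also have "\<dots> = \<tau> y $$ (0,0) * \<tau> z $$ (0,0)"
      using mult_mat_index[of "\<tau> y" 1 1 "\<tau> z" 1 0 0] t(1)[of y] t(1)[of z] d that by simp
    finally show ?thesis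
      using affordsD(2)[OF aff\<mu>] mat_trace_sum[of "\<tau> y" 1] mat_trace_sum[of "\<tau> z" 1] t(1) d that by simp
  qed
  have \<mu>one: "\<mu> \<one>\<^bsub>G\<^esub> = 1" using affords_one[OF gM aff\<mu>] d by simp
  have \<mu>pow: "\<mu> (y [^]\<^bsub>G\<^esub> (j::nat)) = \<mu> y ^ j" if y: "y \<in> M" for y j
  proof (induction j)
    case (Suc j)
    have "y [^]\<^bsub>G\<^esub> j \<in> M" by (induction j) (use y in auto)
    then show ?case using \<mu>mult Suc y by (simp add: mult.commute)
  qed (simp add: \<mu>one)
  have det\<mu>: "det_char ?M \<mu> y = \<mu> y" if "y \<in> M" for y
    using det_char_degree_one[OF gM _ , of \<tau> \<mu> y] aff\<mu> d that by simp
  have "\<mu> x = 1" if x: "x \<in> M" for x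
  proof -
    have "\<mu> x ^ k = 1"
    proof -
      \<comment> \<open>\<open>det_order\<close> is a \<open>LEAST\<close>, so its defining property
        is available only once some positive exponent is known; the order of M is one.\<close>
      have "\<forall>y\<in>M. \<mu> y ^ card M = 1"
      proof
        fix y assume y: "y \<in> M"
        have "y [^]\<^bsub>?M\<^esub> Coset.order ?M = \<one>\<^bsub>?M\<^esub>" by (rule group.pow_order_eq_1[OF gM]) (simp add: y)
        then have "y [^]\<^bsub>G\<^esub> card M = \<one>\<^bsub>G\<^esub>" by (simp add: Coset.order_def nat_pow_def)
        then show "\<mu> y ^ card M = 1" using \<mu>pow[OF y, of "card M"] \<mu>one by simp
      qed
      moreover note \<open>card M > 0\<close>
      ultimately have "\<exists>j>0. \<forall>y\<in>carrier ?M. det_char ?M \<mu> y ^ j = 1" using det\<mu> by auto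
      then have "k > 0 \<and> (\<forall>y\<in>carrier ?M. det_char ?M \<mu> y ^ k = 1)"
        unfolding k_def det_order_def by (rule LeastI_ex)
      then show ?thesis using det\<mu> x by simp
    qed
    \<comment> \<open>The quotient M / L has order c, so x^c lies in L, where \<mu> is 1. Together
      with the \<pi>-number k as exponent this leaves only the value 1.\<close>
    moreover have "\<mu> x ^ c = 1"
    proof -
      have LM: "L \<lhd> ?M" using G.normal_restrict_supergroup[OF M.subgroup_axioms L(1,2)] .
      interpret LM: normal L ?M by (rule LM)
      interpret Q: group "?M Mod L" by (rule LM.factorgroup_is_group)
      have "Coset.order (?M Mod L) * card L = card M"
        using LM.lagrange[OF LM.subgroup_axioms] by (simp add: Coset.order_def FactGroup_def)
      then have "Coset.order (?M Mod L) = c" using c(1) c0 by simp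
      then have "(L #>\<^bsub>?M\<^esub> x) [^]\<^bsub>?M Mod L\<^esub> c = L"
        using Q.pow_order_eq_1[of "L #>\<^bsub>?M\<^esub> x"] x by (simp add: carrier_FactGroup)
      then have "L #>\<^bsub>?M\<^esub> (x [^]\<^bsub>?M\<^esub> c) = L" using LM.FactGroup_pow[of x c] x by simp
      moreover have "x [^]\<^bsub>?M\<^esub> c \<in> M" using LM.nat_pow_closed[of x c] x by simp
      ultimately have "x [^]\<^bsub>?M\<^esub> c \<in> L" using LM.coset_join1 LM.subgroup_axioms by simp
      then have "x [^]\<^bsub>G\<^esub> c \<in> L" by (simp add: nat_pow_def)
      then have "\<mu> (x [^]\<^bsub>G\<^esub> c) = 1"
        using \<tau>L affordsD(2)[OF aff\<mu>, of "x [^]\<^bsub>G\<^esub> c"] L(2) mat_trace_one[of d] d by auto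
      then show ?thesis using \<mu>pow[OF x] by simp
    qed
    ultimately show ?thesis
      using coprime_powers_eq_one[OF pi_numbers_coprime[OF k c(2)]] k by (simp add: pi_number_def)
  qed
  then have \<tau>1: "\<tau> y = 1\<^sub>m 1" if "y \<in> M" for y
    using affords_eq_one_iff[OF gM _ aff\<mu>, of y] finM \<mu>one d that by simp
  \<comment> \<open>B carries the basis vector of the trivial one-dimensional block to a nonzero
    vector fixed by M.\<close>
  define v where "v = B *\<^sub>v unit_vec 1 0"
  have v: "v \<in> carrier_vec n" using Bc d by (simp add: v_def)
  have v0: "v \<noteq> 0\<^sub>v n"
  proof
    assume "v = 0\<^sub>v n"
    then have "unit_vec 1 0 = (0\<^sub>v 1 :: complex vec)" using B d by (auto simp: inj_mat_def v_def)
    then have "unit_vec 1 0 $ 0 = (0\<^sub>v 1 :: complex vec) $ 0" by simp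
    then show False by simp
  qed
  have fixed: "h *\<^sub>v v = v" if h: "h \<in> \<sigma> ` M" for h
  proof -
    obtain y where y: "y \<in> M" "h = \<sigma> y" using h by auto
    have "h *\<^sub>v v = (\<sigma> y * B) *\<^sub>v unit_vec 1 0"
      unfolding v_def y using s(1)[of y] y(1) M.mem_carrier Bc d by simp
    also have "\<dots> = v" using int[OF y(1)] \<tau>1[OF y(1)] Bc d by (simp add: v_def)
    finally show ?thesis .
  qed
  have "\<sigma> ` M \<subseteq> carrier_mat n n" using s(1) M.subset by auto
  from normal_fixed_vector[OF irrG this rep_normalizes[OF G(1) \<sigma> M] v v0 fixed] x show ?thesis by simp
qed


section \<open>Induction from the nucleus\<close>

lemma subnormal_subgroup:
  assumes "subnormal G S" "group G"
  shows "subgroup S G"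
  using assms
proof (induction)
  case whole
  then show ?case by (rule group.subgroup_self)
next
  case (step S N)
  then show ?case using group.incl_subgroup normal_imp_subgroup by metis
qed

text \<open>In the recursion of \<open>nucleus\<close> the group is replaced by T, which has to be a
  group again for the induction to continue.\<close>

lemma inertia_subgroup:
  assumes G: "group G" and S: "subgroup S G"
  shows "subgroup (inertia_in_normalizer G S \<theta>) G"
proof -
  interpret G: group G by (rule G)
  interpret S: subgroup S G by (rule S)
  have N: "subgroup (normalizer G S) G" by (rule G.normalizer_imp_subgroup[OF S.subset])
  interpret N: subgroup "normalizer G S" G by (rule N)
  have conj: "g \<otimes>\<^bsub>G\<^esub> s \<otimes>\<^bsub>G\<^esub> inv\<^bsub>G\<^esub> g \<in> S" if "g \<in> normalizer G S" "s \<in> S" for g s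
  proof -
    have "(\<lambda>H\<in>{H. H \<subseteq> carrier G}. g <#\<^bsub>G\<^esub> H #>\<^bsub>G\<^esub> (inv\<^bsub>G\<^esub> g)) S = S"
      using that(1) unfolding normalizer_def stabilizer_def by blast
    then have "g <#\<^bsub>G\<^esub> S #>\<^bsub>G\<^esub> (inv\<^bsub>G\<^esub> g) = S"
      using S.subset by (simp only: restrict_apply mem_Collect_eq if_True)
    moreover have "g \<otimes>\<^bsub>G\<^esub> s \<otimes>\<^bsub>G\<^esub> inv\<^bsub>G\<^esub> g \<in> g <#\<^bsub>G\<^esub> S #>\<^bsub>G\<^esub> (inv\<^bsub>G\<^esub> g)"
      using that(2) by (auto simp: l_coset_def r_coset_def)
    ultimately show ?thesis by simp
  qed
  show ?thesis
  proof (rule G.subgroupI)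
    show "inertia_in_normalizer G S \<theta> \<subseteq> carrier G"
      using N.subset by (auto simp: inertia_in_normalizer_def)
    have "\<one>\<^bsub>G\<^esub> \<in> inertia_in_normalizer G S \<theta>"
      using N.one_closed by (simp add: inertia_in_normalizer_def)
    then show "inertia_in_normalizer G S \<theta> \<noteq> {}" by blast
  next
    fix g assume g: "g \<in> inertia_in_normalizer G S \<theta>"
    then have gN: "g \<in> normalizer G S" and gc: "g \<in> carrier G"
      using N.subset by (auto simp: inertia_in_normalizer_def)
    have "\<theta> (inv\<^bsub>G\<^esub> g \<otimes>\<^bsub>G\<^esub> s \<otimes>\<^bsub>G\<^esub> inv\<^bsub>G\<^esub> (inv\<^bsub>G\<^esub> g)) = \<theta> s" if s: "s \<in> S" for s
    proof -
      let ?t = "inv\<^bsub>G\<^esub> g \<otimes>\<^bsub>G\<^esub> s \<otimes>\<^bsub>G\<^esub> inv\<^bsub>G\<^esub> (inv\<^bsub>G\<^esub> g)"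
      have "?t \<in> S" using conj[OF N.m_inv_closed[OF gN] s] .
      then have "\<theta> (g \<otimes>\<^bsub>G\<^esub> ?t \<otimes>\<^bsub>G\<^esub> inv\<^bsub>G\<^esub> g) = \<theta> ?t" using g by (simp add: inertia_in_normalizer_def)
      moreover have "g \<otimes>\<^bsub>G\<^esub> ?t \<otimes>\<^bsub>G\<^esub> inv\<^bsub>G\<^esub> g = s"
        using gc S.mem_carrier[OF s] by (simp add: G.m_assoc) (simp add: G.m_assoc[symmetric])
      ultimately show ?thesis by simp
    qed
    then show "inv\<^bsub>G\<^esub> g \<in> inertia_in_normalizer G S \<theta>"
      using N.m_inv_closed[OF gN] by (simp add: inertia_in_normalizer_def)
  next
    fix g h assume gh: "g \<in> inertia_in_normalizer G S \<theta>" "h \<in> inertia_in_normalizer G S \<theta>"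
    then have N': "g \<in> normalizer G S" "h \<in> normalizer G S" by (auto simp: inertia_in_normalizer_def)
    have "\<theta> (g \<otimes>\<^bsub>G\<^esub> h \<otimes>\<^bsub>G\<^esub> s \<otimes>\<^bsub>G\<^esub> inv\<^bsub>G\<^esub> (g \<otimes>\<^bsub>G\<^esub> h)) = \<theta> s" if s: "s \<in> S" for s
    proof -
      let ?t = "h \<otimes>\<^bsub>G\<^esub> s \<otimes>\<^bsub>G\<^esub> inv\<^bsub>G\<^esub> h"
      have "g \<otimes>\<^bsub>G\<^esub> h \<otimes>\<^bsub>G\<^esub> s \<otimes>\<^bsub>G\<^esub> inv\<^bsub>G\<^esub> (g \<otimes>\<^bsub>G\<^esub> h) = g \<otimes>\<^bsub>G\<^esub> ?t \<otimes>\<^bsub>G\<^esub> inv\<^bsub>G\<^esub> g"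
        using N'[THEN N.mem_carrier] S.mem_carrier[OF s] by (simp add: G.m_assoc G.inv_mult_group)
      moreover have "\<theta> (g \<otimes>\<^bsub>G\<^esub> ?t \<otimes>\<^bsub>G\<^esub> inv\<^bsub>G\<^esub> g) = \<theta> ?t"
        using gh(1) conj[OF N'(2) s] by (simp add: inertia_in_normalizer_def)
      moreover have "\<theta> ?t = \<theta> s" using gh(2) s by (simp add: inertia_in_normalizer_def)
      ultimately show ?thesis by simp
    qed
    then show "g \<otimes>\<^bsub>G\<^esub> h \<in> inertia_in_normalizer G S \<theta>"
      using N.m_closed[OF N'] by (simp add: inertia_in_normalizer_def)
  qed
qed

text \<open>With the condition moved into the summand, the range of summation no longer depends on
  x, so sums can be interchanged and translated.\<close>

lemma induced_char_eq_sum: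
  assumes "finite (carrier G)" "x \<in> carrier G"
  shows "induced_char G W \<gamma> x =
    (\<Sum>g\<in>carrier G. if g \<otimes>\<^bsub>G\<^esub> x \<otimes>\<^bsub>G\<^esub> inv\<^bsub>G\<^esub> g \<in> W then \<gamma> (g \<otimes>\<^bsub>G\<^esub> x \<otimes>\<^bsub>G\<^esub> inv\<^bsub>G\<^esub> g) else 0) / of_nat (card W)"
  using assms by (simp add: induced_char_def sum.inter_filter)

lemma (in group) bij_betw_l_mult:
  assumes "t \<in> carrier G"
  shows "bij_betw (\<lambda>g. t \<otimes> g) (carrier G) (carrier G)"
  using assms by (intro bij_betwI[of _ _ _ "\<lambda>g. inv t \<otimes> g"]) (auto simp: m_assoc[symmetric])

text \<open>The inner induced character at the conjugate by g sums F over the coset T g. Summation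
  over all g then counts every element of G exactly |T| times, which cancels the outer
  denominator.\<close>

lemma induced_char_trans:
  assumes G: "group G" "finite (carrier G)" and T: "subgroup T G" and W: "W \<subseteq> T"
  shows "induced_char G T (induced_char (G\<lparr>carrier := T\<rparr>) W \<gamma>) = induced_char G W \<gamma>"
proof
  interpret G: group G by (rule G)
  interpret T: subgroup T G by (rule T)
  have finT: "finite T" using G(2) T.subset finite_subset by blast
  have T0: "card T \<noteq> 0" using finT T.one_closed card_0_eq by blast
  fix x
  show "induced_char G T (induced_char (G\<lparr>carrier := T\<rparr>) W \<gamma>) x = induced_char G W \<gamma> x"
  proof (cases "x \<in> carrier G")
    case x: True
    define c where "c = (\<lambda>g. g \<otimes>\<^bsub>G\<^esub> x \<otimes>\<^bsub>G\<^esub> inv\<^bsub>G\<^esub> g)"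
    define F where "F = (\<lambda>g. if c g \<in> W then \<gamma> (c g) else 0)"
    have conj: "t \<otimes>\<^bsub>G\<^esub> c g \<otimes>\<^bsub>G\<^esub> inv\<^bsub>G\<^esub> t = c (t \<otimes>\<^bsub>G\<^esub> g)" if "t \<in> T" "g \<in> carrier G" for t g
      using that x T.mem_carrier[of t] by (simp add: c_def G.m_assoc G.inv_mult_group)
    have inner: "(if c g \<in> T then induced_char (G\<lparr>carrier := T\<rparr>) W \<gamma> (c g) else 0)
        = (\<Sum>t\<in>T. F (t \<otimes>\<^bsub>G\<^esub> g)) / of_nat (card W)" if g: "g \<in> carrier G" for g
    proof (cases "c g \<in> T")
      case True
      let ?T = "G\<lparr>carrier := T\<rparr>"
      have "(if t \<otimes>\<^bsub>?T\<^esub> c g \<otimes>\<^bsub>?T\<^esub> inv\<^bsub>?T\<^esub> t \<in> W then \<gamma> (t \<otimes>\<^bsub>?T\<^esub> c g \<otimes>\<^bsub>?T\<^esub> inv\<^bsub>?T\<^esub> t) else 0)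
          = F (t \<otimes>\<^bsub>G\<^esub> g)" if t: "t \<in> T" for t
      proof -
        have "t \<otimes>\<^bsub>?T\<^esub> c g \<otimes>\<^bsub>?T\<^esub> inv\<^bsub>?T\<^esub> t = c (t \<otimes>\<^bsub>G\<^esub> g)"
          using conj[OF t g] G.m_inv_consistent[OF T t] by simp
        then show ?thesis unfolding F_def by (simp only:)
      qed
      then have "(\<Sum>t\<in>T. if t \<otimes>\<^bsub>?T\<^esub> c g \<otimes>\<^bsub>?T\<^esub> inv\<^bsub>?T\<^esub> t \<in> W then \<gamma> (t \<otimes>\<^bsub>?T\<^esub> c g \<otimes>\<^bsub>?T\<^esub> inv\<^bsub>?T\<^esub> t) else 0)
          = (\<Sum>t\<in>T. F (t \<otimes>\<^bsub>G\<^esub> g))" by (rule sum.cong[OF refl])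
      moreover have "induced_char ?T W \<gamma> (c g) =
          (\<Sum>t\<in>T. if t \<otimes>\<^bsub>?T\<^esub> c g \<otimes>\<^bsub>?T\<^esub> inv\<^bsub>?T\<^esub> t \<in> W then \<gamma> (t \<otimes>\<^bsub>?T\<^esub> c g \<otimes>\<^bsub>?T\<^esub> inv\<^bsub>?T\<^esub> t) else 0) / of_nat (card W)"
        using induced_char_eq_sum[of ?T "c g" W \<gamma>, unfolded partial_object.simps] True finT by simp
      ultimately show ?thesis using True by (simp only: if_True)
    next
      \<comment> \<open>If the conjugate by g is outside T, no further conjugation by T brings it
        into W, which lies inside T; both sides vanish.\<close>
      case False
      have "c (t \<otimes>\<^bsub>G\<^esub> g) \<notin> W" if t: "t \<in> T" for t
      proof
        assume "c (t \<otimes>\<^bsub>G\<^esub> g) \<in> W"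
        then have 1: "t \<otimes>\<^bsub>G\<^esub> c g \<otimes>\<^bsub>G\<^esub> inv\<^bsub>G\<^esub> t \<in> T" using conj[OF t g] W by auto
        have cg: "c g \<in> carrier G" using g x by (simp add: c_def)
        have "c g = inv\<^bsub>G\<^esub> t \<otimes>\<^bsub>G\<^esub> (t \<otimes>\<^bsub>G\<^esub> c g \<otimes>\<^bsub>G\<^esub> inv\<^bsub>G\<^esub> t) \<otimes>\<^bsub>G\<^esub> t"
          using T.mem_carrier[OF t] cg by (simp add: G.m_assoc) (simp add: G.m_assoc[symmetric])
        also have "\<dots> \<in> T" using 1 t by simp
        finally show False using False by simp
      qed
      then show ?thesis using False by (simp add: F_def)
    qed
    have "induced_char G T (induced_char (G\<lparr>carrier := T\<rparr>) W \<gamma>) x =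
        (\<Sum>g\<in>carrier G. if c g \<in> T then induced_char (G\<lparr>carrier := T\<rparr>) W \<gamma> (c g) else 0) / of_nat (card T)"
      unfolding c_def by (rule induced_char_eq_sum[OF G(2) x])
    also have "\<dots> = (\<Sum>g\<in>carrier G. (\<Sum>t\<in>T. F (t \<otimes>\<^bsub>G\<^esub> g)) / of_nat (card W)) / of_nat (card T)"
      by (intro arg_cong2[of _ _ _ _ "(/)"] sum.cong refl inner)
    also have "\<dots> = (\<Sum>t\<in>T. \<Sum>g\<in>carrier G. F (t \<otimes>\<^bsub>G\<^esub> g)) / of_nat (card W) / of_nat (card T)"
      by (subst sum.swap) (simp add: sum_divide_distrib)
    also have "\<dots> = (\<Sum>t\<in>T. \<Sum>g\<in>carrier G. F g) / of_nat (card W) / of_nat (card T)"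
      using sum.reindex_bij_betw[OF G.bij_betw_l_mult[OF T.mem_carrier], of _ F] by simp
    also have "\<dots> = (\<Sum>g\<in>carrier G. F g) / of_nat (card W)" using T0 by simp
    also have "\<dots> = induced_char G W \<gamma> x"
      unfolding F_def c_def by (rule induced_char_eq_sum[OF G(2) x, symmetric])
    finally show ?thesis .
  qed (simp add: induced_char_def)
qed

section \<open>The recursion of the nucleus as a single induction\<close>

lemma IrrE:
  assumes "\<chi> \<in> Irr G"
  obtains n \<rho> where "irreducible_rep G n \<rho>" "affords G n \<rho> \<chi>"
  using assms by (auto simp: Irr_def)

lemma affords_conj:
  assumes G: "group G" and aff: "affords G n \<rho> \<chi>" and xg: "x \<in> carrier G" "g \<in> carrier G"
  shows "\<chi> (g \<otimes>\<^bsub>G\<^esub> x \<otimes>\<^bsub>G\<^esub> inv\<^bsub>G\<^esub> g) = \<chi> x"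
proof -
  interpret G: group G by (rule G)
  note r = general_linear_homD[OF G affordsD(1)[OF aff]]
  have "\<chi> (g \<otimes>\<^bsub>G\<^esub> x \<otimes>\<^bsub>G\<^esub> inv\<^bsub>G\<^esub> g) = mat_trace (\<rho> (g \<otimes>\<^bsub>G\<^esub> x) * \<rho> (inv\<^bsub>G\<^esub> g))"
    using affordsD(2)[OF aff] r(2)[of "g \<otimes>\<^bsub>G\<^esub> x" "inv\<^bsub>G\<^esub> g"] xg by simp
  also have "\<dots> = mat_trace (\<rho> (inv\<^bsub>G\<^esub> g) * \<rho> (g \<otimes>\<^bsub>G\<^esub> x))" 
    by (rule mat_trace_comm[OF r(1) r(1)]) (use xg in auto)
  also have "\<dots> = mat_trace (\<rho> (inv\<^bsub>G\<^esub> g \<otimes>\<^bsub>G\<^esub> (g \<otimes>\<^bsub>G\<^esub> x)))" using r(2)[of "inv\<^bsub>G\<^esub> g" "g \<otimes>\<^bsub>G\<^esub> x"] xg by simp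
  also have "inv\<^bsub>G\<^esub> g \<otimes>\<^bsub>G\<^esub> (g \<otimes>\<^bsub>G\<^esub> x) = x" using xg by (simp add: G.m_assoc[symmetric])
  finally show ?thesis using affordsD(2)[OF aff] xg by simp
qed

lemma induced_char_self:
  assumes G: "group G" "finite (carrier G)" and "\<chi> \<in> Irr G"
  shows "induced_char G (carrier G) \<chi> = \<chi>"
proof
  interpret G: group G by (rule G)
  obtain n \<rho> where aff: "affords G n \<rho> \<chi>" using assms(3) by (auto simp: Irr_def)
  have "card (carrier G) \<noteq> 0" using G(2) by auto
  fix x show "induced_char G (carrier G) \<chi> x = \<chi> x"
  proof (cases "x \<in> carrier G")
    case True
    then show ?thesis
      using induced_char_eq_sum[OF G(2) True] affords_conj[OF G(1) aff True] \<open>card (carrier G) \<noteq> 0\<close> by simp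
  qed (use aff in \<open>simp add: induced_char_def affords_def\<close>)
qed

text \<open>Each recursive step writes the character as induced from T, and transitivity collapses
  the tower. At the base, induction from the whole group changes nothing because characters are
  class functions.\<close>

lemma nucleus_induced:
  assumes "nucleus \<pi> G \<chi> W \<gamma>" "group G" "finite (carrier G)"
  shows "subgroup W G \<and> induced_char G W \<gamma> = \<chi>"
  using assms
proof (induction)
  case (factored G \<chi>)
  then show ?case using induced_char_self group.subgroup_self by (auto simp: pi_factored_def)
next
  case (induce \<chi> G S \<theta> T \<psi> W \<gamma>)
  interpret G: group G by (rule induce.prems)
  have "subnormal G S"
    using induce.hyps by (simp add: maximal_factored_pair_def factored_pairs_def)
  then have "subgroup S G" by (rule subnormal_subgroup) (rule induce.prems)
  then have T: "subgroup T G" using inertia_subgroup[OF induce.prems(1)] induce.hyps by simp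
  have "finite T" using induce.prems(2) subgroup.subset[OF T] finite_subset by blast
  then have IH: "subgroup W (G\<lparr>carrier := T\<rparr>)" "induced_char (G\<lparr>carrier := T\<rparr>) W \<gamma> = \<psi>"
    using induce.IH G.subgroup_imp_group[OF T] by auto
  then have "W \<subseteq> T" using subgroup.subset by fastforce
  then show ?case
    using induced_char_trans[OF induce.prems T, of W \<gamma>] IH induce.hyps G.incl_subgroup[OF T] by simp
qed

text \<open>The value at x is a sum over all g of terms of real part at most n, divided by |W|, and
  at the identity every term is n. Equality forces every term to be maximal; the term g = 1 speaks
  about x itself, and n > 0 excludes that it is the value 0 taken outside W.\<close>

lemma induced_char_kernel:
  assumes G: "group G" "finite (carrier G)" and W: "subgroup W G"
    and irr: "irreducible_rep (G\<lparr>carrier := W\<rparr>) n \<sigma>" and aff: "affords (G\<lparr>carrier := W\<rparr>) n \<sigma> \<gamma>"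
    and x: "x \<in> carrier G" "induced_char G W \<gamma> x = induced_char G W \<gamma> \<one>\<^bsub>G\<^esub>"
  shows "x \<in> W" "\<sigma> x = 1\<^sub>m n"
proof -
  interpret G: group G by (rule G)
  interpret W: subgroup W G by (rule W)
  let ?W = "G\<lparr>carrier := W\<rparr>"
  have gW: "group ?W" by (rule G.subgroup_imp_group[OF W])
  have finW: "finite (carrier ?W)" using G(2) W.subset finite_subset by auto
  have n: "n > 0" using irr by (simp add: irreducible_rep_def)
  have "finite W" using finW by simp
  then have W0: "card W \<noteq> 0" using W.one_closed card_0_eq by blast
  define F where "F = (\<lambda>x g. if g \<otimes>\<^bsub>G\<^esub> x \<otimes>\<^bsub>G\<^esub> inv\<^bsub>G\<^esub> g \<in> W then \<gamma> (g \<otimes>\<^bsub>G\<^esub> x \<otimes>\<^bsub>G\<^esub> inv\<^bsub>G\<^esub> g) else 0)"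
  have F1: "F \<one>\<^bsub>G\<^esub> g = of_nat n" if "g \<in> carrier G" for g
    using that W.one_closed affords_one[OF gW aff] by (simp add: F_def)
  have le: "Re (F x g) \<le> real n" if "g \<in> carrier G" for g
    using rep_trace(1)[OF gW finW affordsD(1)[OF aff]] affordsD(2)[OF aff] by (simp add: F_def)
  have "(\<Sum>g\<in>carrier G. F x g) / of_nat (card W) = (\<Sum>g\<in>carrier G. F \<one>\<^bsub>G\<^esub> g) / of_nat (card W)"
    using x(2) unfolding induced_char_eq_sum[OF G(2) x(1)] induced_char_eq_sum[OF G(2) G.one_closed] F_def .
  then have "(\<Sum>g\<in>carrier G. F x g) = (\<Sum>g\<in>carrier G. F \<one>\<^bsub>G\<^esub> g)" using W0 by simp
  also have "\<dots> = (\<Sum>g\<in>carrier G. of_nat n)" using F1 by (rule sum.cong[OF refl])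
  finally have "Re (\<Sum>g\<in>carrier G. F x g) = Re (\<Sum>g\<in>carrier G. of_nat n)" by (rule arg_cong)
  then have "(\<Sum>g\<in>carrier G. Re (F x g)) = (\<Sum>g\<in>carrier G. real n)" unfolding Re_sum by simp
  then have "(\<Sum>g\<in>carrier G. real n - Re (F x g)) = 0" by (simp add: sum_subtractf)
  then have "real n - Re (F x \<one>\<^bsub>G\<^esub>) = 0"
    using le G(2) G.one_closed by (subst (asm) sum_nonneg_eq_0_iff) auto
  then have *: "Re (if x \<in> W then \<gamma> x else 0) = real n" using x(1) by (simp add: F_def)
  then show xW: "x \<in> W" using n by (auto split: if_splits)
  then have "Re (mat_trace (\<sigma> x)) = real n" using * affordsD(2)[OF aff, of x] by simp
  then show "\<sigma> x = 1\<^sub>m n" using rep_trace(2)[OF gW finW affordsD(1)[OF aff]] xW by simp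
qed


section \<open>Kernels\<close>

lemma pi_number_mult: "pi_number \<pi> a \<Longrightarrow> pi_number \<pi> b \<Longrightarrow> pi_number \<pi> (a * b)"
  by (auto simp: pi_number_def prime_factors_product)

lemma pi_number_dvd: "pi_number \<pi> b \<Longrightarrow> a dvd b \<Longrightarrow> pi_number \<pi> a"
  unfolding pi_number_def using dvd_prime_factors[of b a] by auto

lemma pi_number_compl_primes:
  assumes "\<forall>p\<in>\<pi>. prime p"
  shows "pi_number (compl_primes \<pi>) m \<longleftrightarrow> m \<noteq> 0 \<and> (\<forall>p\<in>\<pi>. \<not> p dvd m)"
proof (cases "m = 0")
  case False
  then have "prime_factors m \<subseteq> {p. prime p} - \<pi> \<longleftrightarrow> (\<forall>p. prime p \<longrightarrow> p dvd m \<longrightarrow> p \<notin> \<pi>)"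
    by (auto simp: prime_factors_dvd)
  then show ?thesis using False assms unfolding pi_number_def compl_primes_def by blast
qed (simp add: pi_number_def)

text \<open>\<open>pi_core\<close> is a \<open>GREATEST\<close> for inclusion and carries
  information only once a greatest element exists. A normal \<pi>-subgroup C of largest order is
  one: for any other N the quotient CN / C is an image of N, so CN is again a normal \<pi>-subgroup,
  and CN = C by maximality.\<close>

lemma pi_core_greatest:
  assumes G: "group G" "finite (carrier G)"
  shows "pi_core \<pi> G \<lhd> G" "pi_group \<pi> (G\<lparr>carrier := pi_core \<pi> G\<rparr>)"
    "\<And>N. N \<lhd> G \<Longrightarrow> pi_group \<pi> (G\<lparr>carrier := N\<rparr>) \<Longrightarrow> N \<subseteq> pi_core \<pi> G"
proof -
  interpret G: group G by (rule G)
  define P where "P = (\<lambda>N. N \<lhd> G \<and> pi_group \<pi> (G\<lparr>carrier := N\<rparr>))"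
  have P_iff: "P N \<longleftrightarrow> N \<lhd> G \<and> pi_number \<pi> (card N)" for N
    using G.subgroup_imp_group normal_imp_subgroup finite_subset[OF subgroup.subset G(2)]
    by (auto simp: P_def pi_group_def Coset.order_def)
  have "P {\<one>\<^bsub>G\<^esub>}" using G.one_is_normal by (simp add: P_iff pi_number_def)
  have "finite {N. P N}"
    by (rule finite_subset[of _ "Pow (carrier G)"])
      (use G(2) in \<open>auto simp: P_iff dest!: normal_imp_subgroup subgroup.subset\<close>)
  then have fin: "finite (card ` {N. P N})" by simp
  have "Max (card ` {N. P N}) \<in> card ` {N. P N}" using fin \<open>P {\<one>\<^bsub>G\<^esub>}\<close> by (intro Max_in) auto
  then obtain C where C: "P C" "card C = Max (card ` {N. P N})" by auto
  have max: "card N \<le> card C" if "P N" for N unfolding C(2) using fin that by (intro Max_ge) auto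
  have sub: "N \<subseteq> C" if N: "P N" for N
  proof -
    have n: "C \<lhd> G" "N \<lhd> G" using C N by (auto simp: P_iff)
    interpret second_isomorphism_grp C G N
      using n by (simp add: second_isomorphism_grp_def second_isomorphism_grp_axioms_def normal_imp_subgroup)
    let ?CN = "G\<lparr>carrier := C <#>\<^bsub>G\<^esub> N\<rparr>"
    have CN: "C <#>\<^bsub>G\<^esub> N \<lhd> G" by (rule G.normal_subgroup_set_mult_closed[OF n])
    have "card (carrier (?CN Mod C)) dvd card N"
      using group_hom.card_image_mult_kernel[OF normal_intersection_hom]
      unfolding normal_intersection_hom_surj by (intro dvdI[OF sym]) simp
    then have "pi_number \<pi> (card (carrier (?CN Mod C)))" using N pi_number_dvd by (auto simp: P_iff)
    moreover have "subgroup C ?CN"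
      using G.subgroup_incl[OF normal_imp_subgroup[OF n(1)] normal_imp_subgroup[OF CN] H_contained_in_set_mult] .
    then have "card (carrier (?CN Mod C)) * card C = card (C <#>\<^bsub>G\<^esub> N)"
      using group.lagrange[OF G.subgroup_imp_group[OF normal_imp_subgroup[OF CN]]]
      by (simp add: Coset.order_def FactGroup_def)
    ultimately have "P (C <#>\<^bsub>G\<^esub> N)" using CN C(1) pi_number_mult by (metis P_iff)
    then have "card (C <#>\<^bsub>G\<^esub> N) \<le> card C" by (rule max)
    moreover have "finite (C <#>\<^bsub>G\<^esub> N)"
      using finite_subset[OF subgroup.subset[OF normal_imp_subgroup[OF CN]] G(2)] .
    ultimately have "C = C <#>\<^bsub>G\<^esub> N" using H_contained_in_set_mult by (intro card_seteq) auto
    then show ?thesis using S_contained_in_set_mult by simp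
  qed
  have "pi_core \<pi> G = C"
    unfolding pi_core_def P_def[symmetric] using C(1) sub by (intro Greatest_equality) auto
  then show "pi_core \<pi> G \<lhd> G" "pi_group \<pi> (G\<lparr>carrier := pi_core \<pi> G\<rparr>)"
    "\<And>N. N \<lhd> G \<Longrightarrow> pi_group \<pi> (G\<lparr>carrier := N\<rparr>) \<Longrightarrow> N \<subseteq> pi_core \<pi> G"
    using C(1) sub by (auto simp: P_def)
qed

section \<open>Normality of kernels and orders of sections\<close>

lemma char_kernel_normal:
  assumes G: "group G" "finite (carrier G)" and aff: "affords G n \<rho> \<chi>"
  shows "char_kernel G \<chi> \<lhd> G"
proof -
  interpret group_hom G "general_linear n" \<rho>
    using G affordsD(1)[OF aff] group_general_linear by (simp add: group_hom_def group_hom_axioms_def)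
  have "char_kernel G \<chi> = kernel G (general_linear n) \<rho>"
    using affords_eq_one_iff[OF G aff] by (auto simp: char_kernel_def kernel_def general_linear_simps)
  then show ?thesis using normal_kernel by simp
qed

text \<open>Needed for the normality of L: its generating set is closed under conjugation because
  conjugates of \<pi>-elements are \<pi>-elements.\<close>

lemma (in group) ord_conj:
  assumes "x \<in> carrier G" "g \<in> carrier G"
  shows "ord (g \<otimes> x \<otimes> inv g) = ord x"
proof -
  have pow: "(g \<otimes> x \<otimes> inv g) [^] (k::nat) = g \<otimes> x [^] k \<otimes> inv g" for k
  proof (induction k)
    case (Suc k)
    have "(g \<otimes> x \<otimes> inv g) [^] Suc k = (g \<otimes> x [^] k \<otimes> inv g) \<otimes> (g \<otimes> x \<otimes> inv g)" using Suc by simp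
    also have "\<dots> = g \<otimes> x [^] k \<otimes> (inv g \<otimes> g) \<otimes> x \<otimes> inv g" using assms by (simp only: m_assoc m_closed inv_closed nat_pow_closed)
    also have "\<dots> = g \<otimes> x [^] Suc k \<otimes> inv g" using assms by (simp add: m_assoc)
    finally show ?case .
  qed (use assms in simp)
  have "(g \<otimes> x \<otimes> inv g) [^] k = \<one> \<longleftrightarrow> x [^] k = \<one>" for k :: nat
  proof
    assume "(g \<otimes> x \<otimes> inv g) [^] k = \<one>"
    then have "g \<otimes> x [^] k \<otimes> inv g = \<one>" using pow by simp
    then have "g \<otimes> x [^] k = g" using assms by (metis inv_solve_right l_one m_closed nat_pow_closed one_closed)
    then show "x [^] k = \<one>" using assms by (metis l_cancel_one nat_pow_closed)
  qed (use pow assms in simp)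
  then show ?thesis using assms by (simp add: pow_eq_id) (meson dvd_antisym dvd_refl)
qed

lemma kernel_coset_map:
  assumes "normal L G"
  shows "kernel G (G Mod L) (\<lambda>x. L #>\<^bsub>G\<^esub> x) = L"
proof -
  interpret normal L G by (rule assms)
  have "L #>\<^bsub>G\<^esub> x = L \<longleftrightarrow> x \<in> L" if "x \<in> carrier G" for x
    using coset_join1[OF _ that subgroup_axioms] coset_join2[OF that subgroup_axioms] by blast
  then show ?thesis using subset by (auto simp: kernel_def)
qed

text \<open>The section N / L is taken as a set of cosets in \<open>G Mod L\<close>, so that all
  sections over L, and the core they are compared with, live in one group.\<close>

lemma card_coset_image:
  assumes L: "L \<lhd> G" and N: "subgroup N G" "L \<subseteq> N"
  shows "card ((\<lambda>x. L #>\<^bsub>G\<^esub> x) ` N) * card L = card N"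
proof -
  interpret L: normal L G by (rule L)
  interpret Q: group "G Mod L" by (rule L.factorgroup_is_group)
  let ?N = "G\<lparr>carrier := N\<rparr>"
  note sub = subsetD[OF subgroup.subset[OF N(1)]]
  have "(\<lambda>x. L #>\<^bsub>G\<^esub> x) \<in> hom ?N (G Mod L)"
  proof (rule homI)
    fix x y assume xy: "x \<in> carrier ?N" "y \<in> carrier ?N"
    show "L #>\<^bsub>G\<^esub> x \<in> carrier (G Mod L)" using hom_in_carrier[OF L.r_coset_hom_Mod, of x] sub xy by simp
    show "L #>\<^bsub>G\<^esub> (x \<otimes>\<^bsub>?N\<^esub> y) = (L #>\<^bsub>G\<^esub> x) \<otimes>\<^bsub>G Mod L\<^esub> (L #>\<^bsub>G\<^esub> y)"
      using hom_mult[OF L.r_coset_hom_Mod, of x y] sub xy by simp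
  qed
  then interpret h: group_hom ?N "G Mod L" "\<lambda>x. L #>\<^bsub>G\<^esub> x"
    using L.subgroup_imp_group[OF N(1)] Q.group_axioms unfolding group_hom_def group_hom_axioms_def by blast
  have "kernel ?N (G Mod L) (\<lambda>x. L #>\<^bsub>G\<^esub> x) = N \<inter> kernel G (G Mod L) (\<lambda>x. L #>\<^bsub>G\<^esub> x)"
    using subgroup.subset[OF N(1)] by (auto simp: kernel_def)
  then show ?thesis using h.card_image_mult_kernel kernel_coset_map[OF L] N(2) by (simp add: Int_absorb1)
qed

text \<open>Any element of \<open>N\<close> conjugate into \<open>W\<close> lies in \<open>N \<inter> W \<le> ker \<gamma>\<close>, so \<open>\<gamma>\<^sup>G\<close> is nonnegative on \<open>N\<close>; hence its
  restriction to \<open>N\<close> contains the trivial character.\<close>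

lemma induced_special_kernel:
  assumes G: "group G" "finite (carrier G)" and W: "subgroup W G"
    and spec: "pi_special \<pi> (G\<lparr>carrier := W\<rparr>) \<gamma>"
    and irr: "irreducible_rep G m \<rho>" and aff: "affords G m \<rho> \<chi>" and ind: "induced_char G W \<gamma> = \<chi>"
    and N: "N \<lhd> G" and L: "L \<lhd> G" "L \<subseteq> N" "L \<subseteq> char_kernel G \<chi>"
    and c: "card N = card L * c" "\<And>p. p \<in> \<pi> \<Longrightarrow> \<not> p dvd c"
  shows "N \<subseteq> char_kernel G \<chi>"
proof -
  interpret G: group G by (rule G)
  interpret W: subgroup W G by (rule W)
  interpret N: normal N G by (rule N)
  let ?W = "G\<lparr>carrier := W\<rparr>" and ?M = "G\<lparr>carrier := N \<inter> W\<rparr>"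
  have gW: "group ?W" by (rule G.subgroup_imp_group[OF W])
  have finW: "finite (carrier ?W)" using G(2) W.subset finite_subset by auto
  have finN: "finite N" using G(2) N.subset finite_subset by auto
  have "\<gamma> \<in> Irr ?W" using spec by (simp add: pi_special_def)
  then obtain n \<sigma> where \<sigma>: "irreducible_rep ?W n \<sigma>" and aff\<sigma>: "affords ?W n \<sigma> \<gamma>" by (rule IrrE)
  have n: "n > 0" using \<sigma> by (simp add: irreducible_rep_def)
  have LW: "x \<in> W" "\<sigma> x = 1\<^sub>m n" if "x \<in> L" for x
    using induced_char_kernel[OF G W \<sigma> aff\<sigma>, of x] L(3) that unfolding ind char_kernel_def by auto
  have sM: "subgroup (N \<inter> W) G" using G.subgroups_Inter_pair[OF N.subgroup_axioms W] .
  have M: "N \<inter> W \<lhd> ?W"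
  proof -
    interpret second_isomorphism_grp N G W
      using N W by (simp add: second_isomorphism_grp_def second_isomorphism_grp_axioms_def)
    show ?thesis using normal_subgrp_intersection_normal by (simp add: Int_commute)
  qed
  have LnW: "L \<lhd> ?W" using G.normal_restrict_supergroup[OF W L(1)] LW by auto
  have LM: "L \<subseteq> N \<inter> W" using LW L(2) by auto
  have cM: "card ((\<lambda>x. L #>\<^bsub>G\<^esub> x) ` (N \<inter> W)) * card L = card (N \<inter> W)" by (rule card_coset_image[OF L(1) sM LM])
  define c' where "c' = card ((\<lambda>x. L #>\<^bsub>G\<^esub> x) ` (N \<inter> W))"
  \<comment> \<open>The index of L in N \<inter> W divides its index c in N, so no prime of \<pi>
    divides it either.\<close>
  have "c' dvd c"
  proof -
    have "subgroup (N \<inter> W) (G\<lparr>carrier := N\<rparr>)" using G.subgroup_incl[OF sM N.subgroup_axioms] by simp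
    from group.lagrange[OF G.subgroup_imp_group[OF N.subgroup_axioms] this]
    obtain b where "b * card (N \<inter> W) = card N" by (auto simp: Coset.order_def)
    then have "card L * c = b * (c' * card L)" using c(1) cM unfolding c'_def by simp
    then have "card L * c = card L * (c' * b)" by (simp only: mult_ac)
    moreover have "card L \<noteq> 0"
    proof
      assume "card L = 0"
      then have "card N = 0" using c(1) by (simp only: mult_0)
      moreover have "card N \<noteq> 0" using finN N.one_closed card_0_eq by blast
      ultimately show False by (rule notE[rotated])
    qed
    ultimately have "c = c' * b" by (simp only: mult_cancel1 simp_thms)
    then show ?thesis by simp
  qed
  then have c': "\<not> p dvd c'" if "p \<in> \<pi>" for p using c(2)[OF that] dvd_trans by blast
  have NW: "\<gamma> y = of_nat n" if "y \<in> N \<inter> W" for y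
  proof -
    have "card (N \<inter> W) = card L * c'" unfolding c'_def cM[symmetric] by (rule mult.commute)
    from pi_special_trivial_on_section[OF gW finW spec \<sigma> aff\<sigma> M LnW LM LW(2) this c' that]
    show ?thesis using affordsD(2)[OF aff\<sigma>, of y] that mat_trace_one[of n] by simp
  qed
  \<comment> \<open>This is the formula for the induced character with \<gamma> replaced by its
    constant value n on N \<inter> W.\<close>
  define k where "k = (\<lambda>y. real n * real (card {g \<in> carrier G. g \<otimes>\<^bsub>G\<^esub> y \<otimes>\<^bsub>G\<^esub> inv\<^bsub>G\<^esub> g \<in> W}) / real (card W))"
  have k: "\<chi> y = of_real (k y)" if y: "y \<in> N" for y
  proof -
    have "(\<Sum>g \<in> {g \<in> carrier G. g \<otimes>\<^bsub>G\<^esub> y \<otimes>\<^bsub>G\<^esub> inv\<^bsub>G\<^esub> g \<in> W}. \<gamma> (g \<otimes>\<^bsub>G\<^esub> y \<otimes>\<^bsub>G\<^esub> inv\<^bsub>G\<^esub> g))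
        = (\<Sum>g \<in> {g \<in> carrier G. g \<otimes>\<^bsub>G\<^esub> y \<otimes>\<^bsub>G\<^esub> inv\<^bsub>G\<^esub> g \<in> W}. of_nat n)"
      using NW N.inv_op_closed2[OF _ y] by (intro sum.cong) auto
    then show ?thesis
      using N.mem_carrier[OF y] unfolding ind[symmetric] induced_char_def k_def by (simp add: mult.commute)
  qed
  have "k \<one>\<^bsub>G\<^esub> > 0"
  proof -
    have "{g \<in> carrier G. g \<otimes>\<^bsub>G\<^esub> \<one>\<^bsub>G\<^esub> \<otimes>\<^bsub>G\<^esub> inv\<^bsub>G\<^esub> g \<in> W} = carrier G" using W.one_closed by auto
    moreover have "card (carrier G) > 0" using G(2) G.one_closed card_gt_0_iff by blast
    moreover have "finite W" using finW by simp
    then have "card W > 0" using W.one_closed card_gt_0_iff by blast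
    ultimately show ?thesis
      using n unfolding k_def by (intro divide_pos_pos mult_pos_pos) (simp_all only: of_nat_0_less_iff)
  qed
  moreover have "k y \<ge> 0" for y by (simp add: k_def)
  ultimately have "(\<Sum>y\<in>N. k y) > 0" using finN N.one_closed by (intro sum_pos2) auto
  then have sum_ne: "(\<Sum>y\<in>N. \<chi> y) \<noteq> 0" using k by (simp flip: of_real_sum)
  have \<rho>: "\<rho> \<in> hom G (general_linear m)" and irr\<rho>: "irreducible_mats m (\<rho> ` carrier G)"
    using irr by (auto simp: irreducible_rep_iff)
  note r = general_linear_homD[OF G(1) \<rho>]
  \<comment> \<open>P is |N| times the projection onto the vectors fixed by N. Its trace is the
    nonzero sum of \<chi> over N, so some column is nonzero, and translation by N shows that every
    column is fixed.\<close>
  define P where "P = mat m m (\<lambda>(i,j). \<Sum>y\<in>N. \<rho> y $$ (i,j))"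
  have P: "P \<in> carrier_mat m m" by (simp add: P_def)
  have "(\<Sum>i<m. P $$ (i,i)) = (\<Sum>y\<in>N. \<Sum>i<m. \<rho> y $$ (i,i))"
    by (subst sum.swap) (simp add: P_def)
  also have "\<dots> = (\<Sum>y\<in>N. \<chi> y)"
    using affordsD(2)[OF aff] mat_trace_sum[OF r(1)] N.mem_carrier by (intro sum.cong) auto
  finally obtain i where i: "i < m" "P $$ (i,i) \<noteq> 0" using sum_ne by (metis (no_types, lifting) lessThan_iff sum.neutral)
  define v where "v = col P i"
  have "v $ i = P $$ (i,i)" using P i by (simp add: v_def)
  then have "v \<noteq> 0\<^sub>v m" using i by auto
  moreover have "v \<in> carrier_vec m" using P unfolding v_def by (intro carrier_vecI) simp
  ultimately have v: "v \<in> carrier_vec m" "v \<noteq> 0\<^sub>v m" by simp_all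
  have fixed: "h *\<^sub>v v = v" if h: "h \<in> \<rho> ` N" for h
  proof -
    obtain z where z: "z \<in> N" "h = \<rho> z" using h by auto
    note zc = N.mem_carrier[OF z(1)]
    show ?thesis
    proof (rule eq_vecI)
      fix j assume "j < dim_vec v"
      then have j: "j < m" using P by (simp add: v_def)
      have "(h *\<^sub>v v) $ j = (\<Sum>l<m. \<rho> z $$ (j,l) * (\<Sum>y\<in>N. \<rho> y $$ (l,i)))"
        unfolding z(2) mult_mat_vec_index[OF r(1)[OF zc] v(1) j] using i by (intro sum.cong) (auto simp: v_def P_def)
      also have "\<dots> = (\<Sum>y\<in>N. \<Sum>l<m. \<rho> z $$ (j,l) * \<rho> y $$ (l,i))"
        unfolding sum_distrib_left by (rule sum.swap)
      also have "\<dots> = (\<Sum>y\<in>N. \<rho> (z \<otimes>\<^bsub>G\<^esub> y) $$ (j,i))"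
        using r(2)[OF zc N.mem_carrier] mult_mat_index[OF r(1)[OF zc] r(1)[OF N.mem_carrier] j i(1)] by (intro sum.cong) auto
      also have "\<dots> = (\<Sum>y\<in>N. \<rho> y $$ (j,i))"
      proof (rule sum.reindex_bij_betw[of "\<lambda>y. z \<otimes>\<^bsub>G\<^esub> y" N N "\<lambda>y. \<rho> y $$ (j,i)"])
        show "bij_betw (\<lambda>y. z \<otimes>\<^bsub>G\<^esub> y) N N"
          using group.bij_betw_l_mult[OF G.subgroup_imp_group[OF N.subgroup_axioms], of z] z by simp
      qed
      also have "\<dots> = v $ j" using i j by (simp add: v_def P_def)
      finally show "(h *\<^sub>v v) $ j = v $ j" .
    qed (use r(1)[OF zc] z v in auto)
  qed
  have "\<rho> ` N \<subseteq> carrier_mat m m" using r(1) N.subset by auto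
  from normal_fixed_vector[OF irr\<rho> this rep_normalizes[OF G(1) \<rho> N] v fixed]
  have "\<rho> x = 1\<^sub>m m" if "x \<in> N" for x using that by blast
  then show ?thesis using affords_eq_one_iff[OF G aff] N.mem_carrier unfolding char_kernel_def by blast
qed

text \<open>A Sylow \<open>p\<close>-subgroup of \<open>K\<close> consists of \<open>\<pi>\<close>-elements, so it is contained in \<open>L\<close>.\<close>

lemma pi_element_free_index:
  assumes G: "group G" "finite (carrier G)" and K: "subgroup K G" and L: "subgroup L G" "L \<subseteq> K"
    and gen: "\<And>x. x \<in> K \<Longrightarrow> x \<in> pi_elements \<pi> G \<Longrightarrow> x \<in> L"
    and c: "card K = card L * c" and p: "p \<in> \<pi>" "prime p"
  shows "\<not> p dvd c"
proof
  interpret G: group G by (rule G)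
  let ?K = "G\<lparr>carrier := K\<rparr>"
  have gK: "group ?K" by (rule G.subgroup_imp_group[OF K])
  have finK: "finite K" using finite_subset[OF subgroup.subset[OF K] G(2)] .
  have "card K \<noteq> 0" using finK subgroup.one_closed[OF K] card_0_eq by blast
  define a where "a = multiplicity p (card K)"
  have "p ^ a dvd card K" unfolding a_def by (rule multiplicity_dvd)
  then obtain m where m: "card K = p ^ a * m" by blast
  obtain P where P: "subgroup P ?K" "card P = p ^ a"
    using sylow_thm[OF p(2) gK, of a m] m finK by (auto simp: Coset.order_def)
  have PG: "subgroup P G" by (rule G.incl_subgroup[OF K P(1)])
  have PK: "P \<subseteq> K" using subgroup.subset[OF P(1)] by simp
  have "x \<in> L" if x: "x \<in> P" for x
  proof (rule gen)
    show "x \<in> K" using PK x by auto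
    have xc: "x \<in> carrier G" using subgroup.mem_carrier[OF PG x] .
    have "x [^]\<^bsub>G\<lparr>carrier := P\<rparr>\<^esub> Coset.order (G\<lparr>carrier := P\<rparr>) = \<one>\<^bsub>G\<lparr>carrier := P\<rparr>\<^esub>"
      using group.pow_order_eq_1[OF G.subgroup_imp_group[OF PG], of x] x by simp
    then have "x [^]\<^bsub>G\<^esub> (p ^ a) = \<one>\<^bsub>G\<^esub>" using P(2) by (simp add: Coset.order_def nat_pow_def)
    then have "G.ord x dvd p ^ a" using G.pow_eq_id[OF xc] by simp
    moreover have "pi_number \<pi> (p ^ a)"
      using p by (auto simp: pi_number_def prime_factorization_prime_power)
    ultimately have "pi_number \<pi> (G.ord x)" by (rule pi_number_dvd[rotated])
    then show "x \<in> pi_elements \<pi> G" using xc by (simp add: pi_elements_def)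
  qed
  then have "subgroup P (G\<lparr>carrier := L\<rparr>)" using G.subgroup_incl[OF PG L(1)] by auto
  from group.lagrange[OF G.subgroup_imp_group[OF L(1)] this]
  obtain b where "b * card P = card L" by (auto simp: Coset.order_def)
  then have b: "card L = b * p ^ a" using P(2) by simp
  \<comment> \<open>L already contains the full p-part of the order of K, so another factor p in the
    index would give \<open>p ^ Suc a\<close> dividing that order.\<close>
  assume "p dvd c"
  then obtain e where "c = p * e" by blast
  then have "card K = p ^ Suc a * (b * e)" using c b by simp
  then have "p ^ Suc a dvd card K" by simp
  then have "Suc a \<le> a" unfolding a_def using p(2) \<open>card K \<noteq> 0\<close> by (metis power_dvd_iff_le_multiplicity not_prime_unit)
  then show False by simp
qed

theorem theorem2:
  fixes G :: "('a, 'b) monoid_scheme" and \<pi> :: "nat set" and \<chi> :: "'a \<Rightarrow> complex"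
  assumes "\<forall>p\<in>\<pi>. prime p"
    and "group G" and "finite (carrier G)"
    and "pi_separable \<pi> G"
    and "\<chi> \<in> B_pi \<pi> G"
  shows "char_kernel G \<chi> = partial_K \<pi> G (pi_restriction \<pi> G \<chi>)"
proof -
  note G = assms(2,3) and \<pi> = assms(1)[rule_format]
  interpret G: group G by (rule G)
  obtain W \<gamma> where \<chi>: "\<chi> \<in> Irr G" and nuc: "nucleus \<pi> G \<chi> W \<gamma>" and spec: "pi_special \<pi> (G\<lparr>carrier := W\<rparr>) \<gamma>"
    using assms(5) by (auto simp: B_pi_def)
  have W: "subgroup W G" "induced_char G W \<gamma> = \<chi>" using nucleus_induced[OF nuc G] by auto
  obtain m \<rho> where irr: "irreducible_rep G m \<rho>" and aff: "affords G m \<rho> \<chi>" using \<chi> by (rule IrrE)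
  define K where "K = char_kernel G \<chi>"
  define X where "X = K \<inter> pi_elements \<pi> G"
  define L where "L = partial_L \<pi> G (pi_restriction \<pi> G \<chi>)"
  have Kn: "K \<lhd> G" unfolding K_def by (rule char_kernel_normal[OF G aff])
  have K: "subgroup K G" by (rule normal_imp_subgroup[OF Kn])
  \<comment> \<open>The identity must count as a \<pi>-element: only then is the value of
    \<open>pi_restriction\<close> there \<chi>(1) and not \<open>undefined\<close>, and the
    generators of L are the \<pi>-elements of K.\<close>
  have "G.ord \<one>\<^bsub>G\<^esub> = 1" using G.ord_eq_1[OF G.one_closed] by simp
  then have "\<one>\<^bsub>G\<^esub> \<in> pi_elements \<pi> G" by (simp add: pi_elements_def pi_number_def)
  then have "{x \<in> pi_elements \<pi> G. pi_restriction \<pi> G \<chi> x = pi_restriction \<pi> G \<chi> \<one>\<^bsub>G\<^esub>} = X"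
    by (auto simp: X_def K_def char_kernel_def pi_restriction_def pi_elements_def)
  then have L_gen: "L = generate G X" by (simp add: L_def partial_L_def)
  have Xc: "X \<subseteq> carrier G" by (auto simp: X_def pi_elements_def)
  have Ln: "L \<lhd> G"
    unfolding L_gen
  proof (rule G.normal_generateI[OF Xc])
    fix h g assume hg: "h \<in> X" "g \<in> carrier G"
    then have h: "h \<in> K" "h \<in> carrier G" "pi_number \<pi> (G.ord h)" by (auto simp: X_def pi_elements_def)
    have "g \<otimes>\<^bsub>G\<^esub> h \<otimes>\<^bsub>G\<^esub> inv\<^bsub>G\<^esub> g \<in> K" using normal.inv_op_closed2[OF Kn hg(2) h(1)] .
    then show "g \<otimes>\<^bsub>G\<^esub> h \<otimes>\<^bsub>G\<^esub> inv\<^bsub>G\<^esub> g \<in> X"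
      using G.ord_conj[OF h(2) hg(2)] h hg(2) by (simp add: X_def pi_elements_def)
  qed
  have L: "subgroup L G" by (rule normal_imp_subgroup[OF Ln])
  have LK: "L \<subseteq> K" unfolding L_gen by (rule G.generate_subgroup_incl[OF _ K]) (simp add: X_def)
  interpret L: normal L G by (rule Ln)
  let ?Q = "G Mod L" and ?\<pi>' = "compl_primes \<pi>" and ?q = "\<lambda>x. L #>\<^bsub>G\<^esub> x"
  have Q: "group ?Q" by (rule L.factorgroup_is_group)
  have finQ: "finite (carrier ?Q)" unfolding carrier_FactGroup using G(2) by simp
  define C where "C = pi_core ?\<pi>' ?Q"
  note core = pi_core_greatest[OF Q finQ, where \<pi> = "compl_primes \<pi>", folded C_def]
  \<comment> \<open>N is \<open>partial_K\<close> unfolded, the preimage of the core C in G.\<close>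
  define N where "N = {x \<in> carrier G. ?q x \<in> C}"
  have "K \<subseteq> N"
  proof -
    have c: "card K = card L * card (?q ` K)" using card_coset_image[OF Ln K LK] by (simp add: mult.commute)
    have hom: "group_hom G ?Q ?q"
      unfolding group_hom_def group_hom_axioms_def using G.group_axioms Q L.r_coset_hom_Mod by blast
    have Kq: "?q ` K \<lhd> ?Q"
      using normal.surj_hom_normal_subgroup[OF Kn hom] by (simp add: carrier_FactGroup)
    \<comment> \<open>The image of K in the quotient is normal of order |K : L|; once this order is
      a \<pi>'-number, maximality of the core absorbs the image.\<close>
    have "\<not> p dvd card (?q ` K)" if "p \<in> \<pi>" for p
    proof (rule pi_element_free_index[OF G K L LK _ c that \<pi>[OF that]])
      fix x assume "x \<in> K" "x \<in> pi_elements \<pi> G"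
      then show "x \<in> L" unfolding L_gen by (intro generate.incl) (simp add: X_def)
    qed
    moreover have fin: "finite (?q ` K)" using finite_subset[OF subgroup.subset[OF K] G(2)] by simp
    then have "card (?q ` K) \<noteq> 0" using subgroup.one_closed[OF K] by auto
    ultimately have "pi_number ?\<pi>' (card (?q ` K))"
      unfolding pi_number_compl_primes[OF assms(1)] by blast
    then have "pi_group ?\<pi>' (?Q\<lparr>carrier := ?q ` K\<rparr>)"
      unfolding pi_group_def Coset.order_def
      using fin group.subgroup_imp_group[OF Q normal_imp_subgroup[OF Kq]] by simp
    then have "?q ` K \<subseteq> C" by (rule core(3)[OF Kq])
    then show ?thesis using subgroup.subset[OF K] by (auto simp: N_def)
  qed
  moreover have "N \<subseteq> K"
    unfolding K_def
  proof (rule induced_special_kernel[OF G W(1) spec irr aff W(2)])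
    have Csub: "subgroup C ?Q" by (rule normal_imp_subgroup[OF core(1)])
    have one: "L \<in> C" using subgroup.one_closed[OF Csub] by simp
    have qhom: "?q (x \<otimes>\<^bsub>G\<^esub> y) = ?q x \<otimes>\<^bsub>?Q\<^esub> ?q y" if "x \<in> carrier G" "y \<in> carrier G" for x y
      by (rule hom_mult[OF L.r_coset_hom_Mod that])
    interpret q: group_hom G ?Q ?q
      unfolding group_hom_def group_hom_axioms_def using G.group_axioms Q L.r_coset_hom_Mod by blast
    have Nsub: "subgroup N G"
    proof (rule G.subgroupI)
      show "N \<subseteq> carrier G" by (auto simp: N_def)
      have "\<one>\<^bsub>G\<^esub> \<in> N" using subgroup.one_closed[OF Csub] q.hom_one by (simp add: N_def)
      then show "N \<noteq> {}" by blast
      show "inv\<^bsub>G\<^esub> x \<in> N" if "x \<in> N" for x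
        using that subgroup.m_inv_closed[OF Csub, of "?q x"] q.hom_inv[of x] by (simp add: N_def)
      show "x \<otimes>\<^bsub>G\<^esub> y \<in> N" if "x \<in> N" "y \<in> N" for x y
        using that subgroup.m_closed[OF Csub, of "?q x" "?q y"] qhom[of x y] unfolding N_def by auto
    qed
    show Nn: "N \<lhd> G"
    proof (rule G.normal_invI[OF Nsub])
      fix x h assume xh: "x \<in> carrier G" "h \<in> N"
      then have h: "h \<in> carrier G" "?q h \<in> C" by (auto simp: N_def)
      have "?q (x \<otimes>\<^bsub>G\<^esub> h \<otimes>\<^bsub>G\<^esub> inv\<^bsub>G\<^esub> x) = ?q x \<otimes>\<^bsub>?Q\<^esub> ?q h \<otimes>\<^bsub>?Q\<^esub> inv\<^bsub>?Q\<^esub> ?q x"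
        unfolding qhom[OF G.m_closed[OF xh(1) h(1)] G.inv_closed[OF xh(1)]] qhom[OF xh(1) h(1)]
          q.hom_inv[OF xh(1)] ..
      also have "\<dots> \<in> C"
        by (rule normal.inv_op_closed2[OF core(1) hom_in_carrier[OF L.r_coset_hom_Mod xh(1)] h(2)])
      finally show "x \<otimes>\<^bsub>G\<^esub> h \<otimes>\<^bsub>G\<^esub> inv\<^bsub>G\<^esub> x \<in> N" using xh(1) h(1) by (simp add: N_def)
    qed
    show "L \<lhd> G" by (rule Ln)
    show LN: "L \<subseteq> N"
      using one G.coset_join2[OF _ L] L.mem_carrier by (auto simp: N_def)
    show "L \<subseteq> char_kernel G \<chi>" using LK by (simp add: K_def)
    \<comment> \<open>Every element of C is a coset of L, so the preimage maps onto C and the index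
      of L in N is the \<pi>'-number |C|.\<close>
    have "?q ` N = C"
      using subgroup.subset[OF Csub] by (auto simp: N_def carrier_FactGroup)
    then show "card N = card L * card C"
      using card_coset_image[OF Ln Nsub LN] by (simp add: mult.commute)
    show "\<not> p dvd card C" if "p \<in> \<pi>" for p
      using core(2) that unfolding pi_group_def Coset.order_def pi_number_compl_primes[OF assms(1)] by simp
  qed
  moreover have "partial_K \<pi> G (pi_restriction \<pi> G \<chi>) = N"
    by (simp add: partial_K_def N_def C_def L_def)
  ultimately show ?thesis by (simp add: K_def)
qed

end
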